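(* Let $X\subseteq\mathbb{K}^n$ be a rational trinomial hypersurface $T_0^{l_0}+T_1^{l_1}+T_2^{l_2}=0$ of type I, with the monomials numbered so that $d=1$, $d_{01}=d_{02}=1$ and $d_{12}=s$, and let $S:\bar N\to N$ be any homomorphism with $S\circ F=\mathrm{id}_N$ (all notation as in the context). Let $\sigma=S(\mathbb{Q}^n_{\ge0}\cap N_{\mathbb{Q}})\subseteq N_{\mathbb{Q}}$, let $\zeta\in\mathbb{K}$ be a primitive $s$-th root of unity, and put $$\Delta_0=\mathrm{conv}\Big\{S\Big(\tfrac{1}{l_{0j}}e_{j}\Big)\ \Big|\ j=1,\dots,n_0\Big\}+\sigma,$$ $$\Delta_1=\mathrm{conv}\Big\{S\Big(\tfrac{s}{l_{1j}}e_{n_0+j}\Big)\ \Big|\ j=1,\dots,n_1\Big\}+\sigma,$$ $$\Delta_2=\mathrm{conv}\Big\{S\Big(\tfrac{s}{l_{2j}}e_{n_0+n_1+j}\Big)\ \Big|\ j=1,\dots,n_2\Big\}+\sigma.$$ Then $$\mathfrak{D}=\Delta_0\cdot\sum_{k=0}^{s-1}\{\zeta^k\}+\Delta_1\cdot\{0\}+\Delta_2\cdot\{\infty\}$$ is a proper $\sigma$-polyhedral divisor on $\mathbb{P}^1$ corresponding to the complexity one torus action of $T$ on $X$.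
   Context: $\mathbb{K}$ is an algebraically closed field of characteristic $0$. For a point $z\in\mathbb{P}^1=\mathbb{K}\cup\{\infty\}$, $\{z\}$ denotes the corresponding prime divisor. Trinomial hypersurfaces. Let $n_0,n_1,n_2$ be positive integers, $n=n_0+n_1+n_2$. For $i=0,1,2$ let $l_i=(l_{i1},\dots,l_{in_i})$ be a tuple of positive integers, and assume that for no $i$ one has $n_i=1$ and $l_{i1}=1$. Put $T_i^{l_i}=T_{i1}^{l_{i1}}\cdots T_{in_i}^{l_{in_i}}$. The trinomial hypersurface is $X=\{T_0^{l_0}+T_1^{l_1}+T_2^{l_2}=0\}\subseteq\mathbb{K}^n$, the coordinates being ordered $T_{01},\dots,T_{0n_0},T_{11},\dots,T_{1n_1},T_{21},\dots,T_{2n_2}$. Numbers. $d_i=\gcd(l_{i1},\dots,l_{in_i})$, $d=\gcd(d_0,d_1,d_2)$, $d_{ij}=\gcd(d_i/d,d_j/d)$. $X$ is a rational trinomial hypersurface of type I if, up to renumbering of the three monomials, $d=1$, $d_{01}=d_{02}=1$, $d_{12}=s$ for some positive integer $s$. Torus action. Let $\bar T=(\mathbb{K}^\times)^n$ act diagonally on $\mathbb{K}^n$; its lattice of one-parameter subgroups is $\bar N=\mathbb{Z}^n$ with standard basis $e_1,\dots,e_n$. Let $L:\bar N\to\mathbb{Z}^2$ be given by the $2\times n$ matrix $\begin{pmatrix}-l_0&l_1&0\\-l_0&0&l_2\end{pmatrix}$, let $N=\ker L$, and let $F:N\to\bar N$ be the inclusion. The subtorus $T\subseteq\bar T$ with one-parameter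 subgroup lattice $N$ has dimension $n-2$ and preserves $X$; this is the complexity one torus action on $X$. Let $M=\mathrm{Hom}(N,\mathbb{Z})$, $N_{\mathbb{Q}}=\mathbb{Q}\otimes N$, $M_{\mathbb{Q}}=\mathbb{Q}\otimes M$. The action gives an $M$-grading on $\mathbb{K}[X]$ in which the $k$-th coordinate function has degree $e_k^*\circ F\in M$. The map $S$ is extended $\mathbb{Q}$-linearly to $\bar N_{\mathbb{Q}}=\mathbb{Q}^n\to N_{\mathbb{Q}}$. Polyhedral divisors. Let $\sigma\subseteq N_{\mathbb{Q}}$ be a polyhedral cone with dual cone $\sigma^\vee\subseteq M_{\mathbb{Q}}$. The recession cone of a polyhedron is the cone of directions of rays contained in it. On a normal variety $Y$, consider finite formal sums $\mathfrak{D}=\sum_i\Delta_i\cdot D_i$ with $D_i$ Weil divisors on $Y$ and $\Delta_i\subseteq N_{\mathbb{Q}}$ polyhedra with recession cone $\sigma$. For $u\in\sigma^\vee$ put $\mathfrak{D}(u)=\sum_i\min_{v\in\Delta_i}\langle u,v\rangle\cdot D_i$, a rational Weil divisor. For a rational Weil divisor $D$ let $\Gamma(Y,\mathcal{O}(D))=\{f\in\mathbb{K}(Y)^\times\mid (f)+D\ge 0\}\cup\{0\}$, and for $0\ne f\in\Gamma(Y,\mathcal{O}(D))$ put $Y_f=Y\setminus\mathrm{Supp}(D+(f))$. $D$ is semiample if for some $m\in\mathbb{Z}_{>0}$ the sets $Y_f$, $0\neq f\in\Gamma(Y,\mathcal{O}(mD))$, cover $Y$; $D$ is big if for some $m\in\mathbb{Z}_{>0}$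 there is $0\neq f\in\Gamma(Y,\mathcal{O}(mD))$ with $Y_f$ affine. $\mathfrak{D}$ is a proper $\sigma$-polyhedral divisor (pp-divisor) if $\mathfrak{D}(u)$ is $\mathbb{Q}$-Cartier and semiample for all $u\in\sigma^\vee$, and big for all $u$ in the relative interior of $\sigma^\vee$. The pp-divisor $\mathfrak{D}$ on a projective normal variety $Y$ corresponds to the $T$-action on the normal affine variety $X$ if there is an isomorphism of $M$-graded algebras $\mathbb{K}[X]\cong\bigoplus_{m\in\sigma^\vee\cap M}\Gamma(Y,\mathcal{O}(\mathfrak{D}(m)))$, where multiplication on the right is that of $\mathbb{K}(Y)$. *)

theory Defs
  imports
    "HOL-Analysis.Analysis"
    "HOL-Library.Function_Algebras"
    "HOL-Library.Poly_Mapping"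
    "HOL-Computational_Algebra.Computational_Algebra"
begin

section \<open>Rational polyhedral geometry in \<open>\<rat> \<otimes> N\<close>\<close>

definition rat_vec :: "int ^ 'n \<Rightarrow> rat ^ 'n::finite" where
  "rat_vec v = (\<chi> k. of_int (v $ k))"

text \<open>
  For a subgroup \<open>N\<close> of \<open>\<int>\<^sup>n\<close>, the space \<open>\<rat> \<otimes> N\<close> is identified with the rational span of \<open>N\<close>
  in \<open>\<rat>\<^sup>n\<close>.
\<close>

definition NQ :: "(int ^ 'n) set \<Rightarrow> (rat ^ 'n::finite) set" where
  "NQ N = {q. \<exists>m::nat. m > 0 \<and> (\<exists>v\<in>N. of_nat m *s q = rat_vec v)}"

text \<open>
  \<open>\<rat> \<otimes> M\<close> is the dual space of \<open>\<rat> \<otimes> N\<close>. Its elements are made total by the value 0 outside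
  \<open>NQ N\<close>, so that distinct functionals are distinct functions and addition is pointwise.
  \<open>M = Hom(N, \<int>)\<close> consists of the functionals that are integral on \<open>N\<close>.
\<close>

definition MQ :: "(int ^ 'n) set \<Rightarrow> (rat ^ 'n::finite \<Rightarrow> rat) set" where
  "MQ N = {u. (\<forall>v\<in>NQ N. \<forall>w\<in>NQ N. u (v + w) = u v + u w) \<and>
              (\<forall>r. \<forall>v\<in>NQ N. u (r *s v) = r * u v) \<and>
              (\<forall>v. v \<notin> NQ N \<longrightarrow> u v = 0)}"

definition M_lattice :: "(int ^ 'n) set \<Rightarrow> (rat ^ 'n::finite \<Rightarrow> rat) set" where
  "M_lattice N = {u \<in> MQ N. \<forall>v\<in>N. u (rat_vec v) \<in> \<int>}"

definition rat_polyhedron :: "(int ^ 'n) set \<Rightarrow> (rat ^ 'n::finite) set \<Rightarrow> bool" where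
  "rat_polyhedron N \<Delta> \<longleftrightarrow>
     (\<exists>H. finite H \<and> H \<subseteq> MQ N \<times> UNIV \<and> \<Delta> = {v \<in> NQ N. \<forall>(u, c)\<in>H. c \<le> u v})"

definition rat_polyhedral_cone :: "(int ^ 'n) set \<Rightarrow> (rat ^ 'n::finite) set \<Rightarrow> bool" where
  "rat_polyhedral_cone N \<sigma> \<longleftrightarrow>
     (\<exists>H. finite H \<and> H \<subseteq> MQ N \<and> \<sigma> = {v \<in> NQ N. \<forall>u\<in>H. 0 \<le> u v})"

definition recession_cone :: "(int ^ 'n) set \<Rightarrow> (rat ^ 'n::finite) set \<Rightarrow> (rat ^ 'n) set" where
  "recession_cone N \<Delta> = {w \<in> NQ N. \<exists>v\<in>\<Delta>. \<forall>r\<ge>0. v + r *s w \<in> \<Delta>}"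

definition dual_cone :: "(int ^ 'n) set \<Rightarrow> (rat ^ 'n::finite) set \<Rightarrow> (rat ^ 'n \<Rightarrow> rat) set" where
  "dual_cone N \<sigma> = {u \<in> MQ N. \<forall>v\<in>\<sigma>. 0 \<le> u v}"

definition rat_convex_hull :: "(rat ^ 'n::finite) set \<Rightarrow> (rat ^ 'n) set" where
  "rat_convex_hull A =
     {\<Sum>a\<in>F. c a *s a | F c. finite F \<and> F \<subseteq> A \<and> (\<forall>a\<in>F. 0 \<le> c a) \<and> sum c F = 1}"

definition functional_affine_hull ::
    "(rat ^ 'n::finite \<Rightarrow> rat) set \<Rightarrow> (rat ^ 'n \<Rightarrow> rat) set" where
  "functional_affine_hull C =
     {(\<lambda>v. \<Sum>u\<in>F. c u * u v) | F c. finite F \<and> F \<subseteq> C \<and> sum c F = 1}"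

text \<open>
  The interior relative to the affine hull. The usual topology of the finite-dimensional space
  \<open>MQ N\<close> is that of pointwise convergence on \<open>NQ N\<close>; the pairs \<open>B, \<epsilon>\<close> describe its basic
  neighbourhoods of \<open>u\<close>.
\<close>

definition functional_rel_interior ::
    "(int ^ 'n) set \<Rightarrow> (rat ^ 'n::finite \<Rightarrow> rat) set \<Rightarrow> (rat ^ 'n \<Rightarrow> rat) set" where
  "functional_rel_interior N C =
     {u \<in> C. \<exists>B \<epsilon>. finite B \<and> B \<subseteq> NQ N \<and> \<epsilon> > 0 \<and>
        (\<forall>w\<in>functional_affine_hull C. (\<forall>v\<in>B. \<bar>w v - u v\<bar> < \<epsilon>) \<longrightarrow> w \<in> C)}"


section \<open>Affine varieties as spaces with functions\<close>

inductive_set generated_algebra :: "('x \<Rightarrow> 'k::comm_ring_1) set \<Rightarrow> ('x \<Rightarrow> 'k) set"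
  for G :: "('x \<Rightarrow> 'k) set" where
  generator: "g \<in> G \<Longrightarrow> g \<in> generated_algebra G"
| const: "(\<lambda>_. c) \<in> generated_algebra G"
| add: "f \<in> generated_algebra G \<Longrightarrow> g \<in> generated_algebra G \<Longrightarrow>
    (\<lambda>x. f x + g x) \<in> generated_algebra G"
| mult: "f \<in> generated_algebra G \<Longrightarrow> g \<in> generated_algebra G \<Longrightarrow>
    (\<lambda>x. f x * g x) \<in> generated_algebra G"

text \<open>
  \<open>\<A>\<^sup>r\<close> is modelled by sequences vanishing from index \<open>r\<close> on, because \<open>r\<close> is quantified over in the
  definition of an affine variety.
\<close>

definition affine_space :: "nat \<Rightarrow> (nat \<Rightarrow> 'k::field) set" where
  "affine_space r = {x. \<forall>i\<ge>r. x i = 0}"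

definition affine_space_polys :: "nat \<Rightarrow> ((nat \<Rightarrow> 'k::field) \<Rightarrow> 'k) set" where
  "affine_space_polys r = generated_algebra {\<lambda>x. x i | i. i < r}"

definition zariski_closed :: "nat \<Rightarrow> (nat \<Rightarrow> 'k::field) set \<Rightarrow> bool" where
  "zariski_closed r Z \<longleftrightarrow>
     (\<exists>E\<subseteq>affine_space_polys r. Z = {x \<in> affine_space r. \<forall>P\<in>E. P x = 0})"

definition zariski_open_in :: "nat \<Rightarrow> (nat \<Rightarrow> 'k::field) set \<Rightarrow> (nat \<Rightarrow> 'k) set \<Rightarrow> bool" where
  "zariski_open_in r Z V \<longleftrightarrow> V \<subseteq> Z \<and> zariski_closed r (Z - V)"

definition regular_on_affine ::
    "nat \<Rightarrow> (nat \<Rightarrow> 'k::field) set \<Rightarrow> (nat \<Rightarrow> 'k) set \<Rightarrow> ((nat \<Rightarrow> 'k) \<Rightarrow> 'k) \<Rightarrow> bool" where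
  "regular_on_affine r Z V h \<longleftrightarrow>
     (\<forall>x\<in>V. \<exists>W P Q. x \<in> W \<and> W \<subseteq> V \<and> zariski_open_in r Z W \<and>
        P \<in> affine_space_polys r \<and> Q \<in> affine_space_polys r \<and>
        (\<forall>y\<in>W. Q y \<noteq> 0 \<and> h y = P y / Q y))"


section \<open>The projective line\<close>

datatype 'k proj_line = Pt 'k | Infinity

definition proj_open :: "'k proj_line set \<Rightarrow> bool" where
  "proj_open V \<longleftrightarrow> V = {} \<or> finite (- V)"

text \<open>
  A form of degree \<open>d\<close> in two variables is given by its dehomogenisation \<open>F\<close> with
  \<open>degree F \<le> d\<close>; it is evaluated at the representatives \<open>[z : 1]\<close> and \<open>[1 : 0]\<close>.
\<close>

fun form_eval :: "nat \<Rightarrow> 'k::field poly \<Rightarrow> 'k proj_line \<Rightarrow> 'k" where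
  "form_eval d F (Pt z) = poly F z"
| "form_eval d F Infinity = coeff F d"

definition regular_on_proj :: "'k::field proj_line set \<Rightarrow> ('k proj_line \<Rightarrow> 'k) \<Rightarrow> bool" where
  "regular_on_proj V h \<longleftrightarrow>
     (\<forall>p\<in>V. \<exists>W d F G. p \<in> W \<and> W \<subseteq> V \<and> proj_open W \<and> degree F \<le> d \<and> degree G \<le> d \<and>
        (\<forall>q\<in>W. form_eval d G q \<noteq> 0 \<and> h q = form_eval d F q / form_eval d G q))"

text \<open>
  An open subset of \<open>\<P>\<^sup>1\<close> is affine if it is isomorphic, as a space with functions, to a
  closed subset of some affine space.
\<close>

definition proj_affine :: "'k::field proj_line set \<Rightarrow> bool" where
  "proj_affine U \<longleftrightarrow> proj_open U \<and>
     (\<exists>r Z \<phi>. zariski_closed r Z \<and> bij_betw \<phi> U Z \<and>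
        (\<forall>V\<subseteq>Z. zariski_open_in r Z V \<longleftrightarrow> proj_open {p \<in> U. \<phi> p \<in> V}) \<and>
        (\<forall>V h. zariski_open_in r Z V \<longrightarrow>
           (regular_on_affine r Z V h \<longleftrightarrow> regular_on_proj {p \<in> U. \<phi> p \<in> V} (h \<circ> \<phi>))))"

text \<open>
  The function field \<open>\<K>(\<P>\<^sup>1) = \<K>(t)\<close> is \<open>'k poly fract\<close>; \<open>ord_at p f\<close> is the coefficient at \<open>p\<close> of
  the principal divisor of \<open>f \<noteq> 0\<close>.
\<close>

fun poly_ord_at :: "'k::field proj_line \<Rightarrow> 'k poly \<Rightarrow> int" where
  "poly_ord_at (Pt z) a = int (order z a)"
| "poly_ord_at Infinity a = - int (degree a)"

definition ord_at :: "'k::field proj_line \<Rightarrow> 'k poly fract \<Rightarrow> int" where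
  "ord_at p f = (THE k. \<exists>a b. a \<noteq> 0 \<and> b \<noteq> 0 \<and> f = Fraction_Field.Fract a b \<and>
                        k = poly_ord_at p a - poly_ord_at p b)"

lemma poly_ord_at_mult:
  assumes "a \<noteq> 0" "b \<noteq> 0"
  shows "poly_ord_at p (a * b) = poly_ord_at p a + poly_ord_at p b"
  using assms by (cases p) (auto simp: order_mult degree_mult_eq)

lemma ord_at_Fract:
  assumes "a \<noteq> 0" "b \<noteq> 0"
  shows "ord_at p (Fraction_Field.Fract a b) = poly_ord_at p a - poly_ord_at p b"
  unfolding ord_at_def
proof (rule the_equality)
  show "\<exists>a' b'. a' \<noteq> 0 \<and> b' \<noteq> 0 \<and> Fraction_Field.Fract a b = Fraction_Field.Fract a' b' \<and>
          poly_ord_at p a - poly_ord_at p b = poly_ord_at p a' - poly_ord_at p b'"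
    using assms by blast
next
  fix k
  assume "\<exists>a' b'. a' \<noteq> 0 \<and> b' \<noteq> 0 \<and> Fraction_Field.Fract a b = Fraction_Field.Fract a' b' \<and>
            k = poly_ord_at p a' - poly_ord_at p b'"
  then obtain a' b' where *: "a' \<noteq> 0" "b' \<noteq> 0"
      "Fraction_Field.Fract a b = Fraction_Field.Fract a' b'"
      "k = poly_ord_at p a' - poly_ord_at p b'"
    by blast
  have "a * b' = a' * b"
    using * assms by (simp add: eq_fract)
  then have "poly_ord_at p a + poly_ord_at p b' = poly_ord_at p a' + poly_ord_at p b"
    using * assms by (metis poly_ord_at_mult)
  then show "k = poly_ord_at p a - poly_ord_at p b"
    using * by simp
qed

definition weil_divisor :: "('k proj_line \<Rightarrow> 'a::zero) \<Rightarrow> bool" where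
  "weil_divisor D \<longleftrightarrow> finite {p. D p \<noteq> 0}"

definition prime_divisor :: "'k proj_line \<Rightarrow> 'k proj_line \<Rightarrow> int" where
  "prime_divisor p = (\<lambda>q. if q = p then 1 else 0)"

definition sections :: "('k::field proj_line \<Rightarrow> rat) \<Rightarrow> 'k poly fract set" where
  "sections D = {f. f \<noteq> 0 \<and> (\<forall>p. 0 \<le> of_int (ord_at p f) + D p)} \<union> {0}"

definition nonvanishing_locus ::
    "('k::field proj_line \<Rightarrow> rat) \<Rightarrow> 'k poly fract \<Rightarrow> 'k proj_line set" where
  "nonvanishing_locus D f = - {p. D p + of_int (ord_at p f) \<noteq> 0}"

definition cartier :: "('k::field proj_line \<Rightarrow> rat) \<Rightarrow> bool" where
  "cartier D \<longleftrightarrow> weil_divisor D \<and>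
     (\<forall>p. \<exists>W f. p \<in> W \<and> proj_open W \<and> f \<noteq> 0 \<and> (\<forall>q\<in>W. D q = of_int (ord_at q f)))"

definition q_cartier :: "('k::field proj_line \<Rightarrow> rat) \<Rightarrow> bool" where
  "q_cartier D \<longleftrightarrow> (\<exists>m::nat. m > 0 \<and> cartier (\<lambda>p. of_nat m * D p))"

definition semiample :: "('k::field proj_line \<Rightarrow> rat) \<Rightarrow> bool" where
  "semiample D \<longleftrightarrow> (\<exists>m::nat. m > 0 \<and>
     (\<Union>f\<in>sections (\<lambda>p. of_nat m * D p) - {0}. nonvanishing_locus (\<lambda>p. of_nat m * D p) f) = UNIV)"

definition big :: "('k::field proj_line \<Rightarrow> rat) \<Rightarrow> bool" where
  "big D \<longleftrightarrow> (\<exists>m::nat. m > 0 \<and>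
     (\<exists>f\<in>sections (\<lambda>p. of_nat m * D p) - {0}.
        proj_affine (nonvanishing_locus (\<lambda>p. of_nat m * D p) f)))"


section \<open>Polyhedral divisors on the projective line\<close>

text \<open>A finite formal sum \<open>\<Sum>\<^sub>i \<Delta>\<^sub>i \<cdot> D\<^sub>i\<close> is given by the list of the pairs \<open>(\<Delta>\<^sub>i, D\<^sub>i)\<close>.\<close>

type_synonym ('n, 'k) poly_divisor = "((rat ^ 'n) set \<times> ('k proj_line \<Rightarrow> int)) list"

text \<open>The minimum of \<open>u\<close> on \<open>\<Delta>\<close> is written as the least element of \<open>u ` \<Delta>\<close>.\<close>

definition divisor_at ::
    "('n::finite, 'k) poly_divisor \<Rightarrow> (rat ^ 'n \<Rightarrow> rat) \<Rightarrow> 'k proj_line \<Rightarrow> rat" where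
  "divisor_at \<DD> u = (\<lambda>p. \<Sum>(\<Delta>, D)\<leftarrow>\<DD>. (LEAST r. r \<in> u ` \<Delta>) * of_int (D p))"

definition pp_divisor ::
    "(int ^ 'n::finite) set \<Rightarrow> (rat ^ 'n) set \<Rightarrow> ('n, 'k::field) poly_divisor \<Rightarrow> bool" where
  "pp_divisor N \<sigma> \<DD> \<longleftrightarrow>
     rat_polyhedral_cone N \<sigma> \<and>
     (\<forall>(\<Delta>, D)\<in>set \<DD>. rat_polyhedron N \<Delta> \<and> recession_cone N \<Delta> = \<sigma> \<and> weil_divisor D) \<and>
     (\<forall>u\<in>dual_cone N \<sigma>. q_cartier (divisor_at \<DD> u) \<and> semiample (divisor_at \<DD> u)) \<and>
     (\<forall>u\<in>functional_rel_interior N (dual_cone N \<sigma>). big (divisor_at \<DD> u))"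

text \<open>
  The algebra \<open>\<Oplus>\<^sub>m \<Gamma>(\<P>\<^sup>1, \<O>(\<DD>(m)))\<close>, \<open>m \<in> \<sigma>\<^sup>\<or> \<inter> M\<close>, as a subset of the monoid algebra over the
  function field; the product of \<open>poly_mapping\<close> is convolution, so homogeneous elements are
  multiplied as rational functions while their degrees are added.
\<close>

definition section_algebra ::
    "(int ^ 'n::finite) set \<Rightarrow> (rat ^ 'n) set \<Rightarrow> ('n, 'k::field) poly_divisor \<Rightarrow>
     ((rat ^ 'n \<Rightarrow> rat) \<Rightarrow>\<^sub>0 'k poly fract) set" where
  "section_algebra N \<sigma> \<DD> =
     {g. \<forall>m. if m \<in> dual_cone N \<sigma> \<inter> M_lattice N
             then Poly_Mapping.lookup g m \<in> sections (divisor_at \<DD> m)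
             else Poly_Mapping.lookup g m = 0}"


section \<open>Affine varieties with a torus action\<close>

text \<open>
  The regular functions on a closed subset \<open>X\<close> of \<open>\<K>\<^sup>n\<close>, extended by 0 outside \<open>X\<close>; the ring
  operations are the pointwise ones.
\<close>

definition on_variety :: "'x set \<Rightarrow> ('x \<Rightarrow> 'k::zero) \<Rightarrow> 'x \<Rightarrow> 'k" where
  "on_variety X f = (\<lambda>x. if x \<in> X then f x else 0)"

definition coordinate_ring :: "('k::field ^ 'n::finite) set \<Rightarrow> ('k ^ 'n \<Rightarrow> 'k) set" where
  "coordinate_ring X = on_variety X ` generated_algebra {\<lambda>x. x $ k | k. True}"

text \<open>
  The one-parameter subgroup \<open>c \<mapsto> (c\<^bsup>v\<^sub>1\<^esup>, \<dots>, c\<^bsup>v\<^sub>n\<^esup>)\<close> of \<open>(\<K>\<^sup>\<times>)\<^sup>n\<close>, acting diagonally on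
  \<open>\<K>\<^sup>n\<close>.
\<close>

definition one_param_act :: "int ^ 'n \<Rightarrow> 'k::field \<Rightarrow> 'k ^ 'n \<Rightarrow> 'k ^ 'n::finite" where
  "one_param_act v c x = (\<chi> k. c powi (v $ k) * x $ k)"

text \<open>
  The subtorus with lattice \<open>N\<close> of one-parameter subgroups is generated by the images of these
  subgroups, and the character \<open>m \<in> M\<close> takes the value \<open>c\<^bsup>\<langle>m, v\<rangle>\<^esup>\<close> at the point of \<open>v\<close> with
  parameter \<open>c\<close>. So the following is the space of semi-invariants of weight \<open>m\<close>.
\<close>

definition weight_space ::
    "(int ^ 'n::finite) set \<Rightarrow> ('k::field ^ 'n) set \<Rightarrow> (rat ^ 'n \<Rightarrow> rat) \<Rightarrow> ('k ^ 'n \<Rightarrow> 'k) set" where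
  "weight_space N X m = {f \<in> coordinate_ring X.
     \<forall>v\<in>N. \<forall>c. c \<noteq> 0 \<longrightarrow> (\<forall>x\<in>X. f (one_param_act v c x) = c powi \<lfloor>m (rat_vec v)\<rfloor> * f x)}"

text \<open>
  There is an isomorphism of \<open>\<K>\<close>-algebras carrying the elements of degree \<open>m\<close> exactly to the elements
  of degree \<open>m\<close>, for every \<open>m \<in> M\<close>.
\<close>

definition corresponds_to_action ::
    "(int ^ 'n::finite) set \<Rightarrow> ('k::field ^ 'n) set \<Rightarrow> (rat ^ 'n) set \<Rightarrow>
     ('n, 'k) poly_divisor \<Rightarrow> bool" where
  "corresponds_to_action N X \<sigma> \<DD> \<longleftrightarrow>
     (\<exists>\<Phi>. bij_betw \<Phi> (coordinate_ring X) (section_algebra N \<sigma> \<DD>) \<and>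
        (\<forall>f\<in>coordinate_ring X. \<forall>g\<in>coordinate_ring X.
           \<Phi> (f + g) = \<Phi> f + \<Phi> g \<and> \<Phi> (f * g) = \<Phi> f * \<Phi> g) \<and>
        (\<forall>c. \<Phi> (on_variety X (\<lambda>_. c)) = Poly_Mapping.single 0 (Fraction_Field.Fract [:c:] 1)) \<and>
        (\<forall>m\<in>M_lattice N. \<forall>f\<in>coordinate_ring X.
           f \<in> weight_space N X m \<longleftrightarrow> (\<forall>m'. m' \<noteq> m \<longrightarrow> Poly_Mapping.lookup (\<Phi> f) m' = 0)))"


section \<open>Trinomial hypersurfaces\<close>

text \<open>
  The coordinates \<open>T\<^sub>0\<^sub>j\<close>, \<open>T\<^sub>1\<^sub>j\<close>, \<open>T\<^sub>2\<^sub>j\<close> are indexed by the summands of \<open>'a + 'b + 'c\<close>, where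
  \<open>n\<^sub>0\<close>, \<open>n\<^sub>1\<close>, \<open>n\<^sub>2\<close> are the cardinalities of \<open>'a\<close>, \<open>'b\<close>, \<open>'c\<close>.
\<close>

definition trinomial_hypersurface ::
    "('a::finite \<Rightarrow> nat) \<Rightarrow> ('b::finite \<Rightarrow> nat) \<Rightarrow> ('c::finite \<Rightarrow> nat) \<Rightarrow>
     ('k::field ^ ('a + 'b + 'c)) set" where
  "trinomial_hypersurface l0 l1 l2 =
     {x. (\<Prod>j\<in>UNIV. x $ Inl j ^ l0 j) + (\<Prod>j\<in>UNIV. x $ Inr (Inl j) ^ l1 j)
         + (\<Prod>j\<in>UNIV. x $ Inr (Inr j) ^ l2 j) = 0}"

definition trinomial_matrix ::
    "('a::finite \<Rightarrow> nat) \<Rightarrow> ('b::finite \<Rightarrow> nat) \<Rightarrow> ('c::finite \<Rightarrow> nat) \<Rightarrow>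
     int ^ ('a + 'b + 'c) ^ 2" where
  "trinomial_matrix l0 l1 l2 = vector
     [\<chi> k. case k of Inl j \<Rightarrow> - int (l0 j) | Inr (Inl j) \<Rightarrow> int (l1 j) | Inr (Inr j) \<Rightarrow> 0,
      \<chi> k. case k of Inl j \<Rightarrow> - int (l0 j) | Inr (Inl j) \<Rightarrow> 0 | Inr (Inr j) \<Rightarrow> int (l2 j)]"

definition trinomial_lattice ::
    "('a::finite \<Rightarrow> nat) \<Rightarrow> ('b::finite \<Rightarrow> nat) \<Rightarrow> ('c::finite \<Rightarrow> nat) \<Rightarrow>
     (int ^ ('a + 'b + 'c)) set" where
  "trinomial_lattice l0 l1 l2 = {v. trinomial_matrix l0 l1 l2 *v v = 0}"

text \<open>A homomorphism \<open>S : \<int>\<^sup>n \<rightarrow> N\<close> with \<open>S \<circ> F = id\<close>, where \<open>F : N \<rightarrow> \<int>\<^sup>n\<close> is the inclusion.\<close>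

definition lattice_retraction :: "(int ^ 'n::finite) set \<Rightarrow> (int ^ 'n \<Rightarrow> int ^ 'n) \<Rightarrow> bool" where
  "lattice_retraction N S \<longleftrightarrow>
     (\<forall>v w. S (v + w) = S v + S w) \<and> range S \<subseteq> N \<and> (\<forall>v\<in>N. S v = v)"

definition rat_extension :: "(int ^ 'n::finite \<Rightarrow> int ^ 'n) \<Rightarrow> rat ^ 'n \<Rightarrow> rat ^ 'n" where
  "rat_extension S q = (\<Sum>k\<in>UNIV. (q $ k) *s rat_vec (S (axis k 1)))"

definition primitive_root_of_unity :: "nat \<Rightarrow> 'k::field \<Rightarrow> bool" where
  "primitive_root_of_unity s \<zeta> \<longleftrightarrow> \<zeta> ^ s = 1 \<and> (\<forall>k. 0 < k \<and> k < s \<longrightarrow> \<zeta> ^ k \<noteq> 1)"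

text \<open>
  Consistency of the action with its description: the subtorus preserves the hypersurface, and the
  \<open>k\<close>-th coordinate function has degree \<open>e\<^sub>k\<^sup>* \<circ> F\<close>.
\<close>

lemma trinomial_lattice_iff:
  "v \<in> trinomial_lattice l0 l1 l2 \<longleftrightarrow>
     (\<Sum>j\<in>UNIV. int (l1 j) * v $ Inr (Inl j)) = (\<Sum>j\<in>UNIV. int (l0 j) * v $ Inl j) \<and>
     (\<Sum>j\<in>UNIV. int (l2 j) * v $ Inr (Inr j)) = (\<Sum>j\<in>UNIV. int (l0 j) * v $ Inl j)"
proof -
  have split: "(\<Sum>k\<in>UNIV. h k) =
      (\<Sum>j\<in>UNIV. h (Inl j)) + ((\<Sum>j\<in>UNIV. h (Inr (Inl j))) + (\<Sum>j\<in>UNIV. h (Inr (Inr j))))"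
    for h :: "'a + 'b + 'c \<Rightarrow> int"
    by (simp add: UNIV_Plus_UNIV[symmetric] sum.Plus del: UNIV_Plus_UNIV)
  show ?thesis
    by (auto simp: trinomial_lattice_def trinomial_matrix_def vec_eq_iff forall_2 vector_2
        matrix_vector_mult_def split sum_negf)
qed

lemma power_int_prod_exponents:
  fixes c :: "'k::field" and v :: "'i \<Rightarrow> int"
  assumes "c \<noteq> 0" "finite I"
  shows "(\<Prod>j\<in>I. (c powi v j * y j) ^ l j) = c powi (\<Sum>j\<in>I. int (l j) * v j) * (\<Prod>j\<in>I. y j ^ l j)"
  using assms(2)
  by (induction rule: finite_induct)
     (use assms(1) in \<open>auto simp: power_int_add power_mult_distrib power_int_mult
        power_int_of_nat mult_ac simp flip: power_int_power\<close>)

lemma one_param_act_trinomial_hypersurface: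
  assumes "v \<in> trinomial_lattice l0 l1 l2" "c \<noteq> 0" "x \<in> trinomial_hypersurface l0 l1 l2"
  shows "one_param_act v c x \<in> trinomial_hypersurface l0 l1 l2"
  using assms
  by (simp add: trinomial_hypersurface_def one_param_act_def power_int_prod_exponents
      trinomial_lattice_iff flip: distrib_left)

lemma rat_vec_in_NQ: "v \<in> N \<Longrightarrow> rat_vec v \<in> NQ N"
  by (auto simp: NQ_def intro!: exI[of _ 1])

lemma coordinate_in_weight_space:
  assumes "\<And>v c x. v \<in> N \<Longrightarrow> c \<noteq> 0 \<Longrightarrow> x \<in> X \<Longrightarrow> one_param_act v c x \<in> X"
  shows "on_variety X (\<lambda>x. x $ k) \<in> weight_space N X (\<lambda>q. if q \<in> NQ N then q $ k else 0)"
proof -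
  have "(\<lambda>x::'b ^ 'a. x $ k) \<in> generated_algebra {\<lambda>x. x $ k | k. True}"
    by (rule generated_algebra.generator) blast
  then show ?thesis
    using assms
    by (auto simp: weight_space_def coordinate_ring_def on_variety_def rat_vec_in_NQ
        one_param_act_def) (simp_all add: rat_vec_def)
qed

end

theory Submission
  imports Defs
begin

text \<open>
  Each polyhedron is the image under the retraction of the intersection of the orthant with a fibre
  of the map with kernel \<open>N\<close>, and the retraction is a translation on such a fibre. So a polyhedron is
  cut out by one inequality per coordinate. The divisor \<open>\<DD>(u)\<close> has degree \<open>u b\<close> for some nonzero
  \<open>b \<in> \<sigma>\<close>, and on the projective line the degree decides about semiampleness and bigness.

  A rational function of degree \<open>m\<close> is written as \<open>H / ((1 - t\<^sup>s)\<^sup>\<alpha> t\<^sup>\<beta>)\<close> with the orders allowed by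
  \<open>\<DD>(m)\<close>, where \<open>H\<close> is a polynomial of degree at most \<open>deg \<lfloor>\<DD>(m)\<rfloor>\<close>. With \<open>t\<close> a constant times the
  quotient of the \<open>s\<close>-th roots \<open>u\<^sub>1\<close>, \<open>u\<^sub>2\<close> of the second and third monomial it becomes a
  monomial times the binary form belonging to \<open>H\<close>, evaluated at \<open>u\<^sub>1\<close>, \<open>u\<^sub>2\<close>. The coprimality assumptions say that all monomials of
  degree \<open>m\<close> arise in this way modulo the trinomial. Injectivity and multiplicativity are checked
  on the points of \<open>X\<close> with nonzero coordinates, by the linear independence of characters.
\<close>

section \<open>Divisors on the projective line\<close>

text \<open>\<open>\<DD>(m)\<close> has rational coefficients, but the order of a function is an
  integer, so only the rounded-down divisor matters for sections; hence the floors in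
  \<open>floor_min\<close>. The isomorphism is built in the direction from sections to functions, as
  \<open>\<Psi>\<close>: a section determines an explicit polynomial function \<open>psi\<close>,
  whereas the homogeneous parts of a polynomial function on \<open>X\<close> cannot be read off. The
  critical point is surjectivity. The degree of a monomial determines its exponents only up to
  integral linear forms that vanish on \<open>N\<close>. For \<open>s > 1\<close> these are not
  generated by the two rows of the defining matrix, since the difference of the rows is divisible by
  \<open>s\<close>. Their exact description, \<open>forms_vanishing_on_N\<close>, is where type I
  enters, and it also explains the numerators 1, \<open>s\<close>, \<open>s\<close> in the three
  polyhedra.\<close>

lemma poly_ord_at_one [simp]: "poly_ord_at p 1 = 0"
  by (cases p) (simp_all add: order_1_eq_0)

lemma ord_at_to_fract: "a \<noteq> 0 \<Longrightarrow> ord_at p (to_fract a) = poly_ord_at p a"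
  unfolding to_fract_def by (simp add: ord_at_Fract)

lemma ord_at_mult:
  assumes "f \<noteq> 0" "g \<noteq> 0"
  shows "ord_at p (f * g) = ord_at p f + ord_at p g"
proof -
  obtain a b where f: "f = Fraction_Field.Fract a b" "b \<noteq> 0" by (cases f rule: Fract_cases)
  obtain c d where g: "g = Fraction_Field.Fract c d" "d \<noteq> 0" by (cases g rule: Fract_cases)
  have "a \<noteq> 0" "c \<noteq> 0" using assms f g by (auto simp: Zero_fract_def eq_fract)
  then show ?thesis using f g by (simp add: ord_at_Fract poly_ord_at_mult)
qed

lemma ord_at_one [simp]: "ord_at p 1 = 0"
  using ord_at_to_fract[of 1 p] by simp

lemma ord_at_power: "f \<noteq> 0 \<Longrightarrow> ord_at p (f ^ n) = int n * ord_at p f"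
  by (induction n) (simp_all add: ord_at_mult algebra_simps)

lemma ord_at_inverse: "f \<noteq> 0 \<Longrightarrow> ord_at p (inverse f) = - ord_at p f"
  using ord_at_mult[of f "inverse f" p] by simp

lemma ord_at_power_int: "f \<noteq> 0 \<Longrightarrow> ord_at p (f powi n) = n * ord_at p f"
  by (simp add: power_int_def ord_at_power ord_at_inverse)

lemma ord_at_prod:
  assumes "\<And>i. i \<in> I \<Longrightarrow> f i \<noteq> 0"
  shows "ord_at p (\<Prod>i\<in>I. f i) = (\<Sum>i\<in>I. ord_at p (f i))"
  using assms by (induction I rule: infinite_finite_induct) (simp_all add: ord_at_mult)

lemma order_linear: "order w [:-z, 1:] = (if w = z then 1 else 0)"
  using order_power_n_n[of z 1] by (simp add: order_0I)

section \<open>Degree, semiampleness and bigness\<close>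

definition divisor_degree :: "('k proj_line \<Rightarrow> 'a::comm_monoid_add) \<Rightarrow> 'a" where
  "divisor_degree D = D Infinity + (\<Sum>z | D (Pt z) \<noteq> 0. D (Pt z))"

lemma weil_divisor_finite_points:
  assumes "weil_divisor D"
  shows "finite {z. D (Pt z) \<noteq> 0}"
proof -
  have "finite (Pt -` {p. D p \<noteq> 0})"
    using assms by (intro finite_vimageI) (auto simp: weil_divisor_def inj_on_def)
  then show ?thesis by (simp add: vimage_def)
qed

text \<open>On the projective line a divisor is equivalent to its degree times any point: powers of
  the linear factors t - z clear the finite coefficients and collect the degree at infinity, and one
  more such power moves it to a finite \<open>p\<close>.\<close>

lemma function_with_divisor_off_point:
  fixes D :: "'k::field proj_line \<Rightarrow> int"
  assumes "weil_divisor D"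
  obtains f where "f \<noteq> 0"
    "\<And>q. ord_at q f + D q = (if q = p then divisor_degree D else 0)"
proof -
  define L :: "'k \<Rightarrow> 'k poly fract" where "L z = to_fract [:-z, 1:]" for z
  have L0: "L z \<noteq> 0" for z by (simp add: L_def)
  have ordL: "ord_at (Pt w) (L z) = (if w = z then 1 else 0)" "ord_at Infinity (L z) = -1" for w z
    by (simp_all add: L_def ord_at_to_fract order_linear)
  define Z where "Z = {z. D (Pt z) \<noteq> 0}"
  have Z: "finite Z" unfolding Z_def by (rule weil_divisor_finite_points[OF assms])
  define g where "g = (\<Prod>z\<in>Z. L z powi (- D (Pt z)))"
  have g0: "g \<noteq> 0" using Z L0 by (simp add: g_def)
  have ordg: "ord_at q g = (\<Sum>z\<in>Z. - D (Pt z) * ord_at q (L z))" for q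
    using L0 by (simp add: g_def ord_at_prod ord_at_power_int)
  have fin: "ord_at (Pt w) g = - D (Pt w)" for w
  proof -
    have "ord_at (Pt w) g = (\<Sum>z\<in>Z. if w = z then - D (Pt z) else 0)"
      unfolding ordg ordL by (intro sum.cong) auto
    then show ?thesis using Z by (simp add: sum.delta') (auto simp: Z_def)
  qed
  have inf: "ord_at Infinity g + D Infinity = divisor_degree D"
    by (simp add: ordg ordL divisor_degree_def Z_def)
  show ?thesis
  proof (cases p)
    case (Pt z)
    have "ord_at q (g * L z powi divisor_degree D) + D q = (if q =
        p then divisor_degree D else 0)" for q
      using g0 L0[of z] fin inf Pt ordL by (cases q) (auto simp: ord_at_mult ord_at_power_int)
    then show ?thesis using that[of "g * L z powi divisor_degree D"] g0 L0 by simp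
  next
    case Infinity
    have "ord_at q g + D q = (if q = p then divisor_degree D else 0)" for q
      using fin inf Infinity by (cases q) auto
    then show ?thesis using that g0 by blast
  qed
qed

lemma common_denominator:
  fixes D :: "'b \<Rightarrow> rat"
  assumes "finite F"
  shows "\<exists>m::nat. m > 0 \<and> (\<forall>p\<in>F. of_nat m * D p \<in> \<int>)"
  using assms
proof (induction F rule: finite_induct)
  case (insert x F)
  then obtain m where m: "m > 0" "\<forall>p\<in>F. of_nat m * D p \<in> \<int>" by blast
  obtain a b where ab: "quotient_of (D x) = (a, b)" by (cases "quotient_of (D x)")
  have b: "b > 0" "D x = of_int a / of_int b"
    using quotient_of_denom_pos[OF ab] quotient_of_div[OF ab] by auto
  have "of_nat (m * nat b) * D x = of_int (int m * a)" using b by simp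
  then have "of_nat (m * nat b) * D x \<in> \<int>" using Ints_of_int by metis
  moreover have "of_nat (m * nat b) * D p \<in> \<int>" if "p \<in> F" for p
  proof -
    have "of_nat (m * nat b) * D p = of_nat (nat b) * (of_nat m * D p)" by simp
    then show ?thesis using m(2) that by (metis Ints_mult Ints_of_nat)
  qed
  ultimately show ?case using m(1) b(1) by (intro exI[of _ "m * nat b"]) auto
qed (auto intro: exI[of _ 1])

lemma weil_divisor_integral_multiple:
  fixes D :: "'k::field proj_line \<Rightarrow> rat"
  assumes "weil_divisor D"
  obtains m :: nat and D' :: "'k proj_line \<Rightarrow> int" where "m > 0" "weil_divisor D'"
    "\<And>p. of_nat m * D p = of_int (D' p)" "of_int (divisor_degree D') = of_nat m * divisor_degree D"
proof -
  obtain m :: nat where m: "m > 0" "\<forall>p\<in>{p. D p \<noteq> 0}. of_nat m * D p \<in> \<int>"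
    using common_denominator[of "{p. D p \<noteq> 0}" D] assms unfolding weil_divisor_def by blast
  define D' where "D' p = \<lfloor>of_nat m * D p\<rfloor>" for p
  have D': "of_nat m * D p = of_int (D' p)" for p
    using m(2) by (cases "D p = 0") (auto simp: D'_def)
  have nz: "D' p \<noteq> 0 \<longleftrightarrow> D p \<noteq> 0" for p
    using D'[of p] m(1) by (metis mult_eq_0_iff of_int_eq_0_iff of_nat_eq_0_iff less_numeral_extra(3))
  have "of_int (divisor_degree D') = of_nat m * divisor_degree D"
    by (simp add: divisor_degree_def nz distrib_left sum_distrib_left D')
  with that[of m D'] m(1) D' assms show ?thesis by (simp add: weil_divisor_def nz)
qed

lemma q_cartier_weil_divisor:
  fixes D :: "'k::field proj_line \<Rightarrow> rat"
  assumes "weil_divisor D"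
  shows "q_cartier D"
proof -
  from assms obtain m :: nat and D' :: "'k proj_line \<Rightarrow> int" where m: "m > 0" "weil_divisor D'"
    "\<And>p. of_nat m * D p = of_int (D' p)"
    by (rule weil_divisor_integral_multiple) blast
  have "\<exists>W f. p \<in> W \<and> proj_open W \<and> f \<noteq> 0 \<and> (\<forall>q\<in>W. of_nat m * D q = of_int (ord_at q f))" for p
  proof -
    obtain p' where p': "p' \<noteq> p" by (metis proj_line.distinct(1))
    \<comment> \<open>A function with divisor \<open>D'\<close> off \<open>p'\<close> is a local
      equation on the complement of \<open>p'\<close>, which contains \<open>p\<close>. The lemma
      makes \<open>ord + D\<close> vanish, hence the sign.\<close>
    have "weil_divisor (\<lambda>q. - D' q)" using m(2) by (simp add: weil_divisor_def)
    then obtain f where "f \<noteq> 0"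
      "\<And>q. ord_at q f + - D' q = (if q = p' then divisor_degree (\<lambda>q. - D' q) else 0)"
      by (rule function_with_divisor_off_point[of _ p']) blast
    then have "ord_at q f = D' q" if "q \<noteq> p'" for q using that by (metis add_eq_0_iff2 minus_minus)
    then show ?thesis using p' m(3) \<open>f \<noteq> 0\<close>
      by (intro exI[of _ "- {p'}"] exI[of _ f]) (auto simp: proj_open_def)
  qed
  moreover have "weil_divisor (\<lambda>p. of_nat m * D p)"
    using assms m(1) by (simp add: weil_divisor_def)
  ultimately show ?thesis using m(1) by (auto simp: q_cartier_def cartier_def)
qed

text \<open>Clearing denominators gives one \<open>m\<close> for all \<open>p\<close>. A section
  whose divisor is concentrated at \<open>p\<close> has coefficient \<open>m\<close> times the
  degree there, so it vanishes nowhere in degree 0 and exactly at \<open>p\<close> in positive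
  degree.\<close>

lemma section_off_point:
  fixes D :: "'k::field proj_line \<Rightarrow> rat"
  assumes "weil_divisor D" "divisor_degree D \<ge> 0"
  obtains m :: nat where "m > 0"
    "\<And>p. \<exists>f\<in>sections (\<lambda>p. of_nat m * D p) - {0}.
        nonvanishing_locus (\<lambda>p. of_nat m * D p) f = (if divisor_degree D = 0 then UNIV else - {p})"
proof -
  from assms(1) obtain m :: nat and D' :: "'k proj_line \<Rightarrow> int" where m: "m > 0" "weil_divisor D'"
    "\<And>p. of_nat m * D p = of_int (D' p)" "of_int (divisor_degree D') = of_nat m * divisor_degree D"
    by (rule weil_divisor_integral_multiple) blast
  have deg: "divisor_degree D' \<ge> 0" "divisor_degree D' = 0 \<longleftrightarrow> divisor_degree D = 0"
    using m(1,4) assms(2)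
    by (metis mult_nonneg_nonneg of_int_0_le_iff of_nat_0_le_iff)
       (use m(1,4) in \<open>metis mult_eq_0_iff of_int_eq_0_iff of_nat_eq_0_iff less_numeral_extra(3)\<close>)
  have "\<exists>f\<in>sections (\<lambda>p. of_nat m * D p) - {0}.
        nonvanishing_locus (\<lambda>p. of_nat m * D p) f = (if divisor_degree D =
            0 then UNIV else - {p})" for p
  proof -
    obtain f where f: "f \<noteq> 0"
      "\<And>q. ord_at q f + D' q = (if q = p then divisor_degree D' else 0)"
      using m(2) by (rule function_with_divisor_off_point[of _ p]) blast
    have *: "of_int (ord_at q f) + of_nat m * D q = of_int (if q =
        p then divisor_degree D' else 0)" for q
      using arg_cong[OF f(2)[of q], of "of_int :: int \<Rightarrow> rat"] m(3)[of q] by simp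
    have "f \<in> sections (\<lambda>p. of_nat m * D p) - {0}"
      using f(1) deg(1) by (simp add: sections_def *)
    moreover have "nonvanishing_locus (\<lambda>p. of_nat m * D p) f =
        (if divisor_degree D = 0 then UNIV else - {p})"
      using deg(2) by (auto simp: nonvanishing_locus_def * add.commute[of "of_nat m * _"])
    ultimately show ?thesis by blast
  qed
  then show ?thesis using that m(1) by blast
qed

lemma semiample_nonneg_degree:
  fixes D :: "'k::field proj_line \<Rightarrow> rat"
  assumes "weil_divisor D" "divisor_degree D \<ge> 0"
  shows "semiample D"
proof -
  obtain m :: nat where m: "m > 0"
    "\<And>p. \<exists>f\<in>sections (\<lambda>p. of_nat m * D p) - {0}.
        nonvanishing_locus (\<lambda>p. of_nat m * D p) f = (if divisor_degree D = 0 then UNIV else - {p})"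
    by (rule section_off_point[OF assms]) blast
  have "q \<in> (\<Union>f\<in>sections (\<lambda>p. of_nat m * D p) - {0}. nonvanishing_locus (\<lambda>p. of_nat m * D p) f)" for q
  proof -
    obtain p where "p \<noteq> q" by (metis proj_line.distinct(1))
    then show ?thesis using m(2)[of p] by (auto split: if_splits)
  qed
  then show ?thesis using m(1) unfolding semiample_def by blast
qed

section \<open>The complement of infinity as an affine line\<close>

lemma affine_space_polys_1:
  "affine_space_polys 1 = {\<lambda>x :: nat \<Rightarrow> 'k::field. poly p (x 0) | p. True}"
proof (intro equalityI subsetI)
  fix P :: "(nat \<Rightarrow> 'k) \<Rightarrow> 'k"
  assume "P \<in> affine_space_polys 1"
  then have "\<exists>p. P = (\<lambda>x. poly p (x 0))" unfolding affine_space_polys_def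
  proof (induction rule: generated_algebra.induct)
    case (generator g)
    then have "g = (\<lambda>x. poly [:0, 1:] (x 0))" by auto
    then show ?case ..
  next
    case (const c)
    have "(\<lambda>_. c) = (\<lambda>x :: nat \<Rightarrow> 'k. poly [:c:] (x 0))" by simp
    then show ?case ..
  next
    case (add f g)
    then obtain p q where "f = (\<lambda>x. poly p (x 0))" "g = (\<lambda>x. poly q (x 0))" by blast
    then show ?case by (intro exI[of _ "p + q"]) simp
  next
    case (mult f g)
    then obtain p q where "f = (\<lambda>x. poly p (x 0))" "g = (\<lambda>x. poly q (x 0))" by blast
    then show ?case by (intro exI[of _ "p * q"]) simp
  qed
  then show "P \<in> {\<lambda>x. poly p (x 0) | p. True}" by blast
next
  fix P :: "(nat \<Rightarrow> 'k) \<Rightarrow> 'k"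
  assume "P \<in> {\<lambda>x. poly p (x 0) | p. True}"
  then obtain p where "P = (\<lambda>x. poly p (x 0))" by blast
  moreover have "(\<lambda>x :: nat \<Rightarrow> 'k. poly p (x 0)) \<in> generated_algebra {\<lambda>x. x i | i. i < 1}"
  proof (induction p)
    case 0
    show ?case by (simp add: generated_algebra.const)
  next
    case (pCons a p)
    have "(\<lambda>x::nat \<Rightarrow> 'k. x 0) \<in> generated_algebra {\<lambda>x. x i | i. i < 1}"
      by (rule generated_algebra.generator) auto
    from generated_algebra.add[OF generated_algebra.const generated_algebra.mult[OF this pCons.IH]]
    show ?case unfolding poly_pCons .
  qed
  ultimately show "P \<in> affine_space_polys 1" by (simp add: affine_space_polys_def)
qed

lemma affine_space_1_eqI:
  "x \<in> affine_space 1 \<Longrightarrow> y \<in> affine_space 1 \<Longrightarrow> x 0 = y 0 \<Longrightarrow> x = y"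
proof
  fix i assume *: "x \<in> affine_space 1" "y \<in> affine_space 1" "x 0 = y 0"
  then show "x i = y i" by (cases "i = 0") (simp_all add: affine_space_def)
qed

text \<open>A nonzero polynomial in one variable has finitely many roots, and a finite set is the
  zero set of the product of its linear factors.\<close>

lemma zariski_open_in_affine_line:
  assumes "V \<subseteq> affine_space 1"
  shows "zariski_open_in 1 (affine_space 1) V \<longleftrightarrow> V =
      {} \<or> finite (affine_space 1 - V :: (nat \<Rightarrow> 'k::field) set)"
proof
  let ?Z = "affine_space 1 :: (nat \<Rightarrow> 'k) set"
  assume "zariski_open_in 1 ?Z V"
  then obtain E where E: "E \<subseteq> affine_space_polys 1" "?Z - V = {x \<in> ?Z. \<forall>P\<in>E. P x = 0}"
    by (auto simp: zariski_open_in_def zariski_closed_def)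
  show "V = {} \<or> finite (?Z - V)"
  proof (cases "\<exists>p. p \<noteq> 0 \<and> (\<lambda>x. poly p (x 0)) \<in> E")
    case True
    then obtain p where p: "p \<noteq> 0" "(\<lambda>x. poly p (x 0)) \<in> E" by blast
    have "inj_on (\<lambda>x. x 0) ?Z" by (intro inj_onI affine_space_1_eqI)
    then have "finite {x \<in> ?Z. x 0 \<in> {z. poly p z = 0}}"
      using finite_vimage_IntI[OF poly_roots_finite[OF p(1)], of "\<lambda>x. x 0" ?Z]
      by (simp add: vimage_def Int_def conj_commute)
    moreover have "?Z - V \<subseteq> {x \<in> ?Z. x 0 \<in> {z. poly p z = 0}}" 
    proof
      fix x assume "x \<in> ?Z - V"
      then have "x \<in> ?Z" "\<forall>P\<in>E. P x = 0" using E(2) by auto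
      with bspec[OF this(2) p(2)] show "x \<in> {x \<in> ?Z. x 0 \<in> {z. poly p z = 0}}" by simp
    qed
    ultimately show ?thesis using finite_subset by blast
  next
    case False
    have "P x = 0" if P: "P \<in> E" for P x
    proof -
      obtain p where "P = (\<lambda>x. poly p (x 0))" using P E(1) unfolding affine_space_polys_1 by blast
      then show ?thesis using P False by (cases "p = 0") auto
    qed
    then have "?Z - V = ?Z" using E(2) by simp
    then show ?thesis using assms by blast
  qed
next
  let ?Z = "affine_space 1 :: (nat \<Rightarrow> 'k) set"
  assume "V = {} \<or> finite (?Z - V)"
  then have "zariski_closed 1 (?Z - V)"
  proof
    assume "V = {}"
    then show ?thesis unfolding zariski_closed_def by (intro exI[of _ "{}"]) auto
  next
    assume fin: "finite (?Z - V)"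
    define p where "p = (\<Prod>x\<in>?Z - V. [:- x 0, 1:])"
    have "poly p (y 0) = 0 \<longleftrightarrow> y \<in> ?Z - V" if "y \<in> ?Z" for y
      using fin that affine_space_1_eqI[OF that]
      by (auto simp: p_def poly_prod prod_zero_iff)
    then have "?Z - V = {x \<in> ?Z. \<forall>P\<in>{\<lambda>x. poly p (x 0)}. P x = 0}" by auto
    moreover have "{\<lambda>x. poly p (x 0)} \<subseteq> affine_space_polys 1" unfolding affine_space_polys_1 by blast
    ultimately show ?thesis unfolding zariski_closed_def
        by (intro exI[of _ "{\<lambda>x. poly p (x 0)}"]) simp
  qed
  then show "zariski_open_in 1 ?Z V" using assms by (simp add: zariski_open_in_def)
qed

text \<open>The chart sends \<open>Pt z\<close> to \<open>z\<close> in the affine line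
  (\<open>r = 1\<close>). Nonempty open sets are the cofinite ones on both sides, and both notions
  of regularity ask for local quotients of polynomials in \<open>z\<close>.\<close>

lemma proj_affine_minus_Infinity: "proj_affine (- {Infinity} :: 'k::field proj_line set)"
proof -
  let ?Z = "affine_space 1 :: (nat \<Rightarrow> 'k) set"
  let ?U = "- {Infinity} :: 'k proj_line set"
  define \<phi> :: "'k proj_line \<Rightarrow> nat \<Rightarrow> 'k" where
    "\<phi> p = (\<lambda>i. if i = 0 then (case p of Pt z \<Rightarrow> z | Infinity \<Rightarrow> 0) else 0)" for p
  have \<phi>0 [simp]: "\<phi> (Pt z) 0 = z" for z by (simp add: \<phi>_def)
  have \<phi>Z: "\<phi> p \<in> ?Z" for p by (simp add: \<phi>_def affine_space_def)
  have \<phi>_Pt: "\<phi> (Pt (x 0)) = x" if "x \<in> ?Z" for x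
    using affine_space_1_eqI[OF \<phi>Z that] by simp
  have U: "p \<in> ?U \<longleftrightarrow> (\<exists>z. p = Pt z)" for p by (cases p) auto
  have bij: "bij_betw \<phi> ?U ?Z"
    unfolding bij_betw_def
  proof
    show "inj_on \<phi> ?U"
    proof
      fix p q assume "p \<in> ?U" "q \<in> ?U" "\<phi> p = \<phi> q"
      then show "p = q" using \<phi>0 unfolding U by metis
    qed
    have "x \<in> \<phi> ` ?U" if "x \<in> ?Z" for x
      by (rule image_eqI[of _ _ "Pt (x 0)"]) (simp_all add: \<phi>_Pt[OF that])
    then show "\<phi> ` ?U = ?Z" using \<phi>Z by blast
  qed
  have closed: "zariski_closed 1 ?Z" unfolding zariski_closed_def by (intro exI[of _ "{}"]) auto
  have opens: "zariski_open_in 1 ?Z V \<longleftrightarrow> proj_open {p \<in> ?U. \<phi> p \<in> V}" if V: "V \<subseteq> ?Z" for V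
  proof -
    have "V = {} \<longleftrightarrow> {p \<in> ?U. \<phi> p \<in> V} = {}"
    proof
      assume E: "{p \<in> ?U. \<phi> p \<in> V} = {}"
      have "x \<notin> V" for x
      proof
        assume "x \<in> V"
        then have "Pt (x 0) \<in> {p \<in> ?U. \<phi> p \<in> V}" using V \<phi>_Pt by auto
        then show False using E by blast
      qed
      then show "V = {}" by blast
    qed blast
    moreover have "finite (?Z - V) \<longleftrightarrow> finite (- {p \<in> ?U. \<phi> p \<in> V})"
    proof -
      have "bij_betw \<phi> {p \<in> ?U. \<phi> p \<notin> V} (?Z - V)"
      proof (rule bij_betw_subset[OF bij])
        show "\<phi> ` {p \<in> ?U. \<phi> p \<notin> V} = ?Z - V"
          unfolding bij_betw_imp_surj_on[OF bij, symmetric] by blast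
      qed blast
      then have "finite (?Z - V) \<longleftrightarrow> finite {p \<in> ?U. \<phi> p \<notin> V}" by (simp add: bij_betw_finite)
      moreover have "- {p \<in> ?U. \<phi> p \<in> V} = insert Infinity {p \<in> ?U. \<phi> p \<notin> V}" by auto
      ultimately show ?thesis by simp
    qed
    ultimately show ?thesis using zariski_open_in_affine_line[OF V] unfolding proj_open_def by blast
  qed
  have reg: "regular_on_affine 1 ?Z V h \<longleftrightarrow> regular_on_proj {p \<in> ?U. \<phi> p \<in> V} (h \<circ> \<phi>)"
    if V: "zariski_open_in 1 ?Z V" for V h
  proof
    assume L: "regular_on_affine 1 ?Z V h"
    show "regular_on_proj {p \<in> ?U. \<phi> p \<in> V} (h \<circ> \<phi>)"
      unfolding regular_on_proj_def
    proof
      fix p assume p: "p \<in> {p \<in> ?U. \<phi> p \<in> V}"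
      then have "\<phi> p \<in> V" by simp
      from bspec[OF L[unfolded regular_on_affine_def] this] obtain W P Q where W: "\<phi> p \<in> W" "W \<subseteq> V"
          "zariski_open_in 1 ?Z W"
        "P \<in> affine_space_polys 1" "Q \<in> affine_space_polys 1" "\<forall>y\<in>W. Q y \<noteq> 0 \<and> h y = P y / Q y"
        by (elim exE conjE) (rule that)
      obtain F G where FG: "P = (\<lambda>x. poly F (x 0))" "Q = (\<lambda>x. poly G (x 0))"
        using W(4,5) unfolding affine_space_polys_1 by blast
      have WZ: "W \<subseteq> ?Z" using W(3) by (simp add: zariski_open_in_def)
      define W' where "W' = {p \<in> ?U. \<phi> p \<in> W}"
      \<comment> \<open>Numerator and denominator must be forms of the same degree; at finite points
        \<open>form_eval\<close> does not depend on that degree.\<close>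
      define d where "d = max (degree F) (degree G)"
      have "p \<in> W'" "W' \<subseteq> {p \<in> ?U. \<phi> p \<in> V}" "proj_open W'"
        using p W(1-3) opens[OF WZ] by (auto simp: W'_def)
      moreover have "degree F \<le> d" "degree G \<le> d" by (simp_all add: d_def)
      moreover have "form_eval d G q \<noteq> 0 \<and> (h \<circ> \<phi>) q = form_eval d F q / form_eval d G q"
        if q: "q \<in> W'" for q
      proof -
        obtain z where "q = Pt z" using q unfolding W'_def by (cases q) auto
        then show ?thesis using W(6) q unfolding W'_def FG by auto
      qed
      ultimately show "\<exists>W d F G. p \<in> W \<and> W \<subseteq> {p \<in> ?U. \<phi> p \<in> V} \<and> proj_open W \<and>
        degree F \<le> d \<and> degree G \<le> d \<and>
        (\<forall>q\<in>W. form_eval d G q \<noteq> 0 \<and> (h \<circ> \<phi>) q = form_eval d F q / form_eval d G q)"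
        by (intro exI[of _ W'] exI[of _ d] exI[of _ F] exI[of _ G]) simp
    qed
  next
    assume R: "regular_on_proj {p \<in> ?U. \<phi> p \<in> V} (h \<circ> \<phi>)"
    show "regular_on_affine 1 ?Z V h"
      unfolding regular_on_affine_def
    proof
      fix x assume x: "x \<in> V"
      then have xZ: "x \<in> ?Z" using V by (auto simp: zariski_open_in_def)
      then have "Pt (x 0) \<in> {p \<in> ?U. \<phi> p \<in> V}" using x \<phi>_Pt by auto
      from bspec[OF R[unfolded regular_on_proj_def] this] obtain W d F G where W: "Pt (x 0) \<in> W" "W
          \<subseteq> {p \<in> ?U. \<phi> p \<in> V}" "proj_open W"
        "\<forall>q\<in>W. form_eval d G q \<noteq> 0 \<and> (h \<circ> \<phi>) q = form_eval d F q / form_eval d G q"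
        by (elim exE conjE) (rule that)
      have "{p \<in> ?U. \<phi> p \<in> \<phi> ` W} = W"
        using W(2) bij unfolding bij_betw_def by (auto dest!: inj_onD)
      then have "zariski_open_in 1 ?Z (\<phi> ` W)"
        using opens[of "\<phi> ` W"] W(3) \<phi>Z by auto
      moreover have "x \<in> \<phi> ` W" using W(1) \<phi>_Pt[OF xZ] by force
      moreover have "\<phi> ` W \<subseteq> V" using W(2) by auto
      moreover have "\<forall>y\<in>\<phi> ` W. poly G (y 0) \<noteq> 0 \<and> h y = poly F (y 0) / poly G (y 0)"
      proof
        fix y assume "y \<in> \<phi> ` W"
        then obtain q where q: "q \<in> W" "y = \<phi> q" by blast
        then obtain z where "q = Pt z" using W(2) by (cases q) auto
        then show "poly G (y 0) \<noteq> 0 \<and> h y = poly F (y 0) / poly G (y 0)" using W(4) q by auto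
      qed
      moreover have "(\<lambda>x. poly F (x 0)) \<in> affine_space_polys 1" "(\<lambda>x. poly G (x 0)) \<in>
          affine_space_polys 1"
        unfolding affine_space_polys_1 by blast+
      ultimately show "\<exists>W P Q. x \<in> W \<and> W \<subseteq> V \<and> zariski_open_in 1 ?Z W \<and>
        P \<in> affine_space_polys 1 \<and> Q \<in> affine_space_polys 1 \<and> (\<forall>y\<in>W. Q y \<noteq> 0 \<and> h y = P y / Q y)"
        by (intro exI[of _ "\<phi> ` W"] exI[of _ "\<lambda>x. poly F (x 0)"] exI[of _ "\<lambda>x. poly G (x 0)"] conjI)
    qed
  qed
  have "proj_open ?U" by (simp add: proj_open_def)
  then show ?thesis
    unfolding proj_affine_def using bij closed opens reg
    by (intro conjI exI[of _ "1 :: nat"] exI[of _ ?Z] exI[of _ \<phi>]) simp_all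
qed

lemma big_pos_degree:
  fixes D :: "'k::field proj_line \<Rightarrow> rat"
  assumes "weil_divisor D" "divisor_degree D > 0"
  shows "big D"
proof -
  obtain m :: nat where m: "m > 0"
    "\<And>p. \<exists>f\<in>sections (\<lambda>p. of_nat m * D p) - {0}.
        nonvanishing_locus (\<lambda>p. of_nat m * D p) f = (if divisor_degree D = 0 then UNIV else - {p})"
    by (rule section_off_point[OF assms(1) less_imp_le[OF assms(2)]]) blast
  from m(2)[of Infinity] assms(2) obtain f where "f \<in> sections (\<lambda>p. of_nat m * D p) - {0}"
    "nonvanishing_locus (\<lambda>p. of_nat m * D p) f = - {Infinity}" by auto
  then show ?thesis using m(1) proj_affine_minus_Infinity
    unfolding big_def by (intro exI[of _ m] conjI bexI[of _ f]) simp_all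
qed

section \<open>Rational convex geometry\<close>

lemma rat_vec_nth [simp]: "rat_vec v $ k = of_int (v $ k)"
  by (simp add: rat_vec_def)

text \<open>The hull is defined by sums over sets of points, but \<open>f\<close> may repeat values;
  the coefficients over each fibre of \<open>f\<close> are therefore added up.\<close>

lemma rat_convex_hull_image:
  assumes "finite I" "\<And>i. i \<in> I \<Longrightarrow> 0 \<le> c i" "sum c I = 1"
  shows "(\<Sum>i\<in>I. c i *s f i) \<in> rat_convex_hull (f ` I)"
proof -
  define c' where "c' a = (\<Sum>i\<in>{i \<in> I. f i = a}. c i)" for a
  have "(\<Sum>i\<in>I. c i *s f i) = (\<Sum>a\<in>f ` I. \<Sum>i\<in>{i \<in> I. f i = a}. c i *s f i)"
    by (rule sum.image_gen[OF assms(1)])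
  also have "\<dots> = (\<Sum>a\<in>f ` I. c' a *s a)"
    unfolding c'_def vec_eq_iff by (simp add: sum_distrib_right)
  finally have "(\<Sum>i\<in>I. c i *s f i) = (\<Sum>a\<in>f ` I. c' a *s a)" .
  moreover have "sum c' (f ` I) = 1"
    using sum.image_gen[OF assms(1), of c f] assms(3) by (simp add: c'_def)
  moreover have "\<forall>a\<in>f ` I. 0 \<le> c' a" using assms(2) by (auto simp: c'_def intro!: sum_nonneg)
  ultimately show ?thesis unfolding rat_convex_hull_def using assms(1) by blast
qed

text \<open>If \<open>u b = 0\<close>, a small move from \<open>u\<close> away from
  \<open>w0\<close> stays in the affine hull but makes the value at \<open>b\<close> negative, so it
  leaves the cone.\<close>

lemma pos_of_rel_interior_dual_cone:
  assumes u: "u \<in> functional_rel_interior N (dual_cone N \<sigma>)"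
    and b: "b \<in> \<sigma>" and w0: "w0 \<in> dual_cone N \<sigma>" "w0 b > 0"
  shows "u b > 0"
proof (rule ccontr)
  assume "\<not> u b > 0"
  from u obtain B \<epsilon> where uC: "u \<in> dual_cone N \<sigma>" and B: "finite B" "\<epsilon> > 0"
    "\<And>w. w \<in> functional_affine_hull (dual_cone N \<sigma>) \<Longrightarrow> \<forall>v\<in>B. \<bar>w v - u v\<bar> < \<epsilon> \<Longrightarrow> w \<in> dual_cone N \<sigma>"
    unfolding functional_rel_interior_def by blast
  have ub: "u b = 0" using uC b \<open>\<not> u b > 0\<close> by (force simp: dual_cone_def)
  then have ne: "u \<noteq> w0" using w0(2) by auto
  define T where "T = (\<Sum>v\<in>B. \<bar>u v - w0 v\<bar>)"
  have T: "T \<ge> 0" by (simp add: T_def sum_nonneg)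
  \<comment> \<open>The displacement on \<open>B\<close> is at most \<open>\<delta> * T\<close>; the
    summand 1 keeps this below \<epsilon> and covers \<open>T = 0\<close>.\<close>
  define \<delta> where "\<delta> = \<epsilon> / (1 + T)"
  have \<delta>: "\<delta> > 0" using B(2) T by (simp add: \<delta>_def)
  define w where "w = (\<lambda>v. (1 + \<delta>) * u v + (- \<delta>) * w0 v)"
  have "w = (\<lambda>v. \<Sum>x\<in>{u, w0}. (if x = u then 1 + \<delta> else - \<delta>) * x v)"
    using ne by (auto simp: w_def fun_eq_iff)
  moreover have "(\<Sum>x\<in>{u, w0}. (if x = u then 1 + \<delta> else - \<delta>)) = 1" using ne by auto
  ultimately have "w \<in> functional_affine_hull (dual_cone N \<sigma>)"
    unfolding functional_affine_hull_def using uC w0(1)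
    by (intro CollectI exI[of _ "{u, w0}"] exI[of _ "\<lambda>x. if x = u then 1 + \<delta> else - \<delta>"]) auto
  moreover have "\<bar>w v - u v\<bar> < \<epsilon>" if "v \<in> B" for v
  proof -
    have le: "\<bar>u v - w0 v\<bar> \<le> T" unfolding T_def using B(1) that by (intro member_le_sum) auto
    have "w v - u v = \<delta> * (u v - w0 v)" by (simp add: w_def algebra_simps)
    then have "\<bar>w v - u v\<bar> = \<delta> * \<bar>u v - w0 v\<bar>" using \<delta> by (simp add: abs_mult)
    also have "\<dots> \<le> \<delta> * T" using \<delta> le by simp
    also have "\<dots> < \<epsilon>" using B(2) T by (simp add: \<delta>_def field_simps)
    finally show ?thesis .
  qed
  ultimately have "w \<in> dual_cone N \<sigma>" using B(3) by blast
  then have "0 \<le> w b" using b by (simp add: dual_cone_def)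
  then show False using \<delta> w0(2) ub by (simp add: w_def mult_le_0_iff)
qed

text \<open>One index type with a block function, in place of a nested sum type, lets the three
  monomials be treated by the same arguments. The gcd conditions are those of type I after inserting
  \<open>d = 1\<close>.\<close>

locale trinomial_geometry =
  fixes l :: "'n::finite \<Rightarrow> nat" and blk :: "'n \<Rightarrow> nat" and s :: nat
    and S :: "int ^ 'n \<Rightarrow> int ^ 'n" and N :: "(int ^ 'n) set"
  assumes l_pos: "l k > 0" and blk_less: "blk k < 3" and blk_surj: "i < 3 \<Longrightarrow> \<exists>k. blk k = i"
    and gcd01: "gcd (Gcd (l ` {k. blk k = 0})) (Gcd (l ` {k. blk k = 1})) = 1"
    and gcd02: "gcd (Gcd (l ` {k. blk k = 0})) (Gcd (l ` {k. blk k = 2})) = 1"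
    and gcd12: "gcd (Gcd (l ` {k. blk k = 1})) (Gcd (l ` {k. blk k = 2})) = s"
    and N_eq: "N = {v. (\<Sum>k | blk k = 1. int (l k) * v $ k) = (\<Sum>k | blk k = 0. int (l k) * v $ k) \<and>
                       (\<Sum>k | blk k = 2. int (l k) * v $ k) = (\<Sum>k | blk k = 0. int (l k) * v $ k)}"
    and retraction: "lattice_retraction N S"
begin

definition B :: "nat \<Rightarrow> 'n set" where "B i = {k. blk k = i}"

lemma mem_B [simp]: "k \<in> B i \<longleftrightarrow> blk k = i" by (simp add: B_def)

text \<open>The numerators in the vertices of the three polyhedra, and at the same time the exponent
  with which the \<open>i\<close>-th monomial is a power of a reduced one
  (\<open>block_monomial_power\<close>).\<close>

definition e :: "nat \<Rightarrow> nat" where "e i = (if i = 0 then 1 else s)"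

lemma s_pos: "s > 0"
proof -
  obtain k where "blk k = 1" using blk_surj[of 1] by auto
  then have "Gcd (l ` {k. blk k = 1}) \<noteq> 0" using l_pos[of k] by (auto simp: Gcd_0_iff)
  then show ?thesis using gcd12 by (metis gcd_eq_0_iff gr0I)
qed

lemma e_pos: "e i > 0" using s_pos by (simp add: e_def)

lemma e_dvd: "e (blk k) dvd l k"
proof -
  have "blk k = 0 \<or> blk k = 1 \<or> blk k = 2" using blk_less[of k] by linarith
  moreover have "s dvd l k" if "blk k = i" "i = 1 \<or> i = 2" for i
  proof -
    have "Gcd (l ` {k. blk k = i}) dvd l k" using that(1) by (intro Gcd_dvd) auto
    moreover have "s dvd Gcd (l ` {k. blk k = i})" using gcd12 that(2) by (metis gcd_dvd1 gcd_dvd2)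
    ultimately show ?thesis by (rule dvd_trans[rotated])
  qed
  ultimately show ?thesis by (auto simp: e_def)
qed

definition weight :: "nat \<Rightarrow> rat ^ 'n \<Rightarrow> rat" where
  "weight i q = (\<Sum>k\<in>B i. of_nat (l k) * q $ k)"

lemma weight_add: "weight i (p + q) = weight i p + weight i q"
  by (simp add: weight_def sum.distrib distrib_left)

lemma weight_diff: "weight i (p - q) = weight i p - weight i q"
  by (simp add: weight_def sum_subtractf right_diff_distrib)

lemma weight_scale: "weight i (r *s q) = r * weight i q"
  by (simp add: weight_def sum_distrib_left mult.left_commute)

lemma weight_sum: "weight i (\<Sum>j\<in>J. f j) = (\<Sum>j\<in>J. weight i (f j))"
  unfolding weight_def by (simp add: sum_distrib_left) (rule sum.swap)

lemma weight_rat_vec: "weight i (rat_vec v) = of_int (\<Sum>k\<in>B i. int (l k) * v $ k)"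
  by (simp add: weight_def)

lemma mem_N:
  "v \<in> N \<longleftrightarrow> weight 1 (rat_vec v) = weight 0 (rat_vec v) \<and> weight 2 (rat_vec v) = weight 0 (rat_vec v)"
  unfolding N_eq weight_rat_vec of_int_eq_iff B_def by simp

lemma mem_NQ: "q \<in> NQ N \<longleftrightarrow> weight 1 q = weight 0 q \<and> weight 2 q = weight 0 q"
proof
  assume "q \<in> NQ N"
  then obtain m :: nat and v where m: "m > 0" "v \<in> N" "of_nat m *s q = rat_vec v"
    by (auto simp: NQ_def)
  then have "of_nat m * weight 1 q = of_nat m * weight 0 q \<and> of_nat m * weight 2 q =
      of_nat m * weight 0 q"
    unfolding mem_N m(3)[symmetric] weight_scale by blast
  then show "weight 1 q = weight 0 q \<and> weight 2 q = weight 0 q" using m(1) by simp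
next
  assume *: "weight 1 q = weight 0 q \<and> weight 2 q = weight 0 q"
  obtain m :: nat where m: "m > 0" "\<forall>k\<in>UNIV. of_nat m * q $ k \<in> \<int>"
    using common_denominator[of UNIV "($) q"] by auto
  define v :: "int ^ 'n" where "v = (\<chi> k. \<lfloor>of_nat m * q $ k\<rfloor>)"
  have v: "of_nat m *s q = rat_vec v" using m(2) by (simp add: v_def vec_eq_iff)
  have "v \<in> N" unfolding mem_N v[symmetric] weight_scale using * by simp
  then show "q \<in> NQ N" using m(1) v by (auto simp: NQ_def)
qed

lemma less_3_cases: "(i::nat) < 3 \<Longrightarrow> i = 0 \<or> i = 1 \<or> i = 2"
  by linarith

lemma NQ_wt: "q \<in> NQ N \<Longrightarrow> i < 3 \<Longrightarrow> weight i q = weight 0 q"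
  by (drule less_3_cases) (auto simp: mem_NQ)

lemma NQ_add: "p \<in> NQ N \<Longrightarrow> q \<in> NQ N \<Longrightarrow> p + q \<in> NQ N"
  and NQ_diff: "p \<in> NQ N \<Longrightarrow> q \<in> NQ N \<Longrightarrow> p - q \<in> NQ N"
  and NQ_scale: "q \<in> NQ N \<Longrightarrow> r *s q \<in> NQ N"
  and NQ_zero: "0 \<in> NQ N"
  by (simp_all add: mem_NQ weight_add weight_diff weight_scale) (simp_all add: weight_def)

lemma NQ_sum: "(\<And>i. i \<in> I \<Longrightarrow> f i \<in> NQ N) \<Longrightarrow> (\<Sum>i\<in>I. f i) \<in> NQ N"
  by (induction I rule: infinite_finite_induct) (auto intro: NQ_add NQ_zero)

lemma NQ_rat_vec: "v \<in> N \<Longrightarrow> rat_vec v \<in> NQ N"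
  by (rule rat_vec_in_NQ)

lemma S_add: "S (v + w) = S v + S w" and S_in_N: "S v \<in> N" and S_id: "v \<in> N \<Longrightarrow> S v = v"
  using retraction by (auto simp: lattice_retraction_def)

lemma S_zero: "S 0 = 0" using S_add[of 0 0] by simp

lemma S_minus: "S (- v) = - S v"
  using S_add[of v "- v"] S_zero by (simp add: eq_neg_iff_add_eq_0 add.commute)

lemma S_scale: "S (c *s v) = c *s S v"
proof -
  have nat: "S (int n *s v) = int n *s S v" for n
  proof (induction n)
    case (Suc n)
    have "int (Suc n) *s w = int n *s w + w" for w :: "int ^ 'n"
      by (simp add: vec_eq_iff algebra_simps)
    then show ?case by (simp add: S_add Suc)
  qed (simp add: S_zero)
  show ?thesis
  proof (cases c rule: int_cases2)
    case (nonpos n)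
    have "(- int n) *s w = - (int n *s w)" for w :: "int ^ 'n" by (simp add: vec_eq_iff)
    then show ?thesis by (simp add: nonpos S_minus nat)
  qed (simp add: nat)
qed

lemma S_sum: "S (\<Sum>i\<in>I. f i) = (\<Sum>i\<in>I. S (f i))"
  by (induction I rule: infinite_finite_induct) (simp_all add: S_zero S_add)

abbreviation "ext \<equiv> rat_extension S"

lemma ext_add: "ext (p + q) = ext p + ext q"
  and ext_diff: "ext (p - q) = ext p - ext q"
  and ext_scale: "ext (r *s q) = r *s ext q"
  by (simp_all add: rat_extension_def vec_eq_iff sum.distrib sum_subtractf distrib_right
      left_diff_distrib sum_distrib_left mult.assoc)

lemma ext_sum: "ext (\<Sum>i\<in>I. f i) = (\<Sum>i\<in>I. ext (f i))"
proof (induction I rule: infinite_finite_induct)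
  case empty
  show ?case using ext_scale[of 0 0] by simp
next
  case (infinite I)
  then show ?case using ext_scale[of 0 0] by simp
qed (simp add: ext_add)

lemma ext_rat_vec: "ext (rat_vec v) = rat_vec (S v)"
proof -
  have "S v = S (\<Sum>k\<in>UNIV. v $ k *s axis k 1)" by (simp add: basis_expansion)
  then show ?thesis by (simp add: S_sum S_scale rat_extension_def vec_eq_iff)
qed

lemma ext_id: "q \<in> NQ N \<Longrightarrow> ext q = q"
proof -
  assume "q \<in> NQ N"
  then obtain m :: nat and v where m: "m > 0" "v \<in> N" "of_nat m *s q = rat_vec v"
    by (auto simp: NQ_def)
  then have "of_nat m *s ext q = of_nat m *s q"
    by (metis S_id ext_rat_vec ext_scale)
  then show ?thesis using m(1) by (simp add: vec_eq_iff)
qed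

lemma ext_in_NQ: "ext q \<in> NQ N"
  unfolding rat_extension_def by (intro NQ_sum NQ_scale NQ_rat_vec S_in_N)

lemma ext_diff_id: "p - q \<in> NQ N \<Longrightarrow> ext p - ext q = p - q"
  using ext_id[of "p - q"] by (simp add: ext_diff)

section \<open>The cone and the polyhedra\<close>

definition \<sigma> :: "(rat ^ 'n) set" where "\<sigma> = {q \<in> NQ N. \<forall>k. 0 \<le> q $ k}"

lemma image_ext_orthant: "ext ` ({q. \<forall>k. 0 \<le> q $ k} \<inter> NQ N) = \<sigma>"
proof -
  have "ext ` ({q. \<forall>k. 0 \<le> q $ k} \<inter> NQ N) = id ` ({q. \<forall>k. 0 \<le> q $ k} \<inter> NQ N)"
    by (intro image_cong) (auto simp: ext_id)
  then show ?thesis by (auto simp: \<sigma>_def)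
qed

text \<open>The degrees of the coordinate functions, made total by the convention of
  \<open>MQ\<close>; they are also the inequalities that cut out the cone.\<close>

definition coord :: "'n \<Rightarrow> rat ^ 'n \<Rightarrow> rat" where "coord k q = (if q \<in> NQ N then q $ k else 0)"

lemma coord_MQ: "coord k \<in> MQ N"
  by (simp add: MQ_def coord_def NQ_add NQ_scale)

lemma coord_dual: "coord k \<in> dual_cone N \<sigma>"
  using coord_MQ by (auto simp: dual_cone_def coord_def \<sigma>_def)

lemma rat_polyhedral_cone_\<sigma>: "rat_polyhedral_cone N \<sigma>"
  unfolding rat_polyhedral_cone_def
  by (rule exI[of _ "range coord"]) (auto simp: coord_MQ \<sigma>_def coord_def)

text \<open>The factor gives the point weight \<open>e i\<close> in its own block and 0 in the
  others, so all vertices of one block lie in one coset of \<open>NQ N\<close>.\<close>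

definition vertex :: "'n \<Rightarrow> rat ^ 'n" where "vertex k =
    (of_nat (e (blk k)) / of_nat (l k)) *s axis k 1"

lemma vertex_nth: "vertex k $ j = (if j = k then of_nat (e (blk k)) / of_nat (l k) else 0)"
  by (simp add: vertex_def axis_def)

lemma vertex_nonneg: "0 \<le> vertex k $ j" by (simp add: vertex_nth)

lemma weight_pt: "weight i (vertex k) = (if i = blk k then of_nat (e i) else 0)"
proof -
  have "weight i (vertex k) = (\<Sum>j\<in>B i. if j = k then of_nat (e (blk k)) else 0)"
    unfolding weight_def using l_pos[of k] by (intro sum.cong) (auto simp: vertex_nth)
  then show ?thesis by simp
qed

definition \<Delta> :: "nat \<Rightarrow> (rat ^ 'n) set" where
  "\<Delta> i = rat_convex_hull ((\<lambda>k. ext (vertex k)) ` B i) + \<sigma>"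

text \<open>
  The fibre of the defining map over the weight of \<open>vertex k\<close> meets the orthant in the convex hull of
  the points \<open>vertex j\<close>, \<open>j \<in> B (blk k)\<close>, plus the cone; the retraction is a translation on that
  fibre.
\<close>

lemma mem_\<Delta>:
  "v \<in> \<Delta> (blk k) \<longleftrightarrow> v \<in> NQ N \<and> (\<forall>j. ext (vertex k) $ j - vertex k $ j \<le> v $ j)"
proof
  assume "v \<in> \<Delta> (blk k)"
  then obtain F c w where F: "finite F" "F \<subseteq> (\<lambda>k. ext (vertex k)) ` B (blk k)" "\<forall>a\<in>F. 0 \<le> c a"
      "sum c F = 1" and w: "w \<in> \<sigma>" and v: "v = (\<Sum>a\<in>F. c a *s a) + w"
    by (auto simp: \<Delta>_def rat_convex_hull_def elim!: set_plus_elim)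
  have FN: "a \<in> NQ N" if "a \<in> F" for a using that F(2) ext_in_NQ by blast
  have "v \<in> NQ N" unfolding v using w by (intro NQ_add NQ_sum NQ_scale) (auto simp: \<sigma>_def FN)
  moreover have "ext (vertex k) $ j - vertex k $ j \<le> v $ j" for j
  proof -
    have le: "ext (vertex k) $ j - vertex k $ j \<le> a $ j" if "a \<in> F" for a
    proof -
      obtain k' where k': "blk k' = blk k" "a = ext (vertex k')" using \<open>a \<in> F\<close> F(2) by auto
      \<comment> \<open>Vertices of one block have equal weights, so the retraction moves both by
        the same vector and only \<open>0 \<le> vertex k' $ j\<close> remains.\<close>
      have "vertex k' - vertex k \<in> NQ N" by (simp add: mem_NQ weight_diff weight_pt k'(1))
      then have "a - ext (vertex k) = vertex k' - vertex k" using ext_diff_id k'(2) by blast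
      then have "a $ j - ext (vertex k) $ j = vertex k' $ j - vertex k $ j"
          by (metis vector_minus_component)
      then show ?thesis using vertex_nonneg[of k' j] by linarith
    qed
    have "ext (vertex k) $ j - vertex k $ j = (\<Sum>a\<in>F. c a * (ext (vertex k) $ j - vertex k $ j))"
      using F(4) by (simp flip: sum_distrib_right)
    also have "\<dots> \<le> (\<Sum>a\<in>F. c a * a $ j)" using F(3) le by (intro sum_mono mult_left_mono) auto
    also have "\<dots> \<le> v $ j" using w by (simp add: v \<sigma>_def)
    finally show ?thesis .
  qed
  ultimately show "v \<in> NQ N \<and> (\<forall>j. ext (vertex k) $ j - vertex k $ j \<le> v $ j)" by blast
next
  assume *: "v \<in> NQ N \<and> (\<forall>j. ext (vertex k) $ j - vertex k $ j \<le> v $ j)"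
  define i where "i = blk k"
  \<comment> \<open>Undoes the translation: \<open>x\<close> is the point in the coset of
    \<open>vertex k\<close> that the retraction sends to \<open>v\<close>, and the assumed
    inequalities say that \<open>x\<close> lies in the orthant.\<close>
  define x where "x = v - ext (vertex k) + vertex k"
  have x0: "0 \<le> x $ j" for j using * by (simp add: x_def algebra_simps)
  have xpt: "x - vertex k \<in> NQ N" using * by (simp add: x_def NQ_diff ext_in_NQ)
  define c where "c = weight 0 (x - vertex k)"
  have wtx: "weight j x = (if j = i then of_nat (e i) else 0) + c" if "j < 3" for j
    using NQ_wt[OF xpt that] unfolding c_def[symmetric]
        by (simp add: weight_diff weight_pt i_def algebra_simps)
  \<comment> \<open>In a block other than \<open>i\<close> the vertex has weight 0, so there
    \<open>c\<close> is the weight of the nonnegative vector \<open>x\<close>.\<close>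
  obtain j :: nat where "j < 3" "j \<noteq> i" by (cases "i = 0") (auto intro: that[of 0] that[of 1])
  then have "c = weight j x" using wtx by simp
  then have c0: "c \<ge> 0" unfolding weight_def using x0 by (simp add: sum_nonneg)
  have i3: "i < 3" using blk_less by (simp add: i_def)
  define C where "C = of_nat (e i) + c"
  have C0: "C > 0" using e_pos[of i] c0 by (simp add: C_def add_pos_nonneg)
  have wtix: "weight i x = C" using wtx[OF i3] by (simp add: C_def)
  \<comment> \<open>The share of coordinate \<open>j\<close> in the weight \<open>C\<close> of block
    \<open>i\<close>.\<close>
  define cf where "cf j = of_nat (l j) * x $ j / C" for j
  have cf0: "0 \<le> cf j" for j using x0 C0 by (simp add: cf_def)
  have cf1: "sum cf (B i) = 1"
    using wtix C0 by (simp add: cf_def weight_def flip: sum_divide_distrib)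
  define y where "y = x - (\<Sum>j\<in>B i. cf j *s vertex j)"
  have y_nth: "y $ j = x $ j - (if j \<in> B i then cf j * (of_nat (e i) / of_nat (l j)) else 0)" for j
  proof -
    have "(\<Sum>j'\<in>B i. cf j' * vertex j' $ j) = (\<Sum>j'\<in>B i. if j' =
        j then cf j * (of_nat (e i) / of_nat (l j)) else 0)"
      by (intro sum.cong) (auto simp: vertex_nth)
    then show ?thesis by (simp add: y_def)
  qed
  \<comment> \<open>In block \<open>i\<close> there remains \<open>x\<close> shrunk by
    \<open>c / C\<close>. So \<open>y\<close> is nonnegative, and its weight is \<open>c\<close> in
    every block, which puts it into the cone.\<close>
  have "y $ j = (if j \<in> B i then x $ j * (c / C) else x $ j)" for j
  proof -
    have "cf j * (of_nat (e i) / of_nat (l j)) = x $ j * (of_nat (e i) / C)"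
      using l_pos[of j] by (simp add: cf_def)
    also have "of_nat (e i) / C = 1 - c / C" using C0 by (simp add: C_def field_simps)
    finally show ?thesis unfolding y_nth[of j] by (simp add: algebra_simps)
  qed
  then have y0: "0 \<le> y $ j" for j using x0 c0 C0 by simp
  have wty: "weight j y = c" if "j < 3" for j
  proof -
    have "weight j y = weight j x - (\<Sum>k\<in>B i. cf k * weight j (vertex k))"
      by (simp add: y_def weight_diff weight_sum weight_scale)
    also have "(\<Sum>k\<in>B i. cf k * weight j (vertex k)) = (\<Sum>k\<in>B i. cf k * (if j =
        i then of_nat (e i) else 0))"
      by (intro sum.cong) (auto simp: weight_pt)
    also have "weight j x - \<dots> = weight j x - (if j = i then of_nat (e i) else 0)"
      using cf1 by (simp flip: sum_distrib_right)
    also have "\<dots> = c" using wtx[OF that] by simp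
    finally show ?thesis .
  qed
  then have "y \<in> \<sigma>" using y0 by (simp add: \<sigma>_def mem_NQ)
  have "v - ext (vertex k) = x - vertex k" by (simp add: x_def)
  then have "v = ext x" using ext_diff_id[OF xpt] by (metis diff_add_cancel)
  also have "x = (\<Sum>j\<in>B i. cf j *s vertex j) + y" by (simp add: y_def)
  also have "ext \<dots> = (\<Sum>j\<in>B i. cf j *s ext (vertex j)) + y"
    using \<open>y \<in> \<sigma>\<close> by (simp add: ext_add ext_sum ext_scale ext_id \<sigma>_def)
  finally have "v = (\<Sum>j\<in>B i. cf j *s ext (vertex j)) + y" .
  moreover have "(\<Sum>j\<in>B i. cf j *s ext (vertex j)) \<in> rat_convex_hull ((\<lambda>k. ext (vertex k)) ` B i)"
    using cf0 cf1 by (intro rat_convex_hull_image) auto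
  ultimately show "v \<in> \<Delta> (blk k)"
    using \<open>y \<in> \<sigma>\<close> unfolding \<Delta>_def i_def by auto
qed

lemma blk_cases: obtains "blk k = 0" | "blk k = 1" | "blk k = 2"
  using less_3_cases[OF blk_less[of k]] by auto

lemma ext_vertex_in_\<Delta>: "ext (vertex k) \<in> \<Delta> (blk k)"
  by (simp add: mem_\<Delta> ext_in_NQ vertex_nonneg)

lemma B_nonempty: "i < 3 \<Longrightarrow> B i \<noteq> {}"
  using blk_surj by (auto simp: B_def)

lemma rat_polyhedron_\<Delta>:
  assumes "i < 3"
  shows "rat_polyhedron N (\<Delta> i)"
proof -
  obtain k where k: "i = blk k" using blk_surj[OF assms] by blast
  have "\<Delta> (blk k) = {v \<in> NQ N. \<forall>(u, c)\<in>range (\<lambda>j. (coord j, ext (vertex k) $ j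
      - vertex k $ j)). c \<le> u v}"
    by (auto simp: mem_\<Delta> coord_def)
  moreover have "range (\<lambda>j. (coord j, ext (vertex k) $ j - vertex k $ j)) \<subseteq> MQ N \<times> UNIV"
    using coord_MQ by auto
  ultimately show ?thesis unfolding rat_polyhedron_def k by (intro exI conjI) auto
qed

lemma recession_cone_\<Delta>:
  assumes "i < 3"
  shows "recession_cone N (\<Delta> i) = \<sigma>"
proof -
  obtain k where k: "i = blk k" using blk_surj[OF assms] by blast
  show ?thesis unfolding k
  proof (intro equalityI subsetI)
    fix w assume "w \<in> recession_cone N (\<Delta> (blk k))"
    then obtain v where w: "w \<in> NQ N" and v: "\<And>r. r \<ge> 0 \<Longrightarrow> v + r *s w \<in> \<Delta> (blk k)"
      by (auto simp: recession_cone_def)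
    have "0 \<le> w $ j" for j
    proof (rule ccontr)
      assume "\<not> 0 \<le> w $ j"
      then have wj: "w $ j < 0" by simp
      define a where "a = ext (vertex k) $ j - vertex k $ j"
      have le: "a \<le> v $ j + r * w $ j" if "r \<ge> 0" for r
        using v[OF that] by (simp add: mem_\<Delta> a_def)
      \<comment> \<open>Solves \<open>v $ j + r * w $ j = a - 1\<close>, one below the permitted
        bound.\<close>
      define r where "r = (v $ j - a + 1) / (- w $ j)"
      have "r \<ge> 0" using le[of 0] wj by (simp add: r_def divide_nonneg_neg zero_le_divide_iff)
      moreover have "v $ j + r * w $ j = a - 1" using wj by (simp add: r_def)
      ultimately show False using le[of r] by simp
    qed
    then show "w \<in> \<sigma>" using w by (simp add: \<sigma>_def)
  next
    fix w assume w: "w \<in> \<sigma>"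
    have "ext (vertex k) + r *s w \<in> \<Delta> (blk k)" if "r \<ge> 0" for r
    proof -
      have "- vertex k $ j \<le> r * w $ j" for j
      proof -
        have "0 \<le> r * w $ j" using that w by (intro mult_nonneg_nonneg) (auto simp: \<sigma>_def)
        then show ?thesis using vertex_nonneg[of k j] by linarith
      qed
      then show ?thesis using w by (simp add: mem_\<Delta> NQ_add NQ_scale ext_in_NQ \<sigma>_def)
    qed
    then show "w \<in> recession_cone N (\<Delta> (blk k))"
      using w ext_vertex_in_\<Delta>[of k] by (auto simp: recession_cone_def \<sigma>_def)
  qed
qed

lemma MQ_add: "u \<in> MQ N \<Longrightarrow> v \<in> NQ N \<Longrightarrow> w \<in> NQ N \<Longrightarrow> u (v + w) = u v + u w"
  and MQ_scale: "u \<in> MQ N \<Longrightarrow> v \<in> NQ N \<Longrightarrow> u (r *s v) = r * u v"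
  by (simp_all add: MQ_def)

lemma MQ_zero: "u \<in> MQ N \<Longrightarrow> u 0 = 0"
  using MQ_scale[of u 0 0] NQ_zero by simp

lemma MQ_sum:
  "u \<in> MQ N \<Longrightarrow> (\<And>i. i \<in> I \<Longrightarrow> f i \<in> NQ N) \<Longrightarrow> u (\<Sum>i\<in>I. f i) = (\<Sum>i\<in>I. u (f i))"
  by (induction I rule: infinite_finite_induct) (auto simp: MQ_zero MQ_add NQ_sum)

section \<open>Minima of functionals on the polyhedra\<close>

definition min_on :: "nat \<Rightarrow> (rat ^ 'n \<Rightarrow> rat) \<Rightarrow> rat" where
  "min_on i u = Min ((\<lambda>k. u (ext (vertex k))) ` B i)"

lemma min_on_le: "min_on (blk k) u \<le> u (ext (vertex k))"
  by (simp add: min_on_def)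

lemma min_on_attained:
  assumes "i < 3"
  obtains k where "blk k = i" "min_on i u = u (ext (vertex k))"
proof -
  have "min_on i u \<in> (\<lambda>k. u (ext (vertex k))) ` B i"
    unfolding min_on_def using B_nonempty[OF assms] by (intro Min_in) auto
  then show ?thesis using that by auto
qed

text \<open>A functional that is nonnegative on the recession cone takes its minimum at one of the
  finitely many points spanning the hull.\<close>

lemma Least_\<Delta>:
  assumes u: "u \<in> dual_cone N \<sigma>" and i: "i < 3"
  shows "(LEAST r. r \<in> u ` \<Delta> i) = min_on i u"
proof (rule Least_equality)
  obtain k where "blk k = i" "min_on i u = u (ext (vertex k))" by (rule min_on_attained[OF i])
  then show "min_on i u \<in> u ` \<Delta> i" using ext_vertex_in_\<Delta>[of k] by auto
next
  have uM: "u \<in> MQ N" using u by (simp add: dual_cone_def)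
  fix r assume "r \<in> u ` \<Delta> i"
  then obtain v where v: "v \<in> \<Delta> i" "r = u v" by blast
  then obtain F c w where F: "F \<subseteq> (\<lambda>k. ext (vertex k)) ` B i" "\<forall>a\<in>F. 0 \<le> c a"
      "sum c F = 1" and w: "w \<in> \<sigma>" and vw: "v = (\<Sum>a\<in>F. c a *s a) + w"
    by (auto simp: \<Delta>_def rat_convex_hull_def elim!: set_plus_elim)
  have FN: "a \<in> NQ N" if "a \<in> F" for a using that F(1) ext_in_NQ by blast
  have "min_on i u = (\<Sum>a\<in>F. c a * min_on i u)" using F(3) by (simp flip: sum_distrib_right)
  also have "\<dots> \<le> (\<Sum>a\<in>F. c a * u a)"
  proof (intro sum_mono mult_left_mono)
    fix a assume "a \<in> F"
    then show "0 \<le> c a" using F(2) by blast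
    obtain k where "blk k = i" "a = ext (vertex k)" using F(1) \<open>a \<in> F\<close> by auto
    then show "min_on i u \<le> u a" using min_on_le[of k u] by simp
  qed
  also have "\<dots> = u (\<Sum>a\<in>F. c a *s a)"
    using FN by (simp add: MQ_sum[OF uM] NQ_scale MQ_scale[OF uM] cong: sum.cong)
  also have "\<dots> \<le> u (\<Sum>a\<in>F. c a *s a) + u w" using u w by (simp add: dual_cone_def)
  also have "\<dots> = r"
    unfolding v vw using w FN by (subst MQ_add[OF uM]) (auto intro!: NQ_sum NQ_scale simp: \<sigma>_def)
  finally show "min_on i u \<le> r" .
qed

text \<open>With coefficients \<open>s\<close>, 1, 1 the three minimising vertices add up to a
  nonnegative vector of weight \<open>s\<close> in every block, which lies in \<open>NQ N\<close>
  and is fixed by the retraction. The positive coordinate later supplies a functional of the dual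
  cone that is positive at \<open>b\<close>.\<close>

lemma min_on_degree:
  assumes u: "u \<in> dual_cone N \<sigma>"
  obtains b :: "rat ^ 'n" and k where "b \<in> \<sigma>" "0 < b $ k" "u b =
      of_nat s * min_on 0 u + min_on 1 u + min_on 2 u"
proof -
  have uM: "u \<in> MQ N" using u by (simp add: dual_cone_def)
  obtain k0 where k0: "blk k0 = 0" "min_on 0 u = u (ext (vertex k0))"
      by (rule min_on_attained[of 0]) auto
  obtain k1 where k1: "blk k1 = 1" "min_on 1 u = u (ext (vertex k1))"
      by (rule min_on_attained[of 1]) auto
  obtain k2 where k2: "blk k2 = 2" "min_on 2 u = u (ext (vertex k2))"
      by (rule min_on_attained[of 2]) auto
  define b where "b = of_nat s *s vertex k0 + vertex k1 + vertex k2"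
  have bN: "b \<in> NQ N" by (simp add: mem_NQ b_def weight_add weight_scale weight_pt k0 k1 k2 e_def)
  have b0: "0 \<le> b $ k" for k by (simp add: b_def vertex_nonneg)
  have "0 < vertex k1 $ k1" using l_pos[of k1] e_pos[of "blk k1"] by (simp add: vertex_nth)
  then have "0 < b $ k1" by (simp add: b_def vertex_nonneg add_nonneg_pos add_pos_nonneg)
  moreover have "u b = u (of_nat s *s ext (vertex k0) + ext (vertex k1) + ext (vertex k2))"
    using ext_id[OF bN] by (simp add: b_def ext_add ext_scale)
  then have "u b = of_nat s * min_on 0 u + min_on 1 u + min_on 2 u"
    unfolding k0(2) k1(2) k2(2)
    by (simp add: MQ_add[OF uM] MQ_scale[OF uM] NQ_add NQ_scale ext_in_NQ)
  moreover have "b \<in> \<sigma>" using bN b0 by (simp add: \<sigma>_def)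
  ultimately show ?thesis using that by blast
qed

end

section \<open>The polyhedral divisor\<close>

lemma sum_fun_apply: "(\<Sum>i\<in>I. f i) x = (\<Sum>i\<in>I. f i x)"
  by (induction I rule: infinite_finite_induct) auto

text \<open>The powers of \<zeta> below \<open>s\<close> are distinct by primitivity, and
  \<open>z ^ s - 1\<close> has at most \<open>s\<close> roots, so they are all of them.\<close>

lemma power_eq_one_iff_primitive_root:
  fixes \<zeta> :: "'k::field"
  assumes "primitive_root_of_unity s \<zeta>" "s > 0"
  shows "inj_on (\<lambda>k. \<zeta> ^ k) {..<s}" and "{z. z ^ s = 1} = (\<lambda>k. \<zeta> ^ k) ` {..<s}"
proof -
  have \<zeta>: "\<zeta> ^ s = 1" "\<And>k. 0 < k \<Longrightarrow> k < s \<Longrightarrow> \<zeta> ^ k \<noteq> 1"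
    using assms(1) by (auto simp: primitive_root_of_unity_def)
  have \<zeta>0: "\<zeta> \<noteq> 0" using \<zeta>(1) assms(2) by (auto simp: power_0_left)
  have ne: "\<zeta> ^ i \<noteq> \<zeta> ^ j" if "i < j" "j < s" for i j
  proof
    assume "\<zeta> ^ i = \<zeta> ^ j"
    moreover have "\<zeta> ^ j = \<zeta> ^ i * \<zeta> ^ (j - i)" using that by (simp flip: power_add)
    ultimately have "\<zeta> ^ (j - i) = 1" using \<zeta>0 by simp
    then show False using \<zeta>(2)[of "j - i"] that by simp
  qed
  show inj: "inj_on (\<lambda>k. \<zeta> ^ k) {..<s}"
  proof
    fix i j assume "i \<in> {..<s}" "j \<in> {..<s}" "\<zeta> ^ i = \<zeta> ^ j"
    then show "i = j" using ne[of i j] ne[of j i] by (cases i j rule: linorder_cases) auto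
  qed
  define p :: "'k poly" where "p = monom 1 s - 1"
  have p: "degree p = s" "\<And>z. poly p z = z ^ s - 1"
  proof -
    have "degree (monom 1 s + - 1 :: 'k poly) = degree (monom 1 s :: 'k poly)"
      using assms(2) by (intro degree_add_eq_left) (simp add: degree_monom_eq)
    then show "degree p = s" by (simp add: p_def degree_monom_eq)
  qed (simp add: p_def poly_monom)
  then have "p \<noteq> 0" using assms(2) by auto
  then have fin: "finite {z::'k. z ^ s = 1}" and card: "card {z::'k. z ^ s = 1} \<le> s"
    using poly_roots_finite[of p] card_poly_roots_bound[of p] p by auto
  have sub: "(\<lambda>k. \<zeta> ^ k) ` {..<s} \<subseteq> {z. z ^ s = 1}"
  proof clarify
    fix k show "(\<zeta> ^ k) ^ s = 1" using \<zeta>(1) by (metis power_mult mult.commute power_one)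
  qed
  have "card ((\<lambda>k. \<zeta> ^ k) ` {..<s}) = s" using inj by (simp add: card_image)
  then have "(\<lambda>k. \<zeta> ^ k) ` {..<s} = {z. z ^ s = 1}"
    using card_mono[OF fin sub] card by (intro card_subset_eq[OF fin sub]) simp
  then show "{z. z ^ s = 1} = (\<lambda>k. \<zeta> ^ k) ` {..<s}" by simp
qed

locale trinomial_action = trinomial_geometry l blk s S N
  for l :: "'n::finite \<Rightarrow> nat" and blk s S N +
  fixes \<zeta> :: "'k::{alg_closed_field, field_char_0}"
  assumes primitive: "primitive_root_of_unity s \<zeta>"
begin

definition \<DD> :: "('n, 'k) poly_divisor" where
  "\<DD> = [(\<Delta> 0, \<Sum>k<s. prime_divisor (Pt (\<zeta> ^ k))),
         (\<Delta> 1, prime_divisor (Pt 0)),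
         (\<Delta> 2, prime_divisor Infinity)]"

lemma sum_prime_divisor_roots:
  "(\<Sum>k<s. prime_divisor (Pt (\<zeta> ^ k))) q = (case q of Pt z \<Rightarrow> if z ^ s =
      1 then 1 else 0 | Infinity \<Rightarrow> 0)"
proof (cases q)
  case (Pt z)
  note roots = power_eq_one_iff_primitive_root[OF primitive s_pos]
  have "(\<Sum>k<s. prime_divisor (Pt (\<zeta> ^ k))) q = (\<Sum>k<s. if z = \<zeta> ^ k then 1 else 0)"
    by (simp add: sum_fun_apply prime_divisor_def Pt)
  also have "\<dots> = (\<Sum>w\<in>(\<lambda>k. \<zeta> ^ k) ` {..<s}. if z = w then 1 else 0)"
    by (simp add: sum.reindex[OF roots(1)])
  also have "\<dots> = (if z \<in> {z. z ^ s = 1} then 1 else 0)" unfolding roots(2) by simp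
  finally show ?thesis by (simp add: Pt)
qed (simp add: sum_fun_apply prime_divisor_def)

lemma divisor_at_\<DD>:
  assumes "u \<in> dual_cone N \<sigma>"
  shows "divisor_at \<DD> u p = (case p of Pt z \<Rightarrow> if z ^ s = 1 then min_on 0 u else if z =
      0 then min_on 1 u else 0
    | Infinity \<Rightarrow> min_on 2 u)"
proof (cases p)
  case (Pt z)
  have "z ^ s = 1 \<Longrightarrow> z \<noteq> 0" using s_pos by (auto simp: power_0_left)
  then show ?thesis using Pt
    unfolding divisor_at_def \<DD>_def
    by (simp add: sum_prime_divisor_roots Least_\<Delta>[OF assms]) (auto simp: prime_divisor_def)
next
  case Infinity
  then show ?thesis
    unfolding divisor_at_def \<DD>_def
    by (simp add: sum_prime_divisor_roots Least_\<Delta>[OF assms]) (auto simp: prime_divisor_def)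
qed

lemma divisor_at_\<DD>_support:
  assumes "u \<in> dual_cone N \<sigma>"
  shows "{z. divisor_at \<DD> u (Pt z) \<noteq> 0} \<subseteq> insert 0 {z. z ^ s = 1}"
  by (auto simp: divisor_at_\<DD>[OF assms] split: if_splits)

lemma finite_roots: "finite {z :: 'k. z ^ s = 1}"
  by (simp add: power_eq_one_iff_primitive_root(2)[OF primitive s_pos])

lemma weil_divisor_\<DD>:
  assumes "u \<in> dual_cone N \<sigma>"
  shows "weil_divisor (divisor_at \<DD> u)"
proof -
  have "{p. divisor_at \<DD> u p \<noteq> 0} \<subseteq> insert Infinity (Pt ` insert 0 {z. z ^ s = 1})"
  proof
    fix p assume "p \<in> {p. divisor_at \<DD> u p \<noteq> 0}"
    then show "p \<in> insert Infinity (Pt ` insert 0 {z. z ^ s = 1})"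
      using divisor_at_\<DD>_support[OF assms] by (cases p) auto
  qed
  then show ?thesis unfolding weil_divisor_def
    by (rule finite_subset) (simp add: finite_roots)
qed

lemma divisor_degree_\<DD>:
  assumes "u \<in> dual_cone N \<sigma>"
  shows "divisor_degree (divisor_at \<DD> u) = of_nat s * min_on 0 u + min_on 1 u + min_on 2 u"
proof -
  let ?D = "divisor_at \<DD> u"
  have z: "(0::'k) \<notin> {z. z ^ s = 1}" using s_pos by (simp add: power_0_left)
  have "(\<Sum>z | ?D (Pt z) \<noteq> 0. ?D (Pt z)) = (\<Sum>z\<in>insert 0 {z. z ^ s = 1}. ?D (Pt z))"
    by (rule sum.mono_neutral_left) (use finite_roots divisor_at_\<DD>_support[OF assms] in auto)
  also have "\<dots> = min_on 1 u + (\<Sum>z\<in>{z::'k. z ^ s = 1}. min_on 0 u)"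
    using z finite_roots by (simp add: divisor_at_\<DD>[OF assms])
  also have "card {z::'k. z ^ s = 1} = s"
    using power_eq_one_iff_primitive_root[OF primitive s_pos] by (simp add: card_image)
  then have "(\<Sum>z\<in>{z::'k. z ^ s = 1}. min_on 0 u) = of_nat s * min_on 0 u" by simp
  finally show ?thesis by (simp add: divisor_degree_def divisor_at_\<DD>[OF assms])
qed

lemma pp_divisor_\<DD>: "pp_divisor N \<sigma> \<DD>"
  unfolding pp_divisor_def
proof (intro conjI ballI)
  show "rat_polyhedral_cone N \<sigma>" by (rule rat_polyhedral_cone_\<sigma>)
next
  have "weil_divisor (\<Sum>k<s. prime_divisor (Pt (\<zeta> ^ k)))"
    unfolding weil_divisor_def
  proof (rule finite_subset)
    show "{p. (\<Sum>k<s. prime_divisor (Pt (\<zeta> ^ k))) p \<noteq> 0} \<subseteq> Pt ` {z. z ^ s = 1}"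
    proof
      fix p assume "p \<in> {p. (\<Sum>k<s. prime_divisor (Pt (\<zeta> ^ k))) p \<noteq> 0}"
      then show "p \<in> Pt ` {z. z ^ s = 1}"
        unfolding mem_Collect_eq sum_prime_divisor_roots by (cases p) (auto split: if_splits)
    qed
  qed (simp add: finite_roots)
  moreover have "weil_divisor (prime_divisor p)" for p :: "'k proj_line"
    by (simp add: weil_divisor_def prime_divisor_def)
  moreover fix x assume "x \<in> set \<DD>"
  ultimately show "case x of (\<Delta>', D) \<Rightarrow> rat_polyhedron N \<Delta>' \<and> recession_cone N \<Delta>' = \<sigma> \<and> weil_divisor D"
    using rat_polyhedron_\<Delta> recession_cone_\<Delta> by (auto simp: \<DD>_def)
next
  fix u assume u: "u \<in> dual_cone N \<sigma>"
  obtain b :: "rat ^ 'n" and k where b: "b \<in> \<sigma>" "0 < b $ k"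
    "u b = of_nat s * min_on 0 u + min_on 1 u + min_on 2 u"
    by (rule min_on_degree[OF u])
  have "0 \<le> u b" using u b(1) by (simp add: dual_cone_def)
  then show "semiample (divisor_at \<DD> u)"
    by (intro semiample_nonneg_degree weil_divisor_\<DD>[OF u]) (simp only: divisor_degree_\<DD>[OF u] b)
  show "q_cartier (divisor_at \<DD> u)" by (rule q_cartier_weil_divisor[OF weil_divisor_\<DD>[OF u]])
next
  fix u assume ri: "u \<in> functional_rel_interior N (dual_cone N \<sigma>)"
  then have u: "u \<in> dual_cone N \<sigma>" by (simp add: functional_rel_interior_def)
  obtain b :: "rat ^ 'n" and k where b: "b \<in> \<sigma>" "0 < b $ k"
    "u b = of_nat s * min_on 0 u + min_on 1 u + min_on 2 u"
    by (rule min_on_degree[OF u])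
  \<comment> \<open>This makes \<open>coord k\<close> the element of the dual cone from which
    positivity at \<open>b\<close> passes to every \<open>u\<close> in the relative
    interior.\<close>
  have "0 < coord k b" using b(1,2) by (simp add: coord_def \<sigma>_def)
  then have "0 < u b" by (rule pos_of_rel_interior_dual_cone[OF ri b(1) coord_dual])
  then show "big (divisor_at \<DD> u)"
    by (intro big_pos_degree weil_divisor_\<DD>[OF u]) (simp only: divisor_degree_\<DD>[OF u] b)
qed

end

section \<open>Integral linear forms vanishing on the lattice\<close>

text \<open>The reduced denominator. It turns statements of integrality into divisibility, where gcd
  and coprimality apply.\<close>

lemma rat_denominator:
  fixes r :: rat
  obtains q :: nat where "q > 0" "\<And>n :: nat. of_nat n * r \<in> \<int> \<longleftrightarrow> q dvd n"
proof -
  obtain a b where ab: "quotient_of r = (a, b)" by (cases "quotient_of r")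
  have b: "b > 0" "r = of_int a / of_int b" "coprime a b"
    using quotient_of_denom_pos[OF ab] quotient_of_div[OF ab] quotient_of_coprime[OF ab] by auto
  have "of_nat n * r \<in> \<int> \<longleftrightarrow> nat b dvd n" for n :: nat
  proof
    assume "of_nat n * r \<in> \<int>"
    then obtain c where "of_nat n * r = of_int c" by (auto elim: Ints_cases)
    then have "of_int (int n * a) = (of_int (c * b) :: rat)" using b(1,2) by (simp add: field_simps)
    then have "b dvd int n * a" by (simp only: of_int_eq_iff) simp
    then have "b dvd int n" using b(3) by (simp add: coprime_dvd_mult_left_iff coprime_commute)
    then show "nat b dvd n" using b(1) by (simp add: nat_dvd_iff)
  next
    assume "nat b dvd n"
    then have "b dvd int n" using b(1) by (simp add: nat_dvd_iff)
    then obtain c where c: "int n = b * c" by blast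
    have "of_nat n * r = of_int (int n) * r" by simp
    also have "\<dots> = of_int (c * a)" unfolding c using b(1,2) by simp
    finally show "of_nat n * r \<in> \<int>" by (metis Ints_of_int)
  qed
  then show ?thesis using that[of "nat b"] b(1) by simp
qed

context trinomial_geometry begin

text \<open>Over the rationals such a form is \<open>a i * l k\<close> on block \<open>i\<close>,
  with \<open>a 0 + a 1 + a 2 = 0\<close>. Integrality of its coefficients makes
  \<open>d i * a i\<close> integral, \<open>d i\<close> being the gcd of block \<open>i\<close>. The
  coprimality conditions then force \<open>a 0\<close> to be integral and the denominators of
  \<open>a 1\<close> and \<open>a 2\<close> to divide \<open>s\<close>; scaling by
  \<open>e i\<close> gives \<alpha>.\<close>

lemma forms_vanishing_on_N:
  fixes c :: "'n \<Rightarrow> int"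
  assumes c: "\<And>v. v \<in> N \<Longrightarrow> (\<Sum>k\<in>UNIV. c k * v $ k) = 0"
  obtains \<alpha> :: "nat \<Rightarrow> int" where "\<And>k. c k * int (e (blk k)) = \<alpha> (blk k) * int (l k)"
    "int s * \<alpha> 0 + \<alpha> 1 + \<alpha> 2 = 0"
proof -
  have "\<exists>rep. \<forall>i<3. blk (rep i) = i" using blk_surj by (intro choice) blast
  then obtain rep where rep: "\<And>i. i < 3 \<Longrightarrow> blk (rep i) = i" by blast
  have sum_axis: "(\<Sum>j\<in>UNIV. c j * (d *s axis k 1 :: int ^ 'n) $ j) = c k * d" for k and d :: int
    by (subst sum.cong[OF refl, of _ _ "\<lambda>j. if j = k then c k * d else 0"]) (auto simp: axis_def)
  have weight_axis: "weight i (rat_vec (d *s axis k 1)) = (if blk k =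
      i then of_int (d * int (l k)) else 0)" for i d k
  proof -
    have "weight i (rat_vec (d *s axis k 1)) = (\<Sum>j\<in>B i. if j = k then of_int (d * int (l k)) else 0)"
      unfolding weight_def by (intro sum.cong) (auto simp: axis_def)
    then show ?thesis by simp
  qed
  have rat_vec_add: "rat_vec (v + w) = rat_vec v + rat_vec w" for v w :: "int ^ 'n"
    by (simp add: vec_eq_iff)
  \<comment> \<open>The slope of the form on block \<open>i\<close>, read off at a representative;
    \<open>ck\<close> shows that every coordinate of the block gives the same value.\<close>
  define a where "a i = of_int (c (rep i)) / (of_nat (l (rep i)) :: rat)" for i
  have ck: "of_int (c k) = a (blk k) * of_nat (l k)" for k
  proof -
    let ?r = "rep (blk k)"
    \<comment> \<open>Two opposite weights within one block cancel, so this vector compares the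
      coefficients of two coordinates.\<close>
    have "int (l k) *s axis ?r 1 + (- int (l ?r)) *s axis k 1 \<in> N"
      using rep[OF blk_less[of k]] by (simp add: mem_N rat_vec_add weight_add weight_axis)
    from c[OF this] have "c ?r * int (l k) + c k * (- int (l ?r)) = 0"
      by (simp only: vector_add_component distrib_left sum.distrib sum_axis)
    then have "c ?r * int (l k) = c k * int (l ?r)" by simp
    then have "(of_int (c ?r * int (l k)) :: rat) = of_int (c k * int (l ?r))" by simp
    then show ?thesis using l_pos[of ?r] by (simp add: a_def field_simps)
  qed
  have a_sum: "a 0 + a 1 + a 2 = 0"
  proof -
    \<comment> \<open>One coordinate per block, scaled so that all three weights equal the product
      of the three exponents.\<close>
    let ?v = "int (l (rep 1) * l (rep 2)) *s axis (rep 0) 1 + int (l (rep 0)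
        * l (rep 2)) *s axis (rep 1) 1
      + int (l (rep 0) * l (rep 1)) *s axis (rep 2) 1 :: int ^ 'n"
    have "?v \<in> N"
      unfolding mem_N rat_vec_add weight_add weight_axis using rep[of 0] rep[of 1] rep[of 2] by simp
    from c[OF this] have "c (rep 0) * int (l (rep 1) * l (rep 2)) + c (rep 1) * int (l (rep 0)
        * l (rep 2))
      + c (rep 2) * int (l (rep 0) * l (rep 1)) = 0"
      by (simp only: vector_add_component distrib_left sum.distrib sum_axis)
    then have "of_int (c (rep 0) * int (l (rep 1) * l (rep 2)) + c (rep 1) * int (l (rep 0)
        * l (rep 2))
      + c (rep 2) * int (l (rep 0) * l (rep 1))) = (0 :: rat)" by simp
    then show ?thesis
      using l_pos[of "rep 0"] l_pos[of "rep 1"] l_pos[of "rep 2"] by (simp add: a_def field_simps)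
  qed
  define d where "d i = Gcd (l ` {k. blk k = i})" for i
  have ad: "of_nat (d i) * a i \<in> \<int>" for i
  proof -
    obtain q :: nat where q: "\<And>n :: nat. of_nat n * a i \<in> \<int> \<longleftrightarrow> q dvd n"
      using rat_denominator[of "a i"] by metis
    have "q dvd l k" if "blk k = i" for k
      using ck[of k] that q[of "l k"] by (metis Ints_of_int mult.commute)
    then have "q dvd d i" unfolding d_def by (intro Gcd_greatest) auto
    then show ?thesis using q by simp
  qed
  have cop: "coprime (d 0) (d 1)" "coprime (d 0) (d 2)" and s: "s = gcd (d 1) (d 2)"
    unfolding d_def coprime_iff_gcd_eq_1 by (rule gcd01, rule gcd02, rule gcd12[symmetric])
  \<comment> \<open>The denominator of \<open>a 0\<close> divides \<open>d 0\<close> and, through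
    \<open>a 0 = - a 1 - a 2\<close>, also \<open>d 1 * d 2\<close>.\<close>
  have a0: "a 0 \<in> \<int>"
  proof -
    obtain q :: nat where q: "\<And>n :: nat. of_nat n * a 0 \<in> \<int> \<longleftrightarrow> q dvd n"
      using rat_denominator[of "a 0"] by metis
    have a0_eq: "a 0 = - a 1 - a 2" using a_sum by simp
    have "of_nat (d 1 * d 2) * a 0 =
        - (of_nat (d 2) * (of_nat (d 1) * a 1)) - of_nat (d 1) * (of_nat (d 2) * a 2)"
      unfolding a0_eq of_nat_mult by (simp only: algebra_simps)
    also have "\<dots> \<in> \<int>"
      by (rule Ints_diff[OF Ints_minus[OF Ints_mult[OF Ints_of_nat ad]] Ints_mult[OF Ints_of_nat ad]])
    finally have "q dvd d 1 * d 2" using q by blast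
    moreover have "q dvd d 0" using q ad by blast
    moreover have "coprime (d 0) (d 1 * d 2)" using cop by simp
    ultimately have "q dvd 1" by (metis coprime_common_divisor is_unit_mult_iff)
    then show ?thesis using q[of 1] by simp
  qed
  \<comment> \<open>With \<open>a 0\<close> integral, \<open>a 1\<close> and \<open>a 2\<close> are
    opposite modulo 1, so the denominator of each divides both \<open>d 1\<close> and
    \<open>d 2\<close>.\<close>
  have sa: "of_nat s * a i \<in> \<int>" if ij: "(i = 1 \<and> j = 2) \<or> (i = 2 \<and> j = 1)" for i j :: nat
  proof -
    obtain q :: nat where q: "\<And>n :: nat. of_nat n * a i \<in> \<int> \<longleftrightarrow> q dvd n"
      using rat_denominator[of "a i"] by metis
    have ai: "a i = - a 0 - a j" using a_sum ij by auto
    have "of_nat (d j) * a i = - (of_nat (d j) * a 0) - of_nat (d j) * a j"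
      unfolding ai by (simp only: algebra_simps)
    also have "\<dots> \<in> \<int>" by (rule Ints_diff[OF Ints_minus[OF Ints_mult[OF Ints_of_nat a0]] ad])
    finally have "q dvd d j" using q by blast
    moreover have "q dvd d i" using q ad by blast
    ultimately have "q dvd s" using ij unfolding s by auto
    then show ?thesis using q by blast
  qed
  define \<alpha> where "\<alpha> i = \<lfloor>of_nat (e i) * a i\<rfloor>" for i
  have \<alpha>: "of_int (\<alpha> i) = of_nat (e i) * a i" if "i < 3" for i
  proof -
    have "of_nat (e i) * a i \<in> \<int>"
      using less_3_cases[OF that] a0 sa[of 1 2] sa[of 2 1] by (auto simp: e_def)
    then show ?thesis by (simp add: \<alpha>_def)
  qed
  show ?thesis
  proof
    fix k
    have "(of_int (c k * int (e (blk k))) :: rat) = of_int (\<alpha> (blk k) * int (l k))"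
      by (simp add: ck \<alpha>[OF blk_less])
    then show "c k * int (e (blk k)) = \<alpha> (blk k) * int (l k)" by (simp only: of_int_eq_iff)
  next
    have "(of_int (int s * \<alpha> 0 + \<alpha> 1 + \<alpha> 2) :: rat) = of_nat s * (a 0 + a 1 + a 2)"
      by (simp add: \<alpha> e_def distrib_left)
    also have "\<dots> = of_int 0" using a_sum by simp
    finally show "int s * \<alpha> 0 + \<alpha> 1 + \<alpha> 2 = 0" by (simp only: of_int_eq_iff)
  qed
qed

end

section \<open>Rational functions of one variable\<close>

text \<open>Over an algebraically closed field a nonconstant \<open>b\<close> has a root, which is
  then a root of \<open>a\<close>. Cancelling the common linear factor lowers the orders of both by
  the same amount, so induction on the degree applies.\<close>

lemma dvd_of_order_le:
  fixes a b :: "'k::alg_closed_field poly"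
  assumes "b \<noteq> 0" "\<And>z. order z b \<le> order z a"
  shows "b dvd a"
  using assms
proof (induction "degree b" arbitrary: a b)
  case 0
  then show ?case by (metis is_unit_iff_degree unit_imp_dvd)
next
  case (Suc n)
  show ?case
  proof (cases "a = 0")
    case False
    obtain z where z: "poly b z = 0" using Suc(2) alg_closed_imp_poly_has_root[of b] by auto
    then have "order z b \<noteq> 0" using Suc.prems(1) order_root by blast
    then have "poly a z = 0" using Suc.prems(2)[of z] order_root[of a z] by auto
    then obtain a' where a': "a = [:-z, 1:] * a'" by (auto simp: poly_eq_0_iff_dvd)
    obtain b' where b': "b = [:-z, 1:] * b'" using z by (auto simp: poly_eq_0_iff_dvd)
    have ne: "a \<noteq> 0" "b \<noteq> 0" "a' \<noteq> 0" "b' \<noteq> 0" using False Suc.prems(1) a' b' by auto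
    have "degree b = degree [:-z, 1:] + degree b'" unfolding b' using ne
        by (intro degree_mult_eq) auto
    then have deg: "n = degree b'" using Suc(2) by simp
    have "order w b' \<le> order w a'" for w
    proof -
      have "order w a = order w [:-z, 1:] + order w a'" unfolding a' using ne(1) a'
          by (intro order_mult) simp
      moreover have "order w b = order w [:-z, 1:] + order w b'" unfolding b' using ne(2) b'
          by (intro order_mult) simp
      ultimately show ?thesis using Suc.prems(2)[of w] by simp
    qed
    then have "b' dvd a'" by (rule Suc(1)[OF deg ne(4)])
    then show ?thesis unfolding a' b' by (rule mult_dvd_mono[OF dvd_refl])
  qed simp
qed

lemma to_fract_of_ord_at_nonneg:
  fixes f :: "'k::alg_closed_field poly fract"
  assumes "f \<noteq> 0" "\<And>z. 0 \<le> ord_at (Pt z) f"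
  obtains H where "f = to_fract H"
proof -
  obtain a b where f: "f = Fraction_Field.Fract a b" "b \<noteq> 0" by (cases f rule: Fract_cases)
  have a: "a \<noteq> 0" using assms(1) f by (auto simp: Zero_fract_def eq_fract)
  have "order z b \<le> order z a" for z
    using assms(2)[of z] f a by (simp add: ord_at_Fract)
  then have "b dvd a" using f(2) by (rule dvd_of_order_le[rotated])
  then obtain H where "a = b * H" by blast
  then have "f = to_fract H" using f by (simp add: to_fract_def eq_fract)
  then show ?thesis by (rule that)
qed

section \<open>Values of rational functions at points\<close>

definition regular_at :: "'k::field \<Rightarrow> 'k poly fract \<Rightarrow> bool" where
  "regular_at z f \<longleftrightarrow> (\<exists>a b. f = Fraction_Field.Fract a b \<and> poly b z \<noteq> 0)"

definition fract_eval :: "'k::field \<Rightarrow> 'k poly fract \<Rightarrow> 'k" where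
  "fract_eval z f = (THE y. \<exists>a b. f = Fraction_Field.Fract a b \<and> poly b z \<noteq> 0 \<and> y =
      poly a z / poly b z)"

lemma fract_eval_Fract:
  assumes "poly b z \<noteq> 0"
  shows "fract_eval z (Fraction_Field.Fract a b) = poly a z / poly b z"
  unfolding fract_eval_def
proof (rule the_equality)
  show "\<exists>a' b'. Fraction_Field.Fract a b = Fraction_Field.Fract a' b' \<and> poly b' z \<noteq> 0 \<and>
    poly a z / poly b z = poly a' z / poly b' z" using assms by blast
next
  fix y assume "\<exists>a' b'. Fraction_Field.Fract a b = Fraction_Field.Fract a' b' \<and> poly b' z \<noteq> 0 \<and>
    y = poly a' z / poly b' z"
  then obtain a' b' where *: "Fraction_Field.Fract a b = Fraction_Field.Fract a' b'" "poly b' z \<noteq> 0"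
    "y = poly a' z / poly b' z" by blast
  have "b \<noteq> 0" "b' \<noteq> 0" using assms *(2) by auto
  then have "a * b' = a' * b" using *(1) by (simp add: eq_fract)
  then have "poly a z * poly b' z = poly a' z * poly b z" by (metis poly_mult)
  then show "y = poly a z / poly b z" using assms *(2,3) by (simp add: frac_eq_eq)
qed

lemma regular_at_Fract: "poly b z \<noteq> 0 \<Longrightarrow> regular_at z (Fraction_Field.Fract a b)"
  by (auto simp: regular_at_def)

lemma regular_atE:
  assumes "regular_at z f"
  obtains a b where "f = Fraction_Field.Fract a b" "poly b z \<noteq> 0" "b \<noteq> 0"
proof -
  from assms obtain a b where "f = Fraction_Field.Fract a b" "poly b z \<noteq> 0"
      by (auto simp: regular_at_def)
  moreover from this(2) have "b \<noteq> 0" by auto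
  ultimately show ?thesis by (rule that)
qed

lemma regular_at_add: "regular_at z f \<Longrightarrow> regular_at z g \<Longrightarrow> regular_at z (f + g)"
  and fract_eval_add: "regular_at z f \<Longrightarrow> regular_at z g \<Longrightarrow> fract_eval z (f + g) =
      fract_eval z f + fract_eval z g"
  by (auto elim!: regular_atE simp: regular_at_Fract fract_eval_Fract add_frac_eq)

lemma regular_at_mult: "regular_at z f \<Longrightarrow> regular_at z g \<Longrightarrow> regular_at z (f * g)"
  and fract_eval_mult: "regular_at z f \<Longrightarrow> regular_at z g \<Longrightarrow> fract_eval z (f * g) =
      fract_eval z f * fract_eval z g"
  by (auto elim!: regular_atE simp: regular_at_Fract fract_eval_Fract)

lemma regular_at_to_fract [simp]: "regular_at z (to_fract a)"
  and fract_eval_to_fract [simp]: "fract_eval z (to_fract a) = poly a z"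
  by (simp_all add: to_fract_def regular_at_Fract fract_eval_Fract)

lemma regular_at_zero [simp]: "regular_at z 0"
  and fract_eval_zero [simp]: "fract_eval z 0 = 0"
  and regular_at_one [simp]: "regular_at z 1"
  and fract_eval_one [simp]: "fract_eval z 1 = 1"
  using regular_at_to_fract[of z 0] fract_eval_to_fract[of z 0]
    regular_at_to_fract[of z 1] fract_eval_to_fract[of z 1] by simp_all

lemma regular_at_power: "regular_at z f \<Longrightarrow> regular_at z (f ^ n)"
  by (induction n) (simp_all add: regular_at_mult)

lemma fract_eval_power: "regular_at z f \<Longrightarrow> fract_eval z (f ^ n) = fract_eval z f ^ n"
  by (induction n) (simp_all add: regular_at_power fract_eval_mult)

lemma regular_at_inverse_to_fract:
  assumes "poly a z \<noteq> 0"
  shows "regular_at z (inverse (to_fract a))" "fract_eval z (inverse (to_fract a)) =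
      inverse (poly a z)"
proof -
  have "inverse (to_fract a) = Fraction_Field.Fract 1 a" by (simp add: to_fract_def)
  then show "regular_at z (inverse (to_fract a))" "fract_eval z (inverse (to_fract a)) =
      inverse (poly a z)"
    using assms by (simp_all add: regular_at_Fract fract_eval_Fract divide_inverse)
qed

lemma regular_at_to_fract_powi:
  assumes "poly a z \<noteq> 0"
  shows "regular_at z (to_fract a powi n)" "fract_eval z (to_fract a powi n) = poly a z powi n"
  using regular_at_inverse_to_fract[OF assms]
  by (simp_all add: power_int_def regular_at_power fract_eval_power)

text \<open>The numerator vanishes off a finite set, and a field of characteristic 0 is
  infinite.\<close>

lemma fract_eq_0_of_eval:
  fixes f :: "'k::field_char_0 poly fract"
  assumes "finite Z" "\<And>z. z \<notin> Z \<Longrightarrow> regular_at z f \<and> fract_eval z f = 0"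
  shows "f = 0"
proof -
  obtain a b where f: "f = Fraction_Field.Fract a b" "b \<noteq> 0" by (cases f rule: Fract_cases)
  have "poly a z = 0" if z: "z \<notin> Z \<union> {z. poly b z = 0}" for z
    using assms(2)[of z] z by (simp add: f fract_eval_Fract)
  then have "- (Z \<union> {z. poly b z = 0}) \<subseteq> {z. poly a z = 0}" by blast
  moreover have "finite (Z \<union> {z. poly b z = 0})" using assms(1) poly_roots_finite[OF f(2)] by simp
  then have "infinite (- (Z \<union> {z. poly b z = 0}))"
      by (simp only: finite_compl) (rule infinite_UNIV_char_0)
  ultimately have "a = 0" using poly_roots_finite finite_subset by blast
  then show ?thesis using f by (simp add: Zero_fract_def eq_fract)
qed

section \<open>Binary forms and the polynomial 1 - t^s\<close>

definition hom_eval :: "nat \<Rightarrow> 'k::comm_ring_1 poly \<Rightarrow> 'k \<Rightarrow> 'k \<Rightarrow> 'k" where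
  "hom_eval n H a b = (\<Sum>i\<le>n. coeff H i * a ^ i * b ^ (n - i))"

lemma hom_eval_eq:
  fixes a b :: "'k::field"
  assumes "b \<noteq> 0" "degree H \<le> n"
  shows "hom_eval n H a b = b ^ n * poly H (a / b)"
proof -
  have "poly H (a / b) = (\<Sum>i\<le>n. coeff H i * (a / b) ^ i)"
    unfolding poly_altdef using assms(2) by (intro sum.mono_neutral_left) (auto simp: coeff_eq_0)
  then have "b ^ n * poly H (a / b) = (\<Sum>i\<le>n. b ^ n * (coeff H i * (a / b) ^ i))"
    by (simp add: sum_distrib_left)
  also have "\<dots> = hom_eval n H a b" unfolding hom_eval_def
  proof (rule sum.cong[OF refl])
    fix i assume "i \<in> {..n}"
    then have "b ^ n = b ^ i * b ^ (n - i)" by (simp flip: power_add)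
    then show "b ^ n * (coeff H i * (a / b) ^ i) = coeff H i * a ^ i * b ^ (n - i)"
      using assms(1) by (simp add: power_divide)
  qed
  finally show ?thesis by simp
qed

lemma hom_eval_zero [simp]: "hom_eval n 0 a b = 0"
  by (simp add: hom_eval_def)

lemma hom_eval_add: "hom_eval n (G + H) a b = hom_eval n G a b + hom_eval n H a b"
  by (simp add: hom_eval_def sum.distrib distrib_right)

lemma hom_eval_scale: "hom_eval n H (r * a) (r * b) = r ^ n * hom_eval n H a b"
  unfolding hom_eval_def sum_distrib_left
proof (rule sum.cong[OF refl])
  fix i assume "i \<in> {..n}"
  then have "r ^ n = r ^ i * r ^ (n - i)" by (simp flip: power_add)
  then show "coeff H i * (r * a) ^ i * (r * b) ^ (n - i) = r ^ n * (coeff H i * a ^ i * b ^ (n - i))"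
    by (simp add: power_mult_distrib mult_ac)
qed

text \<open>Multiplying the difference by the variable makes it vanish at 0 as well.\<close>

lemma poly_eqI_off_zero:
  fixes p q :: "'k::{idom, ring_char_0} poly"
  assumes "\<And>b. b \<noteq> 0 \<Longrightarrow> poly p b = poly q b"
  shows "p = q"
proof -
  have "poly ((p - q) * [:0, 1:]) b = 0" for b using assms[of b] by (cases "b = 0") auto
  then have "(p - q) * [:0, 1:] = 0" using poly_all_0_iff_0 by blast
  then show ?thesis by auto
qed

definition roots_poly :: "nat \<Rightarrow> 'k::comm_ring_1 poly" where "roots_poly s = 1 - monom 1 s"

lemma poly_roots_poly [simp]: "poly (roots_poly s) z = 1 - z ^ s"
  by (simp add: roots_poly_def poly_monom)

lemma degree_roots_poly:
  assumes "s > 0"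
  shows "degree (roots_poly s :: 'k::field poly) = s"
proof -
  have "roots_poly s = - monom 1 s + (1 :: 'k poly)" by (simp add: roots_poly_def)
  then have "degree (roots_poly s :: 'k poly) = degree (- monom 1 s :: 'k poly)"
    using assms by (simp only:) (intro degree_add_eq_left, simp add: degree_monom_eq)
  then show ?thesis by (simp add: degree_monom_eq)
qed

lemma roots_poly_nonzero: "s > 0 \<Longrightarrow> (roots_poly s :: 'k::field poly) \<noteq> 0"
  using degree_roots_poly[of s] by (metis degree_0 less_irrefl)

text \<open>In characteristic 0 the derivative does not vanish at a root of unity, so the zeros are
  simple and a power of this polynomial has the same order at all of them.\<close>

lemma order_roots_poly:
  fixes z :: "'k::field_char_0"
  assumes "s > 0"
  shows "order z (roots_poly s) = (if z ^ s = 1 then 1 else 0)"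
proof (cases "z ^ s = 1")
  case True
  have "pderiv (roots_poly s :: 'k poly) = - monom (of_nat s) (s - 1)"
    by (simp add: roots_poly_def pderiv_diff pderiv_monom)
  then have "poly (pderiv (roots_poly s)) z = - of_nat s * z ^ (s - 1)" by (simp add: poly_monom)
  moreover have "z \<noteq> 0" using True assms by (auto simp: power_0_left)
  ultimately have d: "poly (pderiv (roots_poly s)) z \<noteq> 0" using assms by simp
  then have "order z (pderiv (roots_poly s)) = 0" by (rule order_0I)
  moreover have "pderiv (roots_poly s) \<noteq> (0 :: 'k poly)" using d by auto
  moreover have "order z (roots_poly s) \<noteq> 0"
    using True roots_poly_nonzero[OF assms, where 'k = 'k] order_root[of "roots_poly s" z] by auto
  ultimately show ?thesis
    using True order_pderiv[of "roots_poly s" z] roots_poly_nonzero[OF assms, where 'k = 'k] by simp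
next
  case False
  then show ?thesis by (simp add: order_0I)
qed

text \<open>For \<open>b \<noteq> 0\<close> this is dehomogenisation. Both sides are polynomials in
  \<open>b\<close> for fixed \<open>a\<close>, so the identity extends to \<open>b = 0\<close>. The
  exponent \<open>k\<close> is the part of the degree that the polynomial leaves over.\<close>

lemma hom_eval_roots_poly:
  fixes a b :: "'k::field_char_0"
  assumes s: "s > 0" and n: "n = s * i + j + k"
  shows "hom_eval n (roots_poly s ^ i * monom 1 j) a b = (b ^ s - a ^ s) ^ i * a ^ j * b ^ k"
proof -
  let ?H = "roots_poly s ^ i * monom 1 j :: 'k poly"
  have deg: "degree ?H \<le> n"
  proof -
    have "degree ?H \<le> degree (roots_poly s ^ i :: 'k poly) + degree (monom 1 j :: 'k poly)"
        by (rule degree_mult_le)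
    also have "\<dots> \<le> s * i + j"
      using degree_power_le[of "roots_poly s :: 'k poly" i] degree_monom_le[of "1::'k" j]
      by (simp add: degree_roots_poly[OF s])
    finally show ?thesis using n by simp
  qed
  define p where "p = (\<Sum>r\<le>n. monom (coeff ?H r * a ^ r) (n - r))"
  define q where "q = (monom 1 s - [:a ^ s:]) ^ i * [:a ^ j:] * monom 1 k"
  have p: "poly p x = hom_eval n ?H a x" for x
    by (simp add: p_def poly_sum poly_monom hom_eval_def)
  have q: "poly q x = (x ^ s - a ^ s) ^ i * a ^ j * x ^ k" for x
    by (simp add: q_def poly_monom)
  have "p = q"
  proof (rule poly_eqI_off_zero)
    fix x :: 'k assume x: "x \<noteq> 0"
    have "poly p x = x ^ n * ((1 - (a / x) ^ s) ^ i * (a / x) ^ j)"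
      unfolding p hom_eval_eq[OF x deg] by (simp add: poly_monom)
    also have "x ^ n = (x ^ s) ^ i * x ^ j * x ^ k" unfolding n by (simp add: power_add power_mult)
    also have "(x ^ s) ^ i * x ^ j * x ^ k * ((1 - (a / x) ^ s) ^ i * (a / x) ^ j)
      = (x ^ s * (1 - (a / x) ^ s)) ^ i * (x * (a / x)) ^ j * x ^ k"
      by (simp only: power_mult_distrib mult_ac)
    also have "x ^ s * (1 - (a / x) ^ s) = x ^ s - a ^ s" using x
        by (simp add: power_divide field_simps)
    finally show "poly p x = poly q x" using x by (simp add: q)
  qed
  then show ?thesis using p q by metis
qed

section \<open>Sections and semi-invariants\<close>

lemma prod_powi: "(\<Prod>k\<in>A. f k) powi n = (\<Prod>k\<in>A. f k powi n)" for f :: "'i \<Rightarrow> 'k::field"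
  by (induction A rule: infinite_finite_induct) (simp_all add: power_int_mult_distrib)

lemma powi_sum: "c \<noteq> 0 \<Longrightarrow> c powi (\<Sum>k\<in>A. f k) = (\<Prod>k\<in>A. c powi f k)" for c :: "'k::field"
  by (induction A rule: infinite_finite_induct) (simp_all add: power_int_add)

text \<open>In characteristic 0 the element 2 has infinite multiplicative order, so this single
  parameter separates the weights of a one-parameter subgroup.\<close>

lemma two_powi_inject:
  assumes "(2::'k::field_char_0) powi a = 2 powi b"
  shows "a = b"
proof -
  have ne: "(2::'k) ^ n \<noteq> 1" if "n > 0" for n :: nat
  proof
    assume "(2::'k) ^ n = 1"
    then have "of_nat (2 ^ n) = (of_nat 1 :: 'k)" by simp
    then have "2 ^ n = (1::nat)" by (simp only: of_nat_eq_iff)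
    then show False using that by simp
  qed
  have *: "a \<ge> b" if "(2::'k) powi a = 2 powi b" for a b :: int
  proof (rule ccontr)
    assume "\<not> a \<ge> b"
    have "(2::'k) powi b = 2 powi a * 2 powi (b - a)" by (simp flip: power_int_add)
    then have "(2::'k) powi (b - a) = 1" using that by simp
    then have "(2::'k) ^ nat (b - a) = 1" using \<open>\<not> a \<ge> b\<close> by (simp add: power_int_nonneg_exp)
    then show False using ne \<open>\<not> a \<ge> b\<close> by simp
  qed
  show ?thesis using *[OF assms] *[OF assms[symmetric]] by simp
qed

context trinomial_geometry begin

text \<open>The coefficients of \<open>m \<circ> S\<close>, an integral extension of
  \<open>m\<close> from \<open>N\<close> to the full lattice. They may be negative even for degrees
  in which monomials exist.\<close>

definition exponent :: "(rat ^ 'n \<Rightarrow> rat) \<Rightarrow> 'n \<Rightarrow> int" where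
  "exponent m k = \<lfloor>m (rat_vec (S (axis k 1)))\<rfloor>"

lemma M_lattice_MQ: "m \<in> M_lattice N \<Longrightarrow> m \<in> MQ N"
  by (simp add: M_lattice_def)

lemma of_int_exponent: "m \<in> M_lattice N \<Longrightarrow> of_int (exponent m k) = m (rat_vec (S (axis k 1)))"
  using S_in_N by (simp add: M_lattice_def exponent_def)

lemma M_lattice_ext: "m \<in> M_lattice N \<Longrightarrow> m (ext q) = (\<Sum>k\<in>UNIV. q $ k * of_int (exponent m k))"
  unfolding rat_extension_def
  by (simp add: MQ_sum[OF M_lattice_MQ] MQ_scale[OF M_lattice_MQ] NQ_scale NQ_rat_vec S_in_N
      of_int_exponent)

lemma M_lattice_rat_vec:
  assumes "m \<in> M_lattice N" "v \<in> N"
  shows "m (rat_vec v) = of_int (\<Sum>k\<in>UNIV. exponent m k * v $ k)"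
  using M_lattice_ext[OF assms(1), of "rat_vec v"] ext_id[OF NQ_rat_vec[OF assms(2)]]
  by (simp add: mult.commute)

lemma M_lattice_ext_vertex:
  assumes "m \<in> M_lattice N"
  shows "m (ext (vertex k)) = of_nat (e (blk k)) / of_nat (l k) * of_int (exponent m k)"
proof -
  have "m (ext (vertex k)) = (\<Sum>j\<in>UNIV. if j =
      k then of_nat (e (blk k)) / of_nat (l k) * of_int (exponent m k) else 0)"
    unfolding M_lattice_ext[OF assms] by (intro sum.cong) (auto simp: vertex_nth)
  then show ?thesis by simp
qed

lemma M_lattice_eqI:
  assumes "m \<in> M_lattice N" "m' \<in> M_lattice N" "\<And>v. v \<in> N \<Longrightarrow> \<lfloor>m (rat_vec v)\<rfloor> = \<lfloor>m' (rat_vec v)\<rfloor>"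
  shows "m = m'"
proof
  fix q
  have "exponent m = exponent m'" using assms(3) S_in_N by (auto simp: exponent_def)
  then have "m (ext q) = m' (ext q)" using assms(1,2) by (simp add: M_lattice_ext)
  moreover have "m q = m' q" if "q \<notin> NQ N"
    using that M_lattice_MQ[OF assms(1)] M_lattice_MQ[OF assms(2)] by (simp add: MQ_def)
  ultimately show "m q = m' q" using ext_id by (cases "q \<in> NQ N") auto
qed

lemma M_lattice_zero: "0 \<in> M_lattice N"
  by (simp add: M_lattice_def MQ_def zero_fun_def)

lemma M_lattice_add: "m \<in> M_lattice N \<Longrightarrow> m' \<in> M_lattice N \<Longrightarrow> m + m' \<in> M_lattice N"
  by (simp add: M_lattice_def MQ_def algebra_simps)

lemma exponent_add: "m \<in> M_lattice N \<Longrightarrow> m' \<in> M_lattice N \<Longrightarrow> exponent (m + m') k =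
    exponent m k + exponent m' k"
  using of_int_exponent[of m k] of_int_exponent[of m' k] of_int_exponent[OF M_lattice_add, of m m' k]
  by (metis of_int_add of_int_eq_iff plus_fun_apply)

definition reduced_exponent :: "'n \<Rightarrow> nat" where "reduced_exponent k = l k div e (blk k)"

lemma reduced_exponent_mult: "reduced_exponent k * e (blk k) = l k"
  using e_dvd by (simp add: reduced_exponent_def)

lemma reduced_exponent_pos: "reduced_exponent k > 0"
  using reduced_exponent_mult[of k] l_pos[of k] by (cases "reduced_exponent k") auto

definition floor_min :: "(rat ^ 'n \<Rightarrow> rat) \<Rightarrow> nat \<Rightarrow> int" where "floor_min m i = \<lfloor>min_on i m\<rfloor>"

text \<open>The exponents left over when the Laurent monomial of \<open>m \<circ> S\<close> is
  divided by the largest powers of the three block monomials that keep them nonnegative; see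
  \<open>base_exp_nonneg\<close> and \<open>floor_min_ge\<close>.\<close>

definition base_exp :: "(rat ^ 'n \<Rightarrow> rat) \<Rightarrow> 'n \<Rightarrow> int" where
  "base_exp m k = exponent m k - floor_min m (blk k) * int (reduced_exponent k)"

text \<open>The degree of the rounded-down divisor: \<open>s\<close> roots of unity, 0 and infinity.
  If it is negative, only the zero section exists.\<close>

definition form_degree :: "(rat ^ 'n \<Rightarrow> rat) \<Rightarrow> int" where "form_degree m =
    int s * floor_min m 0 + floor_min m 1 + floor_min m 2"

lemma M_lattice_ext_vertex': "m \<in> M_lattice N \<Longrightarrow> m (ext (vertex k)) =
    of_int (exponent m k) / of_nat (reduced_exponent k)"
  unfolding M_lattice_ext_vertex reduced_exponent_mult[of k, symmetric]
      using e_pos[of "blk k"] reduced_exponent_pos[of k] by simp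

lemma base_exp_nonneg:
  assumes "m \<in> M_lattice N"
  shows "0 \<le> base_exp m k"
proof -
  have "of_int (floor_min m (blk k)) \<le> of_int (exponent m k) / (of_nat (reduced_exponent k) :: rat)"
    using min_on_le[of k m] M_lattice_ext_vertex'[OF assms, of k] of_int_floor_le[of "min_on (blk k)
        m"]
    unfolding floor_min_def by linarith
  then have "of_int (floor_min m (blk k) * int (reduced_exponent k)) \<le> (of_int (exponent m k) :: rat)"
    using reduced_exponent_pos[of k] by (simp add: field_simps)
  then show ?thesis by (simp add: base_exp_def flip: of_int_le_iff[where 'a = rat])
qed

text \<open>The minimum is attained at a vertex, where it is \<open>exponent\<close> divided by
  \<open>reduced_exponent\<close>; so \<open>floor_min m i\<close> is the largest integer satisfying
  these inequalities.\<close>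

lemma floor_min_ge:
  assumes "m \<in> M_lattice N" "i < 3" "\<And>k. blk k = i \<Longrightarrow> a * int (reduced_exponent k) \<le> exponent m k"
  shows "a \<le> floor_min m i"
proof -
  obtain k where k: "blk k = i" "min_on i m = m (ext (vertex k))"
      by (rule min_on_attained[OF assms(2)])
  have "of_int (a * int (reduced_exponent k)) \<le> (of_int (exponent m k) :: rat)"
      using assms(3)[OF k(1)] by (simp only: of_int_le_iff)
  then have "of_int a \<le> min_on i m"
    unfolding k(2) M_lattice_ext_vertex'[OF assms(1)] using reduced_exponent_pos[of k]
        by (simp add: field_simps)
  then show ?thesis by (simp add: floor_min_def le_floor_iff)
qed

lemma UNIV_blocks: "UNIV = (B 0 \<union> B 1) \<union> B 2"
proof -
  have "k \<in> (B 0 \<union> B 1) \<union> B 2" for k by (rule blk_cases[of k]) auto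
  then show ?thesis by blast
qed

lemma sum_blocks: "(\<Sum>k\<in>UNIV. g k) = (\<Sum>k\<in>B 0. g k) + (\<Sum>k\<in>B 1. g k) + (\<Sum>k\<in>B 2. g k)"
  for g :: "'n \<Rightarrow> 'z::comm_monoid_add"
proof -
  have "sum g UNIV = sum g (B 0 \<union> B 1) + sum g (B 2)"
    unfolding UNIV_blocks by (rule sum.union_disjoint) auto
  also have "sum g (B 0 \<union> B 1) = sum g (B 0) + sum g (B 1)" by (rule sum.union_disjoint) auto
  finally show ?thesis .
qed

lemma prod_blocks: "(\<Prod>k\<in>UNIV. g k) = (\<Prod>k\<in>B 0. g k) * (\<Prod>k\<in>B 1. g k) * (\<Prod>k\<in>B 2. g k)"
  for g :: "'n \<Rightarrow> 'z::comm_monoid_mult"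
proof -
  have "prod g UNIV = prod g (B 0 \<union> B 1) * prod g (B 2)"
    unfolding UNIV_blocks by (rule prod.union_disjoint) auto
  also have "prod g (B 0 \<union> B 1) = prod g (B 0) * prod g (B 1)" by (rule prod.union_disjoint) auto
  finally show ?thesis .
qed

text \<open>The common value on \<open>N\<close> of the forms \<open>v \<mapsto> (\<Sum>k\<in>B i. l k * v $ k) / s\<close>.\<close>

definition reduced_weight :: "int ^ 'n \<Rightarrow> int" where "reduced_weight v =
    (\<Sum>k\<in>B 1. int (reduced_exponent k) * v $ k)"

lemma reduced_exponent_weights:
  assumes "v \<in> N"
  shows "(\<Sum>k\<in>B 0. int (reduced_exponent k) * v $ k) = int s * reduced_weight v"
    "(\<Sum>k\<in>B 1. int (reduced_exponent k) * v $ k) = reduced_weight v"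
    "(\<Sum>k\<in>B 2. int (reduced_exponent k) * v $ k) = reduced_weight v"
proof -
  have l: "(\<Sum>k\<in>B i. int (l k) * v $ k) = int (e i) * (\<Sum>k\<in>B i. int (reduced_exponent k) * v $ k)" for i
    unfolding sum_distrib_left by (intro sum.cong) (auto simp: reduced_exponent_mult[symmetric])
  have N: "(\<Sum>k\<in>B 1. int (l k) * v $ k) = (\<Sum>k\<in>B 0. int (l k) * v $ k)"
    "(\<Sum>k\<in>B 2. int (l k) * v $ k) = (\<Sum>k\<in>B 0. int (l k) * v $ k)"
    using assms unfolding N_eq B_def by auto
  have e: "e 0 = 1" "e 1 = s" "e 2 = s" by (simp_all add: e_def)
  show "(\<Sum>k\<in>B 1. int (reduced_exponent k) * v $ k) = reduced_weight v"
      by (simp add: reduced_weight_def)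
  show "(\<Sum>k\<in>B 0. int (reduced_exponent k) * v $ k) = int s * reduced_weight v"
    using N(1) unfolding l e reduced_weight_def by simp
  have "int s * (\<Sum>k\<in>B 2. int (reduced_exponent k) * v $ k) = int s * reduced_weight v"
    using N unfolding l e reduced_weight_def by simp
  then show "(\<Sum>k\<in>B 2. int (reduced_exponent k) * v $ k) = reduced_weight v" using s_pos by simp
qed

end

section \<open>Sections as polynomials of bounded degree\<close>

context trinomial_action begin

definition denominator :: "(rat ^ 'n \<Rightarrow> rat) \<Rightarrow> 'k poly fract" where
  "denominator m = to_fract (roots_poly s) powi floor_min m 0 * to_fract [:0, 1:] powi floor_min m 1"

lemma roots_poly_ne: "to_fract (roots_poly s :: 'k poly) \<noteq> 0"
  using roots_poly_nonzero[OF s_pos] by simp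

lemma denominator_nonzero: "denominator m \<noteq> 0"
  using roots_poly_ne by (simp add: denominator_def)

lemma ord_at_den:
  "ord_at (Pt z) (denominator m) = (if z ^ s = 1 then floor_min m 0 else if z =
      0 then floor_min m 1 else 0)"
  "ord_at Infinity (denominator m) = - int s * floor_min m 0 - floor_min m 1"
proof -
  have X: "to_fract [:0, 1:] \<noteq> (0 :: 'k poly fract)" by simp
  have *: "ord_at p (denominator m) =
      floor_min m 0 * poly_ord_at p (roots_poly s) + floor_min m 1 * poly_ord_at p [:0, 1:]" for p
    using roots_poly_ne X roots_poly_nonzero[OF s_pos]
    by (simp add: denominator_def ord_at_mult ord_at_power_int ord_at_to_fract)
  have "order z [:0, 1:] = (if z = 0 then 1 else 0)" for z :: 'k
    using order_linear[of z 0] by simp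
  moreover have "z \<noteq> 0" if "z ^ s = 1" for z :: 'k using that s_pos by (auto simp: power_0_left)
  ultimately show "ord_at (Pt z) (denominator m) = (if z ^ s = 1 then floor_min m 0 else if z =
      0 then floor_min m 1 else 0)"
    by (auto simp: * order_roots_poly[OF s_pos])
  show "ord_at Infinity (denominator m) = - int s * floor_min m 0 - floor_min m 1"
    by (simp add: * degree_roots_poly[OF s_pos])
qed

text \<open>Orders are integers, so the minima may be replaced by their floors. After multiplication
  by \<open>denominator m\<close> the conditions at finite points say that the product is a
  polynomial, and the one at infinity bounds its degree.\<close>

lemma sections_\<DD>:
  assumes m: "m \<in> dual_cone N \<sigma>"
  shows "f \<in> sections (divisor_at \<DD> m) \<longleftrightarrow>
    (\<exists>H. (H = 0 \<or> int (degree H) \<le> form_degree m) \<and> f * denominator m = to_fract H)"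
proof (cases "f = 0")
  case True
  then show ?thesis by (auto simp: sections_def intro!: exI[of _ 0])
next
  case f: False
  let ?g = "f * denominator m"
  have g: "?g \<noteq> 0" using f denominator_nonzero by simp
  have floor_min: "0 \<le> of_int a + min_on i m \<longleftrightarrow> 0 \<le> a + floor_min m i" for a i
  proof -
    have "0 \<le> of_int a + min_on i m \<longleftrightarrow> of_int (- a) \<le> min_on i m" by auto
    also have "\<dots> \<longleftrightarrow> - a \<le> floor_min m i" unfolding floor_min_def by (rule le_floor_iff[symmetric])
    finally show ?thesis by auto
  qed
  have ord: "ord_at p ?g = ord_at p f + ord_at p (denominator m)" for p
    using f denominator_nonzero by (rule ord_at_mult)
  have "0 \<le> of_int (ord_at (Pt z) f) + divisor_at \<DD> m (Pt z) \<longleftrightarrow> 0 \<le> ord_at (Pt z) ?g" for z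
    by (simp add: divisor_at_\<DD>[OF m] ord ord_at_den floor_min)
  moreover have "0 \<le> of_int (ord_at Infinity f) + divisor_at \<DD> m Infinity \<longleftrightarrow>
      - form_degree m \<le> ord_at Infinity ?g"
    by (auto simp: divisor_at_\<DD>[OF m] ord ord_at_den floor_min form_degree_def)
  moreover have "(\<forall>p. P p) \<longleftrightarrow> (\<forall>z. P (Pt z)) \<and> P Infinity" for P :: "'k proj_line \<Rightarrow> bool"
    by (metis proj_line.exhaust)
  ultimately have *: "f \<in> sections (divisor_at \<DD> m) \<longleftrightarrow>
      (\<forall>z. 0 \<le> ord_at (Pt z) ?g) \<and> - form_degree m \<le> ord_at Infinity ?g"
    using f by (simp add: sections_def)
  show ?thesis
  proof
    assume "f \<in> sections (divisor_at \<DD> m)"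
    then have nn: "\<And>z. 0 \<le> ord_at (Pt z) ?g" and inf: "- form_degree m \<le> ord_at Infinity ?g"
        using * by blast+
    obtain H where H: "?g = to_fract H" by (rule to_fract_of_ord_at_nonneg[OF g nn])
    then have "H \<noteq> 0" using g by auto
    then have "int (degree H) \<le> form_degree m" using inf by (simp add: H ord_at_to_fract)
    then show "\<exists>H. (H = 0 \<or> int (degree H) \<le> form_degree m) \<and> ?g = to_fract H" using H by blast
  next
    assume "\<exists>H. (H = 0 \<or> int (degree H) \<le> form_degree m) \<and> ?g = to_fract H"
    then obtain H where H: "H = 0 \<or> int (degree H) \<le> form_degree m" "?g = to_fract H" by blast
    then have "H \<noteq> 0" using g by auto
    then show "f \<in> sections (divisor_at \<DD> m)" unfolding * using H by (simp add: ord_at_to_fract)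
  qed
qed

definition numerator :: "(rat ^ 'n \<Rightarrow> rat) \<Rightarrow> 'k poly fract \<Rightarrow> 'k poly" where
  "numerator m f = (THE H. f * denominator m = to_fract H)"

lemma numerator_eqI: "f * denominator m = to_fract H \<Longrightarrow> numerator m f = H"
  unfolding numerator_def by (rule the_equality) simp_all

lemma numerator_section:
  assumes "m \<in> dual_cone N \<sigma>" "f \<in> sections (divisor_at \<DD> m)"
  shows "f * denominator m = to_fract (numerator m f)" "numerator m f =
      0 \<or> int (degree (numerator m f)) \<le> form_degree m"
  using assms(2) numerator_eqI unfolding sections_\<DD>[OF assms(1)] by auto

lemma numerator_zero [simp]: "numerator m 0 = 0"
  by (rule numerator_eqI) simp

lemma numerator_add:
  assumes "m \<in> dual_cone N \<sigma>" "f \<in> sections (divisor_at \<DD> m)" "g \<in> sections (divisor_at \<DD> m)"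
  shows "numerator m (f + g) = numerator m f + numerator m g"
  by (rule numerator_eqI) (simp add: distrib_right numerator_section[OF assms(1,2)]
      numerator_section[OF assms(1,3)])

lemma sections_add:
  assumes "m \<in> dual_cone N \<sigma>" "f \<in> sections (divisor_at \<DD> m)" "g \<in> sections (divisor_at \<DD> m)"
  shows "f + g \<in> sections (divisor_at \<DD> m)"
proof -
  have "(f + g) * denominator m = to_fract (numerator m f + numerator m g)"
    by (simp add: distrib_right numerator_section[OF assms(1,2)] numerator_section[OF assms(1,3)])
  moreover have "numerator m f + numerator m g =
      0 \<or> int (degree (numerator m f + numerator m g)) \<le> form_degree m"
  proof -
    have "degree (numerator m f
        + numerator m g) \<le> max (degree (numerator m f)) (degree (numerator m g))"
      by (rule degree_add_le_max)
    then show ?thesis using numerator_section(2)[OF assms(1,2)] numerator_section(2)[OF assms(1,3)]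
        by (auto simp: max_def split: if_splits)
  qed
  ultimately show ?thesis unfolding sections_\<DD>[OF assms(1)] by blast
qed

text \<open>The finite points outside every possible support of \<open>\<DD>(m)\<close>, where
  sections of all degrees are regular.\<close>

definition generic :: "'k \<Rightarrow> bool" where "generic z \<longleftrightarrow> z \<noteq> 0 \<and> z ^ s \<noteq> 1"

lemma finite_not_good: "finite {z. \<not> generic z}"
proof -
  have "{z. \<not> generic z} = insert 0 {z. z ^ s = 1}" by (auto simp: generic_def)
  then show ?thesis using finite_roots by simp
qed

lemma section_eval:
  assumes "m \<in> dual_cone N \<sigma>" "f \<in> sections (divisor_at \<DD> m)" "generic z"
  shows "regular_at z f"
    "fract_eval z f = poly (numerator m f) z * (1 - z ^ s) powi (- floor_min m 0)
        * z powi (- floor_min m 1)"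
proof -
  have "f = f * denominator m * (to_fract (roots_poly s) powi (- floor_min m 0)
      * to_fract [:0, 1:] powi (- floor_min m 1))"
    using roots_poly_ne by (simp add: denominator_def power_int_minus field_simps)
  then have f: "f = to_fract (numerator m f) * (to_fract (roots_poly s) powi (- floor_min m 0)
      * to_fract [:0, 1:] powi (- floor_min m 1))"
    unfolding numerator_section(1)[OF assms(1,2)] .
  have 1: "poly (roots_poly s) z \<noteq> 0" "poly [:0, 1:] z \<noteq> 0" using assms(3) by (auto simp: generic_def)
  note r = regular_at_to_fract_powi[OF 1(1)] regular_at_to_fract_powi[OF 1(2)]
  show "regular_at z f" by (subst f) (intro regular_at_mult regular_at_to_fract r)
  show "fract_eval z f = poly (numerator m f) z * (1 - z ^ s) powi (- floor_min m 0)
      * z powi (- floor_min m 1)"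
    by (subst f) (simp add: fract_eval_mult regular_at_mult r mult.assoc)
qed

end

section \<open>Polynomial functions on the hypersurface\<close>

lemma generated_algebra_prod:
  "(\<And>i. i \<in> I \<Longrightarrow> f i \<in> generated_algebra G) \<Longrightarrow> (\<lambda>x. \<Prod>i\<in>I. f i x) \<in> generated_algebra G"
proof (induction I rule: infinite_finite_induct)
  case (insert i I)
  then have "(\<lambda>x. f i x * (\<Prod>i\<in>I. f i x)) \<in> generated_algebra G" by (intro generated_algebra.mult) auto
  then show ?case using insert by simp
qed (auto intro: generated_algebra.const)

lemma generated_algebra_sum:
  "(\<And>i. i \<in> I \<Longrightarrow> f i \<in> generated_algebra G) \<Longrightarrow> (\<lambda>x. \<Sum>i\<in>I. f i x) \<in> generated_algebra G"
proof (induction I rule: infinite_finite_induct)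
  case (insert i I)
  then have "(\<lambda>x. f i x + (\<Sum>i\<in>I. f i x)) \<in> generated_algebra G" by (intro generated_algebra.add) auto
  then show ?case using insert by simp
qed (auto intro: generated_algebra.const)

lemma generated_algebra_power:
  "f \<in> generated_algebra G \<Longrightarrow> (\<lambda>x. f x ^ n) \<in> generated_algebra G"
proof (induction n)
  case (Suc n)
  then have "(\<lambda>x. f x * f x ^ n) \<in> generated_algebra G" by (intro generated_algebra.mult) auto
  then show ?case by simp
qed (simp add: generated_algebra.const)

abbreviation polynomial_functions :: "('k::field ^ 'n::finite \<Rightarrow> 'k) set" where
  "polynomial_functions \<equiv> generated_algebra {\<lambda>x. x $ k | k. True}"

lemma coordinate_polynomial_function: "(\<lambda>x. x $ k) \<in> polynomial_functions"
  by (rule generated_algebra.generator) blast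

text \<open>Polynomial functions presented as sums of monomials, so that surjectivity can be proved
  by induction from single monomials.\<close>

inductive_set monomial_span :: "('k::field ^ 'n::finite \<Rightarrow> 'k) set" where
  monomial: "(\<lambda>x. c * (\<Prod>k\<in>UNIV. x $ k ^ a k)) \<in> monomial_span"
| add: "f \<in> monomial_span \<Longrightarrow> g \<in> monomial_span \<Longrightarrow> (\<lambda>x. f x + g x) \<in> monomial_span"

lemma monomial_span_mult:
  assumes "f \<in> monomial_span" "g \<in> monomial_span"
  shows "(\<lambda>x. f x * g x) \<in> monomial_span"
  using assms
proof (induction f rule: monomial_span.induct)
  case (monomial c a)
  from monomial show ?case
  proof (induction g rule: monomial_span.induct)
    case (monomial d b)
    have "(\<lambda>x :: 'a ^ 'b. c * (\<Prod>k\<in>UNIV. x $ k ^ a k) * (d * (\<Prod>k\<in>UNIV. x $ k ^ b k))) =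
        (\<lambda>x. (c * d) * (\<Prod>k\<in>UNIV. x $ k ^ (a k + b k)))"
      by (simp add: power_add prod.distrib mult_ac)
    then show ?case by (simp only: monomial_span.monomial)
  next
    case (add f g)
    then show ?case unfolding distrib_left by (intro monomial_span.add)
  qed
next
  case (add f h)
  then show ?case unfolding distrib_right by (intro monomial_span.add) auto
qed

lemma polynomial_functions_monomial_span: "polynomial_functions \<subseteq> monomial_span"
proof
  fix f :: "'a ^ 'b \<Rightarrow> 'a" assume "f \<in> polynomial_functions"
  then show "f \<in> monomial_span"
  proof (induction f rule: generated_algebra.induct)
    case (generator g)
    then obtain k where g: "g = (\<lambda>x. x $ k)" by blast
    have "(\<Prod>j\<in>UNIV. x $ j ^ (if j = k then 1 else 0)) = x $ k" for x :: "'a ^ 'b"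
      by (subst prod.cong[OF refl, of _ _ "\<lambda>j. if j = k then x $ k else 1"]) auto
    then have "g = (\<lambda>x. 1 * (\<Prod>j\<in>UNIV. x $ j ^ (if j = k then 1 else 0)))" by (simp add: g)
    then show ?case by (simp only: monomial_span.monomial)
  next
    case (const c)
    have "(\<lambda>_. c) = (\<lambda>x :: 'a ^ 'b. c * (\<Prod>j\<in>UNIV. x $ j ^ 0))" by simp
    then show ?case by (simp only: monomial_span.monomial)
  qed (intro monomial_span.add monomial_span_mult; assumption)+
qed

locale trinomial_variety = trinomial_action l blk s S N \<zeta>
  for l :: "'n::finite \<Rightarrow> nat" and blk s S N and \<zeta> :: "'k::{alg_closed_field, field_char_0}" +
  fixes X :: "('k ^ 'n) set"
  assumes X_eq: "X = {x. (\<Prod>k | blk k = 0. x $ k ^ l k) + (\<Prod>k | blk k = 1. x $ k ^ l k)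
    + (\<Prod>k | blk k = 2. x $ k ^ l k) = 0}"
begin

text \<open>The whole first monomial for \<open>i = 0\<close>, and \<open>s\<close>-th roots of the
  second and the third.\<close>

definition block_monomial :: "nat \<Rightarrow> 'k ^ 'n \<Rightarrow> 'k" where "block_monomial i x =
    (\<Prod>k\<in>B i. x $ k ^ reduced_exponent k)"

lemma block_monomial_power: "(\<Prod>k\<in>B i. x $ k ^ l k) = block_monomial i x ^ e i"
proof -
  have "(\<Prod>k\<in>B i. x $ k ^ l k) = (\<Prod>k\<in>B i. (x $ k ^ reduced_exponent k) ^ e i)"
    by (intro prod.cong) (auto simp: reduced_exponent_mult[symmetric] power_mult)
  then show ?thesis by (simp add: block_monomial_def prod_power_distrib)
qed

lemma mem_X: "x \<in> X \<longleftrightarrow> block_monomial 0 x + block_monomial 1 x ^ s + block_monomial 2 x ^ s = 0"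
proof -
  have "x \<in> X \<longleftrightarrow> block_monomial 0 x ^ e 0 + block_monomial 1 x ^ e 1 + block_monomial 2 x ^ e 2 = 0"
    unfolding X_eq block_monomial_power[symmetric] B_def by simp
  then show ?thesis by (simp add: e_def)
qed

section \<open>The torus part and the quotient map\<close>

definition torus_part :: "('k ^ 'n) set" where "torus_part = {x \<in> X. \<forall>k. x $ k \<noteq> 0}"

lemma block_monomial_nonzero: "(\<And>k. x $ k \<noteq> 0) \<Longrightarrow> block_monomial i x \<noteq> 0"
  by (simp add: block_monomial_def)

text \<open>
  With \<open>eps ^ s = - 1\<close>, the zeros of the first monomial lie over the \<open>s\<close>-th roots of unity
  instead of those of \<open>- 1\<close>.
\<close>

definition eps :: 'k where "eps = (SOME y. y ^ s = - 1)"

lemma eps_power: "eps ^ s = - 1"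
  unfolding eps_def by (rule someI_ex) (rule nth_root_exists[OF s_pos])

lemma eps_nonzero: "eps \<noteq> 0"
  using eps_power s_pos by (auto simp: power_0_left)

text \<open>The rational quotient of \<open>X\<close> by the torus, in the chart around 0. It is a
  quotient of two functions of equal weight, hence invariant
  (\<open>quotient_map_act\<close>).\<close>

definition quotient_map :: "'k ^ 'n \<Rightarrow> 'k" where "quotient_map x =
    eps * block_monomial 1 x / block_monomial 2 x"

text \<open>This is the trinomial equation divided by \<open>block_monomial 2 x ^ s\<close>.\<close>

lemma quotient_map_power:
  assumes "x \<in> torus_part"
  shows "1 - quotient_map x ^ s = - block_monomial 0 x / block_monomial 2 x ^ s"
proof -
  have nz: "block_monomial 2 x ^ s \<noteq> 0" using block_monomial_nonzero[of x 2] assms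
      by (simp add: torus_part_def)
  have m: "- block_monomial 0 x = block_monomial 1 x ^ s + block_monomial 2 x ^ s"
    using assms unfolding torus_part_def mem_X by (simp add: minus_unique add.assoc)
  have q: "quotient_map x ^ s = - (block_monomial 1 x ^ s / block_monomial 2 x ^ s)"
    by (simp add: quotient_map_def power_divide power_mult_distrib eps_power)
  show ?thesis unfolding q m using nz by (simp add: add_divide_distrib)
qed

lemma quotient_map_good:
  assumes "x \<in> torus_part"
  shows "generic (quotient_map x)"
proof -
  have "block_monomial i x \<noteq> 0" for i using block_monomial_nonzero[of x i] assms
      by (simp add: torus_part_def)
  then show ?thesis using quotient_map_power[OF assms] eps_nonzero
      by (auto simp: generic_def quotient_map_def)
qed

text \<open>Extracting roots adjusts one coordinate of the first and one of the second block; all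
  other coordinates are 1, so the third block monomial is 1.\<close>

lemma quotient_map_surj:
  assumes "generic z"
  obtains x where "x \<in> torus_part" "quotient_map x = z"
proof -
  obtain k0 where k0: "blk k0 = 0" using blk_surj[of 0] by auto
  obtain k1 where k1: "blk k1 = 1" using blk_surj[of 1] by auto
  obtain y0 where y0: "y0 ^ reduced_exponent k0 = z ^ s - 1"
      using nth_root_exists[OF reduced_exponent_pos] by blast
  obtain y1 where y1: "y1 ^ reduced_exponent k1 = z / eps"
      using nth_root_exists[OF reduced_exponent_pos] by blast
  define x :: "'k ^ 'n" where "x = (\<chi> k. if k = k0 then y0 else if k = k1 then y1 else 1)"
  have ne: "k0 \<noteq> k1" using k0 k1 by auto
  have "y0 \<noteq> 0" using y0 assms reduced_exponent_pos[of k0] by (auto simp: generic_def power_0_left)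
  moreover have "y1 \<noteq> 0" using y1 assms reduced_exponent_pos[of k1] eps_nonzero
      by (auto simp: generic_def power_0_left)
  ultimately have x0: "x $ k \<noteq> 0" for k by (simp add: x_def)
  have "block_monomial 0 x = (\<Prod>k\<in>B 0. if k = k0 then z ^ s - 1 else 1)"
    unfolding block_monomial_def using k1 by (intro prod.cong) (auto simp: x_def y0)
  then have m0: "block_monomial 0 x = z ^ s - 1" using k0 by simp
  have "block_monomial 1 x = (\<Prod>k\<in>B 1. if k = k1 then z / eps else 1)"
    unfolding block_monomial_def using k0 ne by (intro prod.cong) (auto simp: x_def y1)
  then have m1: "block_monomial 1 x = z / eps" using k1 by simp
  have m2: "block_monomial 2 x = 1"
    unfolding block_monomial_def using k0 k1 by (intro prod.neutral) (auto simp: x_def)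
  have "block_monomial 0 x + block_monomial 1 x ^ s + block_monomial 2 x ^ s = 0"
    unfolding m0 m1 m2 by (simp add: power_divide eps_power)
  then have "x \<in> torus_part" using x0 by (simp add: torus_part_def mem_X)
  moreover have "quotient_map x = z" unfolding quotient_map_def m1 m2 using eps_nonzero by simp
  ultimately show ?thesis by (rule that)
qed

text \<open>The sign comes from \<open>quotient_map_power\<close>, the power of \<open>eps\<close>
  from the definition of \<open>quotient_map\<close>. With this scalar \<open>psi_torus_part\<close>
  holds without a constant, as multiplicativity requires.\<close>

definition normalizer :: "(rat ^ 'n \<Rightarrow> rat) \<Rightarrow> 'k" where "normalizer m =
    (- 1) powi floor_min m 0 * eps powi (- floor_min m 1)"

lemma normalizer_nonzero: "normalizer m \<noteq> 0" using eps_nonzero by (simp add: normalizer_def)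

text \<open>The pulled-back section times \<open>chi m\<close> with all negative powers cancelled,
  which makes it a polynomial function. For \<open>m\<close> in the lattice and a section
  \<open>f\<close>, \<open>nat\<close> truncates nothing that matters: \<open>base_exp\<close> is
  nonnegative, and so is \<open>form_degree\<close> unless the numerator is 0.\<close>

definition psi :: "(rat ^ 'n \<Rightarrow> rat) \<Rightarrow> 'k poly fract \<Rightarrow> 'k ^ 'n \<Rightarrow> 'k" where
  "psi m f x = normalizer m * (\<Prod>k\<in>UNIV. x $ k ^ nat (base_exp m k)) *
     hom_eval (nat (form_degree m)) (numerator m f) (eps * block_monomial 1 x) (block_monomial 2 x)"

text \<open>The Laurent monomial of \<open>m \<circ> S\<close>: a function of weight
  \<open>m\<close> without zeros on the torus part. Dividing by it turns functions of degree
  \<open>m\<close> into invariant ones.\<close>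

definition chi :: "(rat ^ 'n \<Rightarrow> rat) \<Rightarrow> 'k ^ 'n \<Rightarrow> 'k" where
  "chi m x = (\<Prod>k\<in>UNIV. x $ k powi exponent m k)"

lemma chi_nonzero: "x \<in> torus_part \<Longrightarrow> chi m x \<noteq> 0"
  by (simp add: chi_def torus_part_def)

lemma chi_split:
  assumes "m \<in> M_lattice N" "x \<in> torus_part"
  shows "chi m x = (\<Prod>k\<in>UNIV. x $ k ^ nat (base_exp m k)) *
    (block_monomial 0 x powi floor_min m 0 * block_monomial 1 x powi floor_min m 1
        * block_monomial 2 x powi floor_min m 2)"
proof -
  have x0: "x $ k \<noteq> 0" for k using assms(2) by (simp add: torus_part_def)
  have "x $ k powi exponent m k =
      x $ k ^ nat (base_exp m k) * (x $ k ^ reduced_exponent k) powi floor_min m (blk k)" for k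
  proof -
    have "exponent m k = base_exp m k + int (reduced_exponent k) * floor_min m (blk k)"
        by (simp add: base_exp_def)
    then have "x $ k powi exponent m k =
        x $ k powi base_exp m k * x $ k powi (int (reduced_exponent k) * floor_min m (blk k))"
      using x0 by (simp add: power_int_add)
    then show ?thesis using base_exp_nonneg[OF assms(1), of k]
      by (simp add: power_int_nonneg_exp power_int_power)
  qed
  then have "chi m x = (\<Prod>k\<in>UNIV. x $ k ^ nat (base_exp m k))
      * (\<Prod>k\<in>UNIV. (x $ k ^ reduced_exponent k) powi floor_min m (blk k))"
    by (simp add: chi_def prod.distrib)
  also have "(\<Prod>k\<in>UNIV. (x $ k ^ reduced_exponent k) powi floor_min m (blk k)) =
      block_monomial 0 x powi floor_min m 0 * block_monomial 1 x powi floor_min m 1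
          * block_monomial 2 x powi floor_min m 2"
  proof -
    have "(\<Prod>k\<in>B i. (x $ k ^ reduced_exponent k) powi floor_min m (blk k)) =
        block_monomial i x powi floor_min m i" for i
      unfolding block_monomial_def prod_powi by (intro prod.cong) auto
    then show ?thesis by (simp only: prod_blocks)
  qed
  finally show ?thesis .
qed

text \<open>Homogenising contributes \<open>u 2\<close> to the power \<open>form_degree m\<close>.
  Its three summands supply the powers of \<open>u 2\<close> that arise from
  \<open>1 - quotient_map x ^ s\<close> and from \<open>quotient_map x\<close>, and the power of the
  third block monomial in \<open>chi_split\<close>.\<close>

lemma psi_torus_part:
  assumes M: "m \<in> M_lattice N" and m: "m \<in> dual_cone N \<sigma>" and f: "f \<in> sections (divisor_at \<DD> m)"
    and x: "x \<in> torus_part"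
  shows "psi m f x = chi m x * fract_eval (quotient_map x) f"
proof (cases "numerator m f = 0")
  case True
  then show ?thesis using section_eval(2)[OF m f quotient_map_good[OF x]] by (simp add: psi_def)
next
  case False
  define u where "u i = block_monomial i x" for i
  have u0: "u i \<noteq> 0" for i using block_monomial_nonzero[of x i] x by (simp add: torus_part_def u_def)
  define a b c where "a = floor_min m 0" and "b = floor_min m 1" and "c = floor_min m 2"
  have deg: "int (degree (numerator m f)) \<le> form_degree m"
      using numerator_section(2)[OF m f] False by simp
  then have "hom_eval (nat (form_degree m)) (numerator m f) (eps * u 1) (u 2) =
      u 2 ^ nat (form_degree m) * poly (numerator m f) (quotient_map x)"
    using u0 by (subst hom_eval_eq) (auto simp: quotient_map_def u_def)
  moreover have "u 2 ^ nat (form_degree m) = u 2 powi form_degree m" using deg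
      by (simp add: power_int_nonneg_exp)
  moreover have "u 2 powi form_degree m = (u 2 ^ s) powi a * u 2 powi b * u 2 powi c"
    using u0 by (simp add: form_degree_def a_def b_def c_def power_int_add power_int_power)
  ultimately have h: "hom_eval (nat (form_degree m)) (numerator m f) (eps * u 1) (u 2) =
    (u 2 ^ s) powi a * u 2 powi b * u 2 powi c * poly (numerator m f) (quotient_map x)" by simp
  have 1: "(1 - quotient_map x ^ s) powi (- a) = (- 1) powi a * (u 2 ^ s) powi a * u 0 powi (- a)"
  proof -
    have "(1 - quotient_map x ^ s) powi (- a) = ((- 1) * u 0 / u 2 ^ s) powi (- a)"
      unfolding quotient_map_power[OF x] by (simp add: u_def)
    also have "\<dots> = (- 1) powi (- a) * u 0 powi (- a) / (u 2 ^ s) powi (- a)"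
      by (simp only: power_int_divide_distrib power_int_mult_distrib)
    also have "(- 1 :: 'k) powi (- a) = (- 1) powi a"
      by (simp add: power_int_minus flip: power_int_inverse)
    finally show ?thesis by (simp add: power_int_minus divide_inverse mult_ac)
  qed
  have 2: "quotient_map x powi (- b) = eps powi (- b) * u 1 powi (- b) * u 2 powi b"
    unfolding quotient_map_def u_def[symmetric] power_int_divide_distrib power_int_mult_distrib
    by (simp add: power_int_minus divide_inverse)
  have "chi m x * fract_eval (quotient_map x) f = (\<Prod>k\<in>UNIV. x $ k ^ nat (base_exp m k)) *
    (u 0 powi a * u 1 powi b * u 2 powi c) * (poly (numerator m f) (quotient_map x) * (1
        - quotient_map x ^ s) powi (- a) * quotient_map x powi (- b))"
    using chi_split[OF M x] section_eval(2)[OF m f quotient_map_good[OF x]]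
    by (simp add: u_def a_def b_def c_def)
  also have "\<dots> = (\<Prod>k\<in>UNIV. x $ k ^ nat (base_exp m k)) * (u 0 powi a * u 0 powi (- a)) * (u 1 powi b
      * u 1 powi (- b)) *
    ((- 1) powi a * eps powi (- b)) * ((u 2 ^ s) powi a * u 2 powi b * u 2 powi c
        * poly (numerator m f) (quotient_map x))"
    unfolding 1 2 by (simp only: mult_ac)
  also have "u 0 powi a * u 0 powi (- a) = 1" using u0 by (simp add: power_int_minus)
  also have "u 1 powi b * u 1 powi (- b) = 1" using u0[of 1] by (simp add: power_int_minus)
  finally show ?thesis unfolding psi_def u_def[symmetric] h normalizer_def a_def b_def by simp
qed

section \<open>Weights under the one-parameter subgroups\<close>

lemma block_monomial_act:
  assumes "v \<in> N" "c \<noteq> 0"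
  shows "block_monomial 0 (one_param_act v c x) =
      c powi (int s * reduced_weight v) * block_monomial 0 x"
    "block_monomial 1 (one_param_act v c x) = c powi reduced_weight v * block_monomial 1 x"
    "block_monomial 2 (one_param_act v c x) = c powi reduced_weight v * block_monomial 2 x"
proof -
  have *: "block_monomial i (one_param_act v c x) =
      c powi (\<Sum>k\<in>B i. int (reduced_exponent k) * v $ k) * block_monomial i x" for i
    unfolding block_monomial_def one_param_act_def vec_lambda_beta
    using assms(2) by (intro power_int_prod_exponents) auto
  show "block_monomial 0 (one_param_act v c x) =
      c powi (int s * reduced_weight v) * block_monomial 0 x"
    "block_monomial 1 (one_param_act v c x) = c powi reduced_weight v * block_monomial 1 x"
    "block_monomial 2 (one_param_act v c x) = c powi reduced_weight v * block_monomial 2 x"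
    unfolding * reduced_exponent_weights[OF assms(1)] by (rule refl)+
qed

lemma act_X: "v \<in> N \<Longrightarrow> c \<noteq> 0 \<Longrightarrow> x \<in> X \<Longrightarrow> one_param_act v c x \<in> X"
proof -
  assume *: "v \<in> N" "c \<noteq> 0" "x \<in> X"
  have "block_monomial 0 (one_param_act v c x) + block_monomial 1 (one_param_act v c x) ^ s
      + block_monomial 2 (one_param_act v c x) ^ s
    = c powi (int s * reduced_weight v) * (block_monomial 0 x + block_monomial 1 x ^ s
        + block_monomial 2 x ^ s)"
    unfolding block_monomial_act[OF *(1,2)]
        by (simp add: power_mult_distrib distrib_left power_int_power' mult.commute)
  then show ?thesis using *(3) by (simp add: mem_X)
qed

lemma act_tor: "v \<in> N \<Longrightarrow> c \<noteq> 0 \<Longrightarrow> x \<in> torus_part \<Longrightarrow> one_param_act v c x \<in> torus_part"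
  using act_X by (simp add: torus_part_def one_param_act_def)

lemma quotient_map_act:
  assumes "v \<in> N" "c \<noteq> 0"
  shows "quotient_map (one_param_act v c x) = quotient_map x"
  unfolding quotient_map_def block_monomial_act[OF assms] using assms(2) by simp

lemma chi_act:
  assumes "m \<in> M_lattice N" "v \<in> N" "c \<noteq> 0"
  shows "chi m (one_param_act v c x) = c powi \<lfloor>m (rat_vec v)\<rfloor> * chi m x"
proof -
  have "chi m (one_param_act v c x) = (\<Prod>k\<in>UNIV. c powi (exponent m k * v $ k)) * chi m x"
    by (simp add: chi_def one_param_act_def power_int_mult_distrib prod.distrib mult.commute flip:
        power_int_mult)
  also have "(\<Prod>k\<in>UNIV. c powi (exponent m k * v $ k)) = c powi (\<Sum>k\<in>UNIV. exponent m k * v $ k)"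
    using assms(3) by (simp add: powi_sum)
  finally show ?thesis unfolding M_lattice_rat_vec[OF assms(1,2)] floor_of_int .
qed

text \<open>The weight removed with the block monomials in \<open>base_exp\<close> returns through
  the degree of the form. The computation uses the formula for \<open>psi\<close>, because the
  comparison with \<open>chi\<close> is confined to the torus part.\<close>

lemma psi_act:
  assumes M: "m \<in> M_lattice N" and m: "m \<in> dual_cone N \<sigma>" and f: "f \<in> sections (divisor_at \<DD> m)"
    and v: "v \<in> N" "c \<noteq> 0"
  shows "psi m f (one_param_act v c x) = c powi \<lfloor>m (rat_vec v)\<rfloor> * psi m f x"
proof (cases "numerator m f = 0")
  case True
  then show ?thesis by (simp add: psi_def)
next
  case False
  let ?y = "one_param_act v c x"
  let ?W = "\<Sum>k\<in>UNIV. int (nat (base_exp m k)) * v $ k"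
  have form_degree: "0 \<le> form_degree m" using numerator_section(2)[OF m f] False by linarith
  have "(\<Prod>k\<in>UNIV. ?y $ k ^ nat (base_exp m k)) = c powi ?W * (\<Prod>k\<in>UNIV. x $ k ^ nat (base_exp m k))"
    unfolding one_param_act_def vec_lambda_beta using v(2) by (intro power_int_prod_exponents) auto
  moreover have "hom_eval (nat (form_degree m)) (numerator m f) (eps
      * block_monomial 1 ?y) (block_monomial 2 ?y) =
      (c powi reduced_weight v) ^ nat (form_degree m)
          * hom_eval (nat (form_degree m)) (numerator m f) (eps
          * block_monomial 1 x) (block_monomial 2 x)"
    unfolding block_monomial_act[OF v] hom_eval_scale[symmetric] by (simp only: mult.left_commute)
  moreover have "(c powi reduced_weight v) ^ nat (form_degree m) =
      c powi (reduced_weight v * form_degree m)"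
    using form_degree by (simp add: power_int_power')
  ultimately have "psi m f ?y = c powi (?W + reduced_weight v * form_degree m) * psi m f x"
    using v(2) by (simp add: psi_def power_int_add mult_ac)
  moreover have "?W + reduced_weight v * form_degree m = (\<Sum>k\<in>UNIV. exponent m k * v $ k)"
  proof -
    have "?W = (\<Sum>k\<in>UNIV. exponent m k * v $ k) - (\<Sum>k\<in>UNIV. floor_min m (blk k)
        * (int (reduced_exponent k) * v $ k))"
      using base_exp_nonneg[OF M]
          by (simp add: base_exp_def left_diff_distrib sum_subtractf mult.assoc)
    also have "(\<Sum>k\<in>UNIV. floor_min m (blk k) * (int (reduced_exponent k) * v $ k)) =
      floor_min m 0 * (int s * reduced_weight v) + floor_min m 1 * reduced_weight v + floor_min m 2
          * reduced_weight v"
    proof -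
      have "(\<Sum>k\<in>B i. floor_min m (blk k) * (int (reduced_exponent k) * v $ k)) =
          floor_min m i * (\<Sum>k\<in>B i. int (reduced_exponent k) * v $ k)" for i
        unfolding sum_distrib_left by (intro sum.cong) auto
      then show ?thesis unfolding sum_blocks by (simp only: reduced_exponent_weights[OF v(1)])
    qed
    finally show ?thesis by (simp add: form_degree_def algebra_simps)
  qed
  ultimately show ?thesis unfolding M_lattice_rat_vec[OF M v(1)] floor_of_int by simp
qed

lemma psi_polynomial_function: "psi m f \<in> polynomial_functions"
proof -
  have block_monomial: "(\<lambda>x. block_monomial i x) \<in> polynomial_functions" for i
    unfolding block_monomial_def
        by (intro generated_algebra_prod generated_algebra_power coordinate_polynomial_function)
  show ?thesis
    unfolding psi_def hom_eval_def
    by (intro generated_algebra.mult generated_algebra.const generated_algebra_prod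
        generated_algebra_sum
      generated_algebra_power coordinate_polynomial_function block_monomial)
qed

lemma psi_zero [simp]: "psi m 0 x = 0" by (simp add: psi_def)

lemma psi_add:
  assumes "m \<in> dual_cone N \<sigma>" "f \<in> sections (divisor_at \<DD> m)" "g \<in> sections (divisor_at \<DD> m)"
  shows "psi m (f + g) x = psi m f x + psi m g x"
  by (simp add: psi_def numerator_add[OF assms] hom_eval_add distrib_left)

text \<open>The forms \<open>a\<close> and \<open>exponent m\<close> agree on \<open>N\<close>, so
  by \<open>forms_vanishing_on_N\<close> they differ by \<alpha> times the reduced exponents. Hence
  the monomial is the one with exponents \<open>base_exp m\<close> times powers \<open>A i\<close>
  of the block monomials. These powers are nonnegative by the maximality of
  \<open>floor_min\<close>, and on \<open>X\<close> their product is, up to a constant, the form of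
  \<open>(1 - t ^ s) ^ A 0 * t ^ A 1\<close>.\<close>

lemma monomial_eq_psi:
  obtains m f where "m \<in> M_lattice N" "m \<in> dual_cone N \<sigma>" "f \<in> sections (divisor_at \<DD> m)"
    "\<And>x. x \<in> X \<Longrightarrow> c * (\<Prod>k\<in>UNIV. x $ k ^ a k) = psi m f x"
proof -
  define m where "m = (\<lambda>q. \<Sum>k\<in>UNIV. of_nat (a k) * coord k q)"
  have coord: "coord k (q + r) = coord k q + coord k r" "coord k (t *s q) = t * coord k q"
    if "q \<in> NQ N" "r \<in> NQ N" for k q r t
    using that by (simp_all add: coord_def NQ_add NQ_scale)
  have MQ: "m \<in> MQ N"
    unfolding MQ_def m_def
    by (simp add: coord distrib_left sum.distrib sum_distrib_left mult.left_commute) (simp add: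
        coord_def)
  have mv: "m (rat_vec v) = of_int (\<Sum>k\<in>UNIV. int (a k) * v $ k)" if "v \<in> N" for v
    using that by (simp add: m_def coord_def NQ_rat_vec)
  have M: "m \<in> M_lattice N" using MQ mv by (auto simp: M_lattice_def simp del: of_int_sum)
  have m: "m \<in> dual_cone N \<sigma>"
    using MQ by (auto simp: dual_cone_def m_def coord_def \<sigma>_def intro!: sum_nonneg)
  have "(\<Sum>k\<in>UNIV. (int (a k) - exponent m k) * v $ k) = 0" if "v \<in> N" for v
    using mv[OF that] M_lattice_rat_vec[OF M that]
    by (simp add: left_diff_distrib sum_subtractf del: of_int_sum)
  then obtain \<alpha> :: "nat \<Rightarrow> int" where \<alpha>: "\<And>k. (int (a k) - exponent m k) * int (e (blk k)) =
      \<alpha> (blk k) * int (l k)"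
    "int s * \<alpha> 0 + \<alpha> 1 + \<alpha> 2 = 0"
    by (rule forms_vanishing_on_N) (assumption, blast)
  have ak: "int (a k) = exponent m k + \<alpha> (blk k) * int (reduced_exponent k)" for k
  proof -
    have "(int (a k) - exponent m k) * int (e (blk k)) =
        \<alpha> (blk k) * int (reduced_exponent k) * int (e (blk k))"
      using \<alpha>(1)[of k] by (simp flip: reduced_exponent_mult[of k])
    then show ?thesis using e_pos[of "blk k"] by simp
  qed
  define A where "A i = nat (floor_min m i + \<alpha> i)" for i
  have A: "int (A i) = floor_min m i + \<alpha> i" if "i < 3" for i
  proof -
    have "- \<alpha> i \<le> floor_min m i"
    proof (rule floor_min_ge[OF M that])
      fix k assume "blk k = i"
      then show "- \<alpha> i * int (reduced_exponent k) \<le> exponent m k" using ak[of k] by simp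
    qed
    then show ?thesis by (simp add: A_def)
  qed
  \<comment> \<open>The linear relation between the \<alpha> makes the three powers fill the degree
    exactly.\<close>
  have form_degree: "form_degree m = int (s * A 0 + A 1 + A 2)"
    using \<alpha>(2) by (simp add: A form_degree_def algebra_simps)
  have ndg: "nat (form_degree m) = s * A 0 + A 1 + A 2" unfolding form_degree by (rule nat_int)
  have ak': "a k = nat (base_exp m k) + A (blk k) * reduced_exponent k" for k
  proof -
    have "int (a k) = base_exp m k + int (A (blk k)) * int (reduced_exponent k)"
      unfolding A[OF blk_less] ak base_exp_def by (simp add: algebra_simps)
    then have "int (a k) = int (nat (base_exp m k) + A (blk k) * reduced_exponent k)"
      using base_exp_nonneg[OF M, of k] by simp
    then show ?thesis by (simp only: of_nat_eq_iff)
  qed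
  \<comment> \<open>Cancels the normalizer and the constants produced by \<open>hom_eval\<close>: on
    \<open>X\<close> its factor \<open>b ^ s - a ^ s\<close> is minus the first block monomial, and
    its argument \<open>a\<close> carries \<open>eps\<close>.\<close>
  define c' where "c' = c / (normalizer m * (- 1) ^ A 0 * eps ^ A 1)"
  define H where "H = smult c' (roots_poly s ^ A 0 * monom 1 (A 1))"
  define f where "f = to_fract H / denominator m"
  have fH: "f * denominator m = to_fract H" using denominator_nonzero by (simp add: f_def)
  then have numerator: "numerator m f = H" by (rule numerator_eqI)
  have "degree H \<le> s * A 0 + A 1"
  proof -
    have "degree H \<le> degree (roots_poly s ^ A 0 * monom 1 (A 1) :: 'k poly)"
      unfolding H_def by (rule degree_smult_le)
    also have "\<dots> \<le> degree (roots_poly s ^ A 0 :: 'k poly) + degree (monom 1 (A 1) :: 'k poly)"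
        by (rule degree_mult_le)
    also have "\<dots> \<le> s * A 0 + A 1"
      using degree_power_le[of "roots_poly s :: 'k poly" "A 0"] degree_monom_le[of "1::'k" "A 1"]
      by (simp add: degree_roots_poly[OF s_pos])
    finally show ?thesis .
  qed
  then have "int (degree H) \<le> form_degree m" unfolding form_degree of_nat_le_iff by linarith
  then have f: "f \<in> sections (divisor_at \<DD> m)" unfolding sections_\<DD>[OF m] using fH by blast
  have "c * (\<Prod>k\<in>UNIV. x $ k ^ a k) = psi m f x" if x: "x \<in> X" for x
  proof -
    have "(\<Prod>k\<in>UNIV. x $ k ^ a k) =
        (\<Prod>k\<in>UNIV. x $ k ^ nat (base_exp m k)) * (\<Prod>k\<in>UNIV. (x $ k ^ reduced_exponent k) ^ A (blk k))"
      unfolding ak' by (simp add: power_add prod.distrib mult.commute flip: power_mult)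
    also have "(\<Prod>k\<in>UNIV. (x $ k ^ reduced_exponent k) ^ A (blk k)) =
        block_monomial 0 x ^ A 0 * block_monomial 1 x ^ A 1 * block_monomial 2 x ^ A 2"
      unfolding prod_blocks block_monomial_def prod_power_distrib by simp
    finally have 1: "(\<Prod>k\<in>UNIV. x $ k ^ a k) = (\<Prod>k\<in>UNIV. x $ k ^ nat (base_exp m k)) *
      (block_monomial 0 x ^ A 0 * block_monomial 1 x ^ A 1 * block_monomial 2 x ^ A 2)" .
    have "block_monomial 2 x ^ s - (eps * block_monomial 1 x) ^ s = (- 1) * block_monomial 0 x"
      using x by (simp add: mem_X power_mult_distrib eps_power) (simp add: algebra_simps
          eq_neg_iff_add_eq_0)
    then have "hom_eval (nat (form_degree m)) (roots_poly s ^ A 0 * monom 1 (A 1)) (eps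
        * block_monomial 1 x) (block_monomial 2 x) =
        ((- 1) * block_monomial 0 x) ^ A 0 * (eps * block_monomial 1 x) ^ A 1
            * block_monomial 2 x ^ A 2"
      by (simp only: hom_eval_roots_poly[OF s_pos ndg])
    moreover have "hom_eval n (smult c' p) y z = c' * hom_eval n p y z" for n p y z
      by (simp add: hom_eval_def sum_distrib_left mult_ac)
    ultimately have "psi m f x = normalizer m * (\<Prod>k\<in>UNIV. x $ k ^ nat (base_exp m k)) *
        (c' * (((- 1) * block_monomial 0 x) ^ A 0 * (eps * block_monomial 1 x) ^ A 1
            * block_monomial 2 x ^ A 2))"
      by (simp add: psi_def numerator H_def)
    also have "\<dots> = (c' * (normalizer m * (- 1) ^ A 0 * eps ^ A 1))
        * ((\<Prod>k\<in>UNIV. x $ k ^ nat (base_exp m k)) *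
      (block_monomial 0 x ^ A 0 * block_monomial 1 x ^ A 1 * block_monomial 2 x ^ A 2))"
      by (simp only: power_mult_distrib mult_ac)
    also have "c' * (normalizer m * (- 1) ^ A 0 * eps ^ A 1) = c"
      using normalizer_nonzero eps_nonzero by (simp add: c'_def)
    finally show ?thesis using 1 by simp
  qed
  then show ?thesis using that M m f by blast
qed

end

section \<open>The isomorphism of graded algebras\<close>

lemma regular_at_diff: "regular_at z f \<Longrightarrow> regular_at z g \<Longrightarrow> regular_at z (f - g)"
  and fract_eval_diff: "regular_at z f \<Longrightarrow> regular_at z g \<Longrightarrow> fract_eval z (f - g) =
      fract_eval z f - fract_eval z g"
  by (auto elim!: regular_atE simp: regular_at_Fract fract_eval_Fract diff_frac_eq)

lemma poly_mapping_sum_single: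
  "g = (\<Sum>m\<in>Poly_Mapping.keys g. Poly_Mapping.single m (Poly_Mapping.lookup g m))"
proof (rule poly_mapping_eqI)
  fix k
  have "Poly_Mapping.lookup (\<Sum>m\<in>Poly_Mapping.keys g. Poly_Mapping.single m (Poly_Mapping.lookup g
      m)) k
    = (\<Sum>m\<in>Poly_Mapping.keys g. if m = k then Poly_Mapping.lookup g k else 0)"
    unfolding lookup_sum by (intro sum.cong) (auto simp: lookup_single when_def)
  then show "Poly_Mapping.lookup g k = Poly_Mapping.lookup
    (\<Sum>m\<in>Poly_Mapping.keys g. Poly_Mapping.single m (Poly_Mapping.lookup g m)) k"
    by (simp add: in_keys_iff)
qed

text \<open>The usual proof for characters. Choose \<open>v\<close> in \<open>N\<close> that
  separates \<open>m\<close> from \<open>m0\<close>, act with its parameter 2 and subtract the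
  multiple of the relation that cancels the term of \<open>m0\<close>. The term of \<open>m\<close>
  is multiplied by a nonzero number; other terms may disappear, which does no harm.\<close>

lemma (in trinomial_geometry) semi_invariants_independent:
  fixes Y :: "('k::field_char_0 ^ 'n) set" and h :: "(rat ^ 'n \<Rightarrow> rat) \<Rightarrow> 'k ^ 'n \<Rightarrow> 'k"
  assumes "finite F" "F \<subseteq> M_lattice N"
    and Y: "\<And>v c x. v \<in> N \<Longrightarrow> c \<noteq> 0 \<Longrightarrow> x \<in> Y \<Longrightarrow> one_param_act v c x \<in> Y"
    and "\<And>m v c x. m \<in> F \<Longrightarrow> v \<in> N \<Longrightarrow> c \<noteq> 0 \<Longrightarrow> x \<in> Y \<Longrightarrow>
      h m (one_param_act v c x) = c powi \<lfloor>m (rat_vec v)\<rfloor> * h m x"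
    and "\<And>x. x \<in> Y \<Longrightarrow> (\<Sum>m\<in>F. h m x) = 0"
    and "m \<in> F" "x \<in> Y"
  shows "h m x = 0"
  using assms(1,2,4-)
proof (induction F arbitrary: h m x rule: finite_induct)
  case (insert m0 F)
  have F: "h m x = 0" if "m \<in> F" "x \<in> Y" for m x
  proof -
    have "m \<noteq> m0" using that(1) insert.hyps by auto
    moreover have "m \<in> M_lattice N" "m0 \<in> M_lattice N" using insert.prems(1) that(1) by auto
    ultimately obtain v where v: "v \<in> N" "\<lfloor>m (rat_vec v)\<rfloor> \<noteq> \<lfloor>m0 (rat_vec v)\<rfloor>"
      using M_lattice_eqI[of m m0] by metis
    define h' where "h' m x = (2 powi \<lfloor>m (rat_vec v)\<rfloor> - 2 powi \<lfloor>m0 (rat_vec v)\<rfloor>) * h m x" for m x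
    have "h' m x = 0"
    proof (rule insert.IH[of h'])
      show "F \<subseteq> M_lattice N" using insert.prems(1) by blast
      show "h' m (one_param_act v c x) = c powi \<lfloor>m (rat_vec v)\<rfloor> * h' m x"
        if "m \<in> F" "v \<in> N" "c \<noteq> 0" "x \<in> Y" for m v c x
        using insert.prems(2)[of m v c x] that by (simp add: h'_def mult.left_commute)
    next
      fix x assume x: "x \<in> Y"
      let ?y = "one_param_act v 2 x"
      have sum: "h m0 x = - (\<Sum>m\<in>F. h m x)" "h m0 ?y = - (\<Sum>m\<in>F. h m ?y)"
        using insert.prems(3)[OF x] insert.prems(3)[of ?y] Y[OF v(1), of 2 x] x insert.hyps
        by (simp_all add: eq_neg_iff_add_eq_0)
      have act: "h m ?y = 2 powi \<lfloor>m (rat_vec v)\<rfloor> * h m x" if "m \<in> insert m0 F" for m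
        using insert.prems(2)[OF that v(1) _ x] by simp
      have "(\<Sum>m\<in>F. h' m x) = (\<Sum>m\<in>F. h m ?y) - 2 powi \<lfloor>m0 (rat_vec v)\<rfloor> * (\<Sum>m\<in>F. h m x)"
        using act by (simp add: h'_def left_diff_distrib sum_subtractf sum_distrib_left)
      also have "\<dots> = - h m0 ?y + 2 powi \<lfloor>m0 (rat_vec v)\<rfloor> * h m0 x"
        unfolding sum by simp
      also have "\<dots> = 0" using act[of m0] by simp
      finally show "(\<Sum>m\<in>F. h' m x) = 0" .
    qed (use that in auto)
    moreover have "(2::'k) powi \<lfloor>m (rat_vec v)\<rfloor> - 2 powi \<lfloor>m0 (rat_vec v)\<rfloor> \<noteq> 0"
      using v(2) two_powi_inject[where 'k = 'k] by auto
    ultimately show ?thesis by (simp add: h'_def)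
  qed
  then have "h m0 x = 0" if "x \<in> Y" for x
    using insert.prems(3)[OF that] insert.hyps that by simp
  then show ?case using F insert.prems(4,5) by auto
qed simp

context trinomial_variety begin

abbreviation lookup where "lookup \<equiv> Poly_Mapping.lookup"
abbreviation keys where "keys \<equiv> Poly_Mapping.keys"

definition sec_alg :: "((rat ^ 'n \<Rightarrow> rat) \<Rightarrow>\<^sub>0 'k poly fract) set" where
  "sec_alg = section_algebra N \<sigma> \<DD>"

text \<open>
  Contains the section algebra and is visibly closed under multiplication, so that the superadditivity
  of \<open>m \<mapsto> \<DD>(m)\<close> is not needed.
\<close>

definition reg_alg :: "((rat ^ 'n \<Rightarrow> rat) \<Rightarrow>\<^sub>0 'k poly fract) set" where
  "reg_alg = {g. keys g \<subseteq> M_lattice N \<and> (\<forall>m z. generic z \<longrightarrow> regular_at z (lookup g m))}"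

text \<open>A ring homomorphism on \<open>reg_alg\<close> by which identities in the monoid algebra
  are tested at points; on sections it agrees with \<open>\<Psi>\<close> over the torus
  part.\<close>

definition torus_eval :: "((rat ^ 'n \<Rightarrow> rat) \<Rightarrow>\<^sub>0 'k poly fract) \<Rightarrow> 'k ^ 'n \<Rightarrow> 'k" where
  "torus_eval g x = (\<Sum>m\<in>keys g. chi m x * fract_eval (quotient_map x) (lookup g m))"

lemma torus_eval_superset:
  "finite F \<Longrightarrow> keys g \<subseteq> F \<Longrightarrow> torus_eval g x =
      (\<Sum>m\<in>F. chi m x * fract_eval (quotient_map x) (lookup g m))"
  unfolding torus_eval_def by (rule sum.mono_neutral_left) (auto simp: in_keys_iff)

lemma reg_alg_add:
  assumes "g \<in> reg_alg" "h \<in> reg_alg"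
  shows "g + h \<in> reg_alg" and "x \<in> torus_part \<Longrightarrow> torus_eval (g + h) x =
      torus_eval g x + torus_eval h x"
proof -
  have keys: "keys (g + h) \<subseteq> keys g \<union> keys h" by (rule keys_add)
  then show "g + h \<in> reg_alg" using assms by (auto simp: reg_alg_def lookup_add intro: regular_at_add)
  assume x: "x \<in> torus_part"
  let ?F = "keys g \<union> keys h"
  have "torus_eval (g + h) x = (\<Sum>m\<in>?F. chi m x * fract_eval (quotient_map x) (lookup (g + h) m))"
    using keys by (intro torus_eval_superset) auto
  also have "\<dots> = (\<Sum>m\<in>?F. chi m x * fract_eval (quotient_map x) (lookup g m) + chi m x
      * fract_eval (quotient_map x) (lookup h m))"
    using assms quotient_map_good[OF x]
        by (simp add: reg_alg_def lookup_add fract_eval_add distrib_left)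
  also have "\<dots> = torus_eval g x + torus_eval h x"
    unfolding sum.distrib by (subst (1 2) torus_eval_superset[of ?F]) auto
  finally show "torus_eval (g + h) x = torus_eval g x + torus_eval h x" .
qed

lemma reg_alg_zero: "0 \<in> reg_alg" "torus_eval 0 x = 0"
  by (simp_all add: reg_alg_def torus_eval_def)

lemma reg_alg_sum:
  assumes "\<And>i. i \<in> I \<Longrightarrow> f i \<in> reg_alg"
  shows "(\<Sum>i\<in>I. f i) \<in> reg_alg \<and> (x \<in> torus_part \<longrightarrow> torus_eval (\<Sum>i\<in>I. f i) x =
      (\<Sum>i\<in>I. torus_eval (f i) x))"
  using assms
  by (induction I rule: infinite_finite_induct) (auto simp: reg_alg_zero reg_alg_add)

lemma reg_alg_single:
  assumes "m \<in> M_lattice N" "\<And>z. generic z \<Longrightarrow> regular_at z f"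
  shows "Poly_Mapping.single m f \<in> reg_alg"
  using assms by (auto simp: reg_alg_def lookup_single when_def)

lemma torus_eval_single: "torus_eval (Poly_Mapping.single m f) x =
    chi m x * fract_eval (quotient_map x) f"
  by (subst torus_eval_superset[of "{m}"]) auto

lemma chi_add:
  assumes "m \<in> M_lattice N" "m' \<in> M_lattice N" "x \<in> torus_part"
  shows "chi (m + m') x = chi m x * chi m' x"
  using assms by (simp add: chi_def exponent_add torus_part_def power_int_add prod.distrib)

lemma reg_alg_mult:
  assumes "g \<in> reg_alg" "h \<in> reg_alg"
  shows "g * h \<in> reg_alg" and "x \<in> torus_part \<Longrightarrow> torus_eval (g * h) x =
      torus_eval g x * torus_eval h x"
proof -
  let ?I = "keys g \<times> keys h"
  define f where "f = (\<lambda>(m, m'). Poly_Mapping.single (m + m') (lookup g m * lookup h m'))"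
  have "g * h = (\<Sum>m\<in>keys g. Poly_Mapping.single m (lookup g m))
      * (\<Sum>m\<in>keys h. Poly_Mapping.single m (lookup h m))"
    by (simp flip: poly_mapping_sum_single)
  then have gh: "g * h = (\<Sum>i\<in>?I. f i)"
    by (simp add: sum_product mult_single sum.cartesian_product f_def)
  have f: "f i \<in> reg_alg" if iI: "i \<in> ?I" for i
  proof -
    obtain m m' where i: "i = (m, m')" "m \<in> keys g" "m' \<in> keys h" using iI by auto
    then have "m + m' \<in> M_lattice N" using assms by (intro M_lattice_add) (auto simp: reg_alg_def)
    moreover have "regular_at z (lookup g m * lookup h m')" if "generic z" for z
      using assms that by (intro regular_at_mult) (auto simp: reg_alg_def)
    ultimately show ?thesis unfolding i(1) f_def by (simp add: reg_alg_single)
  qed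
  show "g * h \<in> reg_alg" unfolding gh using reg_alg_sum[of ?I f] f by blast
  assume x: "x \<in> torus_part"
  have "torus_eval (g * h) x = (\<Sum>i\<in>?I. torus_eval (f i) x)"
    unfolding gh using reg_alg_sum[of ?I f x] f x by blast
  also have "\<dots> = (\<Sum>(m, m')\<in>?I. (chi m x * fract_eval (quotient_map x) (lookup g m)) * (chi m' x
      * fract_eval (quotient_map x) (lookup h m')))"
  proof (rule sum.cong[OF refl], clarify)
    fix m m' assume "m \<in> keys g" "m' \<in> keys h"
    then have "m \<in> M_lattice N" "m' \<in> M_lattice N" using assms by (auto simp: reg_alg_def)
    moreover have "fract_eval (quotient_map x) (lookup g m * lookup h m') =
        fract_eval (quotient_map x) (lookup g m) * fract_eval (quotient_map x) (lookup h m')"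
      using assms quotient_map_good[OF x] by (intro fract_eval_mult) (auto simp: reg_alg_def)
    ultimately show "torus_eval (f (m, m')) x =
        (chi m x * fract_eval (quotient_map x) (lookup g m)) * (chi m' x
        * fract_eval (quotient_map x) (lookup h m'))"
      using x by (simp add: f_def torus_eval_single chi_add mult_ac)
  qed
  also have "\<dots> = torus_eval g x * torus_eval h x"
    by (simp add: torus_eval_def sum_product sum.cartesian_product)
  finally show "torus_eval (g * h) x = torus_eval g x * torus_eval h x" .
qed

text \<open>\<open>chi m\<close> has no zeros on the torus part and \<open>quotient_map\<close>
  reaches every generic value, so \<open>f\<close> vanishes at all but finitely many points.\<close>

lemma eq_zero_of_torus_part:
  assumes "\<And>z. generic z \<Longrightarrow> regular_at z f" "\<And>x. x \<in> torus_part \<Longrightarrow>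
      chi m x * fract_eval (quotient_map x) f = 0"
  shows "f = 0"
proof (rule fract_eq_0_of_eval[OF finite_not_good])
  fix z assume "z \<notin> {z. \<not> generic z}"
  then have z: "generic z" by simp
  then obtain x where x: "x \<in> torus_part" "quotient_map x = z" by (rule quotient_map_surj)
  then have "fract_eval z f = 0" using assms(2)[of x] chi_nonzero[of x m] by simp
  then show "regular_at z f \<and> fract_eval z f = 0" using assms(1)[OF z] by blast
qed

text \<open>The homogeneous parts of the difference are semi-invariants of distinct weights whose
  sum is 0, so each of them vanishes separately.\<close>

lemma torus_eval_inject:
  assumes g: "g \<in> reg_alg" and h: "h \<in> reg_alg" and eq: "\<And>x. x \<in> torus_part \<Longrightarrow> torus_eval g x =
      torus_eval h x"
  shows "g = h"
proof (rule poly_mapping_eqI)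
  fix m
  let ?F = "keys g \<union> keys h"
  have reg: "regular_at z (lookup g m - lookup h m)" if "generic z" for z m
    using g h that by (auto simp: reg_alg_def intro: regular_at_diff)
  show "lookup g m = lookup h m"
  proof (cases "m \<in> ?F")
    case True
    have "chi m x * fract_eval (quotient_map x) (lookup g m - lookup h m) = 0"
        if "x \<in> torus_part" for x
    proof (rule semi_invariants_independent[where F = ?F and Y = torus_part
          and h = "\<lambda>m x. chi m x * fract_eval (quotient_map x) (lookup g m - lookup h m)"])
      show M: "?F \<subseteq> M_lattice N" using g h by (auto simp: reg_alg_def)
      show "chi m (one_param_act v c x)
          * fract_eval (quotient_map (one_param_act v c x)) (lookup g m - lookup h m) =
        c powi \<lfloor>m (rat_vec v)\<rfloor> * (chi m x * fract_eval (quotient_map x) (lookup g m - lookup h m))"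
        if "m \<in> ?F" "v \<in> N" "c \<noteq> 0" for m v c x
      proof -
        have "m \<in> M_lattice N" using M that(1) by blast
        then show ?thesis using that by (simp add: chi_act quotient_map_act)
      qed
      fix x assume x: "x \<in> torus_part"
      have "(\<Sum>m\<in>?F. chi m x * fract_eval (quotient_map x) (lookup g m - lookup h m)) =
        (\<Sum>m\<in>?F. chi m x * fract_eval (quotient_map x) (lookup g m)) - (\<Sum>m\<in>?F. chi m x
            * fract_eval (quotient_map x) (lookup h m))"
        using g h quotient_map_good[OF x]
        by (simp add: reg_alg_def fract_eval_diff right_diff_distrib flip: sum_subtractf)
      also have "\<dots> = torus_eval g x - torus_eval h x" by (subst (1 2) torus_eval_superset[of ?F]) auto
      finally show "(\<Sum>m\<in>?F. chi m x * fract_eval (quotient_map x) (lookup g m - lookup h m)) = 0"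
        using eq[OF x] by simp
    qed (use True that act_tor in auto)
    then have "lookup g m - lookup h m = 0" using reg by (intro eq_zero_of_torus_part) auto
    then show ?thesis by simp
  qed (simp add: in_keys_iff)
qed

section \<open>From the section algebra to functions on the hypersurface\<close>

lemma sec_alg_lookup:
  assumes "g \<in> sec_alg" "m \<in> keys g"
  shows "m \<in> M_lattice N" "m \<in> dual_cone N \<sigma>" "lookup g m \<in> sections (divisor_at \<DD> m)"
  using assms unfolding sec_alg_def section_algebra_def by (auto simp: in_keys_iff split: if_splits)

lemma zero_in_sections: "0 \<in> sections D"
  by (simp add: sections_def)

lemma sec_algI:
  assumes "\<And>m. m \<in> keys g \<Longrightarrow>
      m \<in> M_lattice N \<and> m \<in> dual_cone N \<sigma> \<and> lookup g m \<in> sections (divisor_at \<DD> m)"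
  shows "g \<in> sec_alg"
  unfolding sec_alg_def section_algebra_def
proof clarify
  fix m
  show "if m \<in> dual_cone N \<sigma> \<inter> M_lattice N then lookup g m \<in> sections (divisor_at \<DD> m) else lookup g
      m = 0"
    using assms[of m] zero_in_sections by (cases "m \<in> keys g") (auto simp: in_keys_iff)
qed

lemma sec_alg_reg_alg: "g \<in> sec_alg \<Longrightarrow> g \<in> reg_alg"
proof -
  assume g: "g \<in> sec_alg"
  have "regular_at z (lookup g m)" if "generic z" for m z
    using section_eval(1)[OF _ _ that] sec_alg_lookup[OF g, of m]
    by (cases "m \<in> keys g") (auto simp: in_keys_iff)
  then show ?thesis using sec_alg_lookup[OF g] by (auto simp: reg_alg_def)
qed

lemma sec_alg_add:
  assumes "g \<in> sec_alg" "h \<in> sec_alg"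
  shows "g + h \<in> sec_alg"
proof -
  have sec: "lookup g m \<in> sections (divisor_at \<DD> m)" if "g \<in> sec_alg" for g m
    using sec_alg_lookup(3)[OF that, of m] zero_in_sections
        by (cases "m \<in> keys g") (auto simp: in_keys_iff)
  show ?thesis
  proof (rule sec_algI)
    fix m assume "m \<in> keys (g + h)"
    then have "m \<in> keys g \<or> m \<in> keys h" using keys_add[of g h] by blast
    then have m: "m \<in> M_lattice N" "m \<in> dual_cone N \<sigma>" using assms sec_alg_lookup by blast+
    then show "m \<in> M_lattice N \<and> m \<in> dual_cone N \<sigma> \<and> lookup (g + h) m \<in> sections (divisor_at \<DD> m)"
      using sections_add[OF m(2)] sec assms by (simp add: lookup_add)
  qed
qed

definition \<Psi> :: "((rat ^ 'n \<Rightarrow> rat) \<Rightarrow>\<^sub>0 'k poly fract) \<Rightarrow> 'k ^ 'n \<Rightarrow> 'k" where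
  "\<Psi> g = on_variety X (\<lambda>x. \<Sum>m\<in>keys g. psi m (lookup g m) x)"

lemma \<Psi>_superset:
  "finite F \<Longrightarrow> keys g \<subseteq> F \<Longrightarrow> x \<in> X \<Longrightarrow> \<Psi> g x = (\<Sum>m\<in>F. psi m (lookup g m) x)"
  unfolding \<Psi>_def on_variety_def by (simp, rule sum.mono_neutral_left) (auto simp: in_keys_iff)

lemma \<Psi>_torus_part:
  assumes "g \<in> sec_alg" "x \<in> torus_part"
  shows "\<Psi> g x = torus_eval g x"
proof -
  have "x \<in> X" using assms(2) by (simp add: torus_part_def)
  then show ?thesis unfolding \<Psi>_def torus_eval_def on_variety_def
    using assms sec_alg_lookup[OF assms(1)] by (simp add: psi_torus_part)
qed

lemma \<Psi>_coordinate_ring: "\<Psi> g \<in> coordinate_ring X"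
  unfolding \<Psi>_def coordinate_ring_def
  by (intro imageI generated_algebra_sum psi_polynomial_function)

text \<open>Single monomials come from \<open>monomial_eq_psi\<close>, and sums stay in the image
  because each \<open>psi m\<close> is additive on sections.\<close>

lemma \<Psi>_surj:
  assumes "f \<in> coordinate_ring X"
  shows "\<exists>g\<in>sec_alg. f = \<Psi> g"
proof -
  obtain p where p: "p \<in> polynomial_functions" "f = on_variety X p"
    using assms by (auto simp: coordinate_ring_def)
  have "p \<in> monomial_span" using p(1) polynomial_functions_monomial_span by blast
  then have "\<exists>g\<in>sec_alg. \<forall>x\<in>X. p x = \<Psi> g x"
  proof (induction p rule: monomial_span.induct)
    case (monomial c a)
    obtain m f where m: "m \<in> M_lattice N" "m \<in> dual_cone N \<sigma>" "f \<in> sections (divisor_at \<DD> m)"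
      "\<And>x. x \<in> X \<Longrightarrow> c * (\<Prod>k\<in>UNIV. x $ k ^ a k) = psi m f x"
      by (rule monomial_eq_psi[of c a]) blast
    have "Poly_Mapping.single m f \<in> sec_alg"
      using m(1-3) by (intro sec_algI) (auto split: if_splits)
    moreover have "\<Psi> (Poly_Mapping.single m f) x = psi m f x" if "x \<in> X" for x
      using \<Psi>_superset[of "{m}" "Poly_Mapping.single m f" x] that by simp
    ultimately show ?case using m(4) by (intro bexI[of _ "Poly_Mapping.single m f"]) auto
  next
    case (add p q)
    then obtain g h where g: "g \<in> sec_alg" "\<forall>x\<in>X. p x = \<Psi> g x" and h: "h \<in> sec_alg" "\<forall>x\<in>X. q x =
        \<Psi> h x"
      by blast
    have "\<Psi> (g + h) x = \<Psi> g x + \<Psi> h x" if x: "x \<in> X" for x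
    proof -
      let ?F = "keys g \<union> keys h"
      have psi: "psi m (lookup g m + lookup h m) x = psi m (lookup g m) x + psi m (lookup h m) x"
          if "m \<in> ?F" for m
      proof (cases "m \<in> keys g \<and> m \<in> keys h")
        case True
        then show ?thesis using sec_alg_lookup[OF g(1)] sec_alg_lookup[OF h(1)]
            by (intro psi_add) auto
      qed (auto simp: in_keys_iff)
      have "\<Psi> (g + h) x = (\<Sum>m\<in>?F. psi m (lookup (g + h) m) x)"
        using keys_add[of g h] x by (intro \<Psi>_superset) auto
      also have "\<dots> = (\<Sum>m\<in>?F. psi m (lookup g m) x) + (\<Sum>m\<in>?F. psi m (lookup h m) x)"
        using psi by (simp add: lookup_add flip: sum.distrib)
      also have "\<dots> = \<Psi> g x + \<Psi> h x"
        using x by (subst (1 2) \<Psi>_superset[of ?F]) auto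
      finally show ?thesis .
    qed
    then show ?case using g h sec_alg_add by (intro bexI[of _ "g + h"]) auto
  qed
  then show ?thesis using p(2) by (auto simp: \<Psi>_def on_variety_def fun_eq_iff)
qed

lemma \<Psi>_inj: "inj_on \<Psi> sec_alg"
proof
  fix g h assume "g \<in> sec_alg" "h \<in> sec_alg" "\<Psi> g = \<Psi> h"
  then show "g = h" using \<Psi>_torus_part by (intro torus_eval_inject sec_alg_reg_alg) metis+
qed

lemma \<Psi>_bij: "bij_betw \<Psi> sec_alg (coordinate_ring X)"
  unfolding bij_betw_def using \<Psi>_inj \<Psi>_coordinate_ring \<Psi>_surj by blast

section \<open>The inverse map and its compatibility with the grading\<close>

definition \<Phi> :: "('k ^ 'n \<Rightarrow> 'k) \<Rightarrow> (rat ^ 'n \<Rightarrow> rat) \<Rightarrow>\<^sub>0 'k poly fract" where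
  "\<Phi> = inv_into sec_alg \<Psi>"

lemma \<Phi>_bij: "bij_betw \<Phi> (coordinate_ring X) sec_alg"
  unfolding \<Phi>_def by (rule bij_betw_inv_into[OF \<Psi>_bij])

lemma \<Phi>_sec_alg: "f \<in> coordinate_ring X \<Longrightarrow> \<Phi> f \<in> sec_alg"
  using \<Phi>_bij by (auto simp: bij_betw_def)

lemma \<Psi>_\<Phi>: "f \<in> coordinate_ring X \<Longrightarrow> \<Psi> (\<Phi> f) = f"
  unfolding \<Phi>_def using \<Psi>_bij by (rule bij_betw_inv_into_right)

lemma torus_eval_\<Phi>: "f \<in> coordinate_ring X \<Longrightarrow> x \<in> torus_part \<Longrightarrow> torus_eval (\<Phi> f) x = f x"
  using \<Psi>_torus_part[OF \<Phi>_sec_alg, of f x] \<Psi>_\<Phi>[of f] by simp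

text \<open>Values on the torus part determine an element even within \<open>reg_alg\<close>. So
  \<open>g\<close> may be a product of images whose membership in the section algebra is not yet
  known, which is how the ring laws are obtained.\<close>

lemma \<Phi>_eqI:
  assumes "f \<in> coordinate_ring X" "g \<in> reg_alg" "\<And>x. x \<in> torus_part \<Longrightarrow> torus_eval g x = f x"
  shows "\<Phi> f = g"
  using assms(3) torus_eval_\<Phi>[OF assms(1)]
  by (intro torus_eval_inject sec_alg_reg_alg[OF \<Phi>_sec_alg[OF assms(1)]] assms(2)) simp

lemma coordinate_ring_add: "f \<in> coordinate_ring X \<Longrightarrow> g \<in> coordinate_ring X \<Longrightarrow> f + g \<in> coordinate_ring X"
  and coordinate_ring_mult: "f \<in> coordinate_ring X \<Longrightarrow> g \<in> coordinate_ring X \<Longrightarrow>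
      f * g \<in> coordinate_ring X"
proof -
  assume "f \<in> coordinate_ring X" "g \<in> coordinate_ring X"
  then obtain p q where p: "p \<in> polynomial_functions" "f = on_variety X p"
    and q: "q \<in> polynomial_functions" "g = on_variety X q" by (auto simp: coordinate_ring_def)
  have "f + g = on_variety X (\<lambda>x. p x + q x)" by (auto simp: p q on_variety_def)
  then show "f + g \<in> coordinate_ring X"
    using p(1) q(1) by (auto simp: coordinate_ring_def intro: generated_algebra.add)
  have "f * g = on_variety X (\<lambda>x. p x * q x)" by (auto simp: p q on_variety_def)
  then show "f * g \<in> coordinate_ring X"
    using p(1) q(1) by (auto simp: coordinate_ring_def intro: generated_algebra.mult)
qed

lemma \<Phi>_const: "\<Phi> (on_variety X (\<lambda>_. c)) = Poly_Mapping.single 0 (to_fract [:c:])"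
proof (rule \<Phi>_eqI)
  show "on_variety X (\<lambda>_. c) \<in> coordinate_ring X"
    unfolding coordinate_ring_def by (intro imageI generated_algebra.const)
  show "Poly_Mapping.single 0 (to_fract [:c:]) \<in> reg_alg"
    by (intro reg_alg_single M_lattice_zero) simp
  fix x assume "x \<in> torus_part"
  moreover have "chi 0 x = 1" by (simp add: chi_def exponent_def)
  ultimately show "torus_eval (Poly_Mapping.single 0 (to_fract [:c:])) x = on_variety X (\<lambda>_. c) x"
    by (simp add: torus_eval_single on_variety_def torus_part_def)
qed

text \<open>One direction is \<open>psi_act\<close>. For the other, \<open>f\<close> minus its part
  of degree \<open>m\<close> has weight \<open>m\<close> and equals the sum of the remaining parts,
  which have other weights; independence makes them vanish.\<close>

lemma weight_space_iff:
  assumes M: "m \<in> M_lattice N" and f: "f \<in> coordinate_ring X"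
  shows "f \<in> weight_space N X m \<longleftrightarrow> (\<forall>m'. m' \<noteq> m \<longrightarrow> lookup (\<Phi> f) m' = 0)"
proof
  define g where "g = \<Phi> f"
  have g: "g \<in> sec_alg" and fg: "f = \<Psi> g" using \<Phi>_sec_alg[OF f] \<Psi>_\<Phi>[OF f] by (simp_all add: g_def)
  note sec = sec_alg_lookup[OF g]
  {
    assume *: "\<forall>m'. m' \<noteq> m \<longrightarrow> lookup (\<Phi> f) m' = 0"
    have fx: "f x = psi m (lookup g m) x" if "x \<in> X" for x
      unfolding fg using * that by (subst \<Psi>_superset[of "{m}"]) (auto simp: g_def in_keys_iff)
    have "f (one_param_act v c x) = c powi \<lfloor>m (rat_vec v)\<rfloor> * f x" if "v \<in> N" "c \<noteq> 0" "x \<in> X" for v c x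
    proof (cases "m \<in> keys g")
      case True
      then show ?thesis using sec[OF True] that by (simp add: fx act_X psi_act)
    next
      case False
      then show ?thesis using that by (simp add: fx act_X in_keys_iff)
    qed
    then show "f \<in> weight_space N X m" using f by (simp add: weight_space_def)
  next
    assume w: "f \<in> weight_space N X m"
    show "\<forall>m'. m' \<noteq> m \<longrightarrow> lookup (\<Phi> f) m' = 0"
    proof (intro allI impI, rule ccontr)
      fix m' assume m': "m' \<noteq> m" "lookup (\<Phi> f) m' \<noteq> 0"
      then have k: "m' \<in> keys g" by (simp add: in_keys_iff g_def)
      define h where "h m x = psi m (lookup g m) x" for m x
      \<comment> \<open>Absorbs \<open>- f\<close> into the term of weight \<open>m\<close>: the
        terms now add up to 0 and the weights stay distinct.\<close>
      define h' where "h' = (\<lambda>i x. if i = m then h m x - f x else h i x)"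
      have hact: "h i (one_param_act v c x) = c powi \<lfloor>i (rat_vec v)\<rfloor> * h i x"
        if "v \<in> N" "c \<noteq> 0" for i v c x
        using sec[of i] that by (cases "i \<in> keys g") (auto simp: h_def psi_act in_keys_iff)
      \<comment> \<open>\<open>f\<close> contributes in degree \<open>m\<close> even if
        \<open>m\<close> is not a key of \<open>g\<close>.\<close>
      let ?F = "insert m (keys g)"
      have "h' m' x = 0" if x: "x \<in> torus_part" for x
      proof (rule semi_invariants_independent[where F = ?F and Y = torus_part])
        show "?F \<subseteq> M_lattice N" using M sec by blast
        fix i v c x assume i: "i \<in> ?F" "v \<in> N" "c \<noteq> (0 :: 'k)" "x \<in> torus_part"
        then have "f (one_param_act v c x) = c powi \<lfloor>m (rat_vec v)\<rfloor> * f x"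
          using w by (simp add: weight_space_def torus_part_def)
        then show "h' i (one_param_act v c x) = c powi \<lfloor>i (rat_vec v)\<rfloor> * h' i x"
          using hact[OF i(2,3)] by (simp add: h'_def right_diff_distrib)
      next
        fix x assume "x \<in> torus_part"
        then have "f x = (\<Sum>i\<in>?F. h i x)"
          unfolding fg h_def by (intro \<Psi>_superset) (auto simp: torus_part_def)
        also have "\<dots> = h m x + (\<Sum>i\<in>?F - {m}. h i x)" by (rule sum.remove) auto
        finally have "f x = h m x + (\<Sum>i\<in>?F - {m}. h i x)" .
        moreover have "(\<Sum>i\<in>?F. h' i x) = h' m x + (\<Sum>i\<in>?F - {m}. h' i x)" by (rule sum.remove) auto
        moreover have "(\<Sum>i\<in>?F - {m}. h' i x) = (\<Sum>i\<in>?F - {m}. h i x)"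
          by (intro sum.cong) (auto simp: h'_def)
        ultimately show "(\<Sum>i\<in>?F. h' i x) = 0" by (simp add: h'_def)
      qed (use x k act_tor in auto)
      then have "chi m' x * fract_eval (quotient_map x) (lookup g m') = 0" if "x \<in> torus_part" for x
        using that m'(1) psi_torus_part[OF sec[OF k] that] by (simp add: h'_def h_def)
      moreover have "regular_at z (lookup g m')" if "generic z" for z
        using section_eval(1)[OF sec(2,3)[OF k] that] .
      ultimately have "lookup g m' = 0" by (intro eq_zero_of_torus_part)
      then show False using m'(2) by (simp add: g_def)
    qed
  }
qed

theorem corresponds_to_action_\<DD>: "corresponds_to_action N X \<sigma> \<DD>"
  unfolding corresponds_to_action_def
proof (intro exI conjI ballI allI)
  show "bij_betw \<Phi> (coordinate_ring X) (section_algebra N \<sigma> \<DD>)"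
    using \<Phi>_bij by (simp add: sec_alg_def)
next
  fix f g assume f: "f \<in> coordinate_ring X" and g: "g \<in> coordinate_ring X"
  note reg = sec_alg_reg_alg[OF \<Phi>_sec_alg[OF f]] sec_alg_reg_alg[OF \<Phi>_sec_alg[OF g]]
  show "\<Phi> (f + g) = \<Phi> f + \<Phi> g"
    by (intro \<Phi>_eqI coordinate_ring_add f g reg_alg_add reg) (simp add: reg_alg_add reg torus_eval_\<Phi>
        f g)
  show "\<Phi> (f * g) = \<Phi> f * \<Phi> g"
    by (intro \<Phi>_eqI coordinate_ring_mult f g reg_alg_mult reg) (simp add: reg_alg_mult reg
        torus_eval_\<Phi> f g)
next
  fix c show "\<Phi> (on_variety X (\<lambda>_. c)) = Poly_Mapping.single 0 (Fraction_Field.Fract [:c:] 1)"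
    using \<Phi>_const by (simp add: to_fract_def)
next
  fix m f assume "m \<in> M_lattice N" "f \<in> coordinate_ring X"
  then show "f \<in> weight_space N X m \<longleftrightarrow> (\<forall>m'. m' \<noteq> m \<longrightarrow> lookup (\<Phi> f) m' = 0)"
    by (rule weight_space_iff)
qed

end

section \<open>From the three index types to blocks\<close>

lemma sum3_cases:
  obtains i where "k = Inl i" | j where "k = Inr (Inl j)" | j where "k = Inr (Inr j)"
  by (metis sum.exhaust)

theorem proposition5p5:
  fixes l0 :: "'a::finite \<Rightarrow> nat" and l1 :: "'b::finite \<Rightarrow> nat" and l2 :: "'c::finite \<Rightarrow> nat"
    and d0 d1 d2 d s :: nat
    and N :: "(int ^ ('a + 'b + 'c)) set"
    and X :: "('k::{alg_closed_field, field_char_0} ^ ('a + 'b + 'c)) set"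
    and S :: "int ^ ('a + 'b + 'c) \<Rightarrow> int ^ ('a + 'b + 'c)"
    and \<sigma> \<Delta>0 \<Delta>1 \<Delta>2 :: "(rat ^ ('a + 'b + 'c)) set"
    and \<zeta> :: 'k
  assumes "\<And>j. l0 j > 0" and "\<And>j. l1 j > 0" and "\<And>j. l2 j > 0"
    and "\<not> (CARD('a) = 1 \<and> (\<forall>j. l0 j = 1))"
    and "\<not> (CARD('b) = 1 \<and> (\<forall>j. l1 j = 1))"
    and "\<not> (CARD('c) = 1 \<and> (\<forall>j. l2 j = 1))"
    and "d0 = Gcd (range l0)" and "d1 = Gcd (range l1)" and "d2 = Gcd (range l2)"
    and "d = gcd d0 (gcd d1 d2)"
    and "d = 1"
    and "gcd (d0 div d) (d1 div d) = 1"
    and "gcd (d0 div d) (d2 div d) = 1"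
    and "gcd (d1 div d) (d2 div d) = s"
    and "X = trinomial_hypersurface l0 l1 l2"
    and "N = trinomial_lattice l0 l1 l2"
    and "lattice_retraction N S"
    and "\<sigma> = rat_extension S ` ({q. \<forall>k. 0 \<le> q $ k} \<inter> NQ N)"
    and "primitive_root_of_unity s \<zeta>"
    and "\<Delta>0 = rat_convex_hull
           {rat_extension S ((1 / of_nat (l0 j)) *s axis (Inl j) 1) | j. True} + \<sigma>"
    and "\<Delta>1 = rat_convex_hull
           {rat_extension S ((of_nat s / of_nat (l1 j)) *s axis (Inr (Inl j)) 1) | j. True} + \<sigma>"
    and "\<Delta>2 = rat_convex_hull
           {rat_extension S ((of_nat s / of_nat (l2 j)) *s axis (Inr (Inr j)) 1) | j. True} + \<sigma>"
  defines "\<DD> \<equiv> [(\<Delta>0, \<Sum>k<s. prime_divisor (Pt (\<zeta> ^ k))),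
                (\<Delta>1, prime_divisor (Pt 0)),
                (\<Delta>2, prime_divisor Infinity)]"
  shows "pp_divisor N \<sigma> \<DD> \<and> corresponds_to_action N X \<sigma> \<DD>"
proof -
  define l :: "'a + 'b + 'c \<Rightarrow> nat" where "l = case_sum l0 (case_sum l1 l2)"
  define blk :: "'a + 'b + 'c \<Rightarrow> nat" where "blk = case_sum (\<lambda>_. 0) (case_sum (\<lambda>_. 1) (\<lambda>_. 2))"
  have l_simps [simp]: "l (Inl i) = l0 i" "l (Inr (Inl j)) = l1 j" "l (Inr (Inr k)) = l2 k" for i j k
    by (simp_all add: l_def)
  have blk: "{k. blk k = 0} = range Inl" "{k. blk k = 1} = range (\<lambda>j. Inr (Inl j))"
    "{k. blk k = 2} = range (\<lambda>j. Inr (Inr j))"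
  proof -
    have "blk k = 0 \<longleftrightarrow> k \<in> range Inl" "blk k = 1 \<longleftrightarrow> k \<in> range (\<lambda>j. Inr (Inl j))"
      "blk k = 2 \<longleftrightarrow> k \<in> range (\<lambda>j. Inr (Inr j))" for k
      by (cases k rule: sum3_cases; auto simp: blk_def)+
    then show "{k. blk k = 0} = range Inl" "{k. blk k = 1} = range (\<lambda>j. Inr (Inl j))"
      "{k. blk k = 2} = range (\<lambda>j. Inr (Inr j))"
      by (simp_all only: set_eq_iff mem_Collect_eq simp_thms)
  qed
  have d1: "d = 1" by fact
  have gcds: "gcd d0 d1 = 1" "gcd d0 d2 = 1" "gcd d1 d2 = s"
    using assms(12-14) by (simp_all add: d1)
  interpret V: trinomial_variety l blk s S N \<zeta> X
  proof unfold_locales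
    show "0 < l k" for k
      by (cases k rule: sum3_cases) (simp_all add: assms(1-3))
    show "blk k < 3" for k by (cases k rule: sum3_cases) (simp_all add: blk_def)
    show "\<exists>k. blk k = i" if "i < 3" for i
    proof -
      have "i = 0 \<or> i = 1 \<or> i = 2" using that by linarith
      then have "{k. blk k = i} \<noteq> {}" using blk by fastforce
      then show ?thesis by blast
    qed
    show "gcd (Gcd (l ` {k. blk k = 0})) (Gcd (l ` {k. blk k = 1})) = 1"
      "gcd (Gcd (l ` {k. blk k = 0})) (Gcd (l ` {k. blk k = 2})) = 1"
      "gcd (Gcd (l ` {k. blk k = 1})) (Gcd (l ` {k. blk k = 2})) = s"
      unfolding blk image_image l_simps using gcds by (simp_all add: assms(7-9))
    show "N = {v. (\<Sum>k | blk k = 1. int (l k) * v $ k) = (\<Sum>k | blk k = 0. int (l k) * v $ k) \<and>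
                  (\<Sum>k | blk k = 2. int (l k) * v $ k) = (\<Sum>k | blk k = 0. int (l k) * v $ k)}"
      unfolding blk by (auto simp: assms(16) trinomial_lattice_iff sum.reindex inj_on_def)
    show "lattice_retraction N S" by fact
    show "primitive_root_of_unity s \<zeta>" by fact
    show "X = {x. (\<Prod>k | blk k = 0. x $ k ^ l k) + (\<Prod>k | blk k = 1. x $ k ^ l k)
      + (\<Prod>k | blk k = 2. x $ k ^ l k) = 0}"
      unfolding blk by (simp add: assms(15) trinomial_hypersurface_def prod.reindex inj_on_def)
  qed
  have \<sigma>: "\<sigma> = V.\<sigma>" unfolding assms(18) by (rule V.image_ext_orthant)
  have \<Delta>: "\<Delta>0 = V.\<Delta> 0" "\<Delta>1 = V.\<Delta> 1" "\<Delta>2 = V.\<Delta> 2"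
    unfolding assms(20-22) V.\<Delta>_def \<sigma> V.B_def blk image_image V.vertex_def
    by (simp_all add: V.e_def blk_def full_SetCompr_eq)
  have "\<DD> = V.\<DD>" by (simp add: assms(23) V.\<DD>_def \<Delta>)
  then show ?thesis
    using V.pp_divisor_\<DD> V.corresponds_to_action_\<DD> by (simp add: \<sigma>)
qed

end
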